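(* Let $N\ge 3$ be an integer, let $\alpha>-2$ be real, and let $p$ be a real number satisfying $$1<p<\frac{N+2\alpha+2}{N-2}.$$ Then the equation $$-\Delta u=|x|^\alpha u^p\quad\text{in }\mathbb{R}^N$$ does not admit any positive solution.
   Context: A solution of $-\Delta u=|x|^\alpha u^p$ in $\mathbb{R}^N$ means a function $u\in H^1_{\rm loc}(\mathbb{R}^N)\cap L^\infty_{\rm loc}(\mathbb{R}^N)$ that satisfies the equation in the weak sense in $\mathbb{R}^N$. *)

theory Defs
  imports "HOL-Analysis.Analysis"
begin

primrec Ck :: "nat \<Rightarrow> (real ^ 'n \<Rightarrow> real) \<Rightarrow> bool" where
  "Ck 0 f \<longleftrightarrow> continuous_on UNIV f"
| "Ck (Suc k) f \<longleftrightarrow> (\<forall>x. f differentiable (at x)) \<and>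
     (\<forall>v. Ck k (\<lambda>x. frechet_derivative f (at x) v))"

definition test_function :: "(real ^ 'n \<Rightarrow> real) \<Rightarrow> bool" where
  "test_function \<phi> \<longleftrightarrow> (\<forall>k. Ck k \<phi>) \<and> compact (closure {x. \<phi> x \<noteq> 0})"

definition grad :: "(real ^ 'n \<Rightarrow> real) \<Rightarrow> real ^ 'n \<Rightarrow> real ^ 'n" where
  "grad \<phi> x = (\<chi> i. frechet_derivative \<phi> (at x) (axis i 1))"

text \<open>
  The local Lebesgue spaces below consist of functions rather than of classes modulo equality
  almost everywhere; all notions are invariant under changes on null sets.
\<close>

definition L1_loc :: "(real ^ 'n \<Rightarrow> 'b::euclidean_space) set" where
  "L1_loc = {u \<in> borel_measurable lebesgue.
     \<forall>K. compact K \<longrightarrow> set_integrable lebesgue K u}"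

definition L2_loc :: "(real ^ 'n \<Rightarrow> 'b::euclidean_space) set" where
  "L2_loc = {u \<in> borel_measurable lebesgue.
     \<forall>K. compact K \<longrightarrow> set_integrable lebesgue K (\<lambda>x. (norm (u x))\<^sup>2)}"

definition Linf_loc :: "(real ^ 'n \<Rightarrow> real) set" where
  "Linf_loc = {u \<in> borel_measurable lebesgue.
     \<forall>K. compact K \<longrightarrow> (\<exists>M. AE x in lebesgue. x \<in> K \<longrightarrow> \<bar>u x\<bar> \<le> M)}"

definition has_weak_gradient :: "(real ^ 'n \<Rightarrow> real) \<Rightarrow> (real ^ 'n \<Rightarrow> real ^ 'n) \<Rightarrow> bool" where
  "has_weak_gradient u G \<longleftrightarrow> u \<in> L1_loc \<and> G \<in> L1_loc \<and>
     (\<forall>\<phi> i. test_function \<phi> \<longrightarrow>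
        (\<integral>x. u x * grad \<phi> x $ i \<partial>lebesgue) = - (\<integral>x. G x $ i * \<phi> x \<partial>lebesgue))"

definition H1_loc :: "(real ^ 'n \<Rightarrow> real) set" where
  "H1_loc = {u \<in> L2_loc. \<exists>G \<in> L2_loc. has_weak_gradient u G}"

text \<open>
  Solutions of \<open>-\<Delta>u = |x|\<^sup>\<alpha> u\<^sup>p\<close> on the whole space. The weak gradient \<open>G\<close> is unique almost
  everywhere, so the existential quantifier just names it. The Bochner integral of a
  non-integrable function is \<open>0\<close>, but for \<open>u\<close> in \<^const>\<open>Linf_loc\<close>, \<open>\<alpha> > - CARD('n)\<close> and
  \<open>p \<ge> 0\<close> the right-hand side is locally integrable, so both integrals are genuine.
  The value \<open>0 powr \<alpha> = 0\<close> only matters on the null set \<open>{0}\<close>.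
\<close>

definition weak_solution :: "real \<Rightarrow> real \<Rightarrow> (real ^ 'n \<Rightarrow> real) \<Rightarrow> bool" where
  "weak_solution \<alpha> p u \<longleftrightarrow> u \<in> H1_loc \<inter> Linf_loc \<and>
     (\<exists>G. has_weak_gradient u G \<and>
       (\<forall>\<phi>. test_function \<phi> \<longrightarrow>
          (\<integral>x. G x \<bullet> grad \<phi> x \<partial>lebesgue) =
          (\<integral>x. norm x powr \<alpha> * u x powr p * \<phi> x \<partial>lebesgue)))"

end

theory Submission
  imports Defs
begin

text \<open>
  The proof moves spheres centred at the origin, on the integral form of the equation. Put
  \<open>N = CARD('n)\<close> and \<open>n = N - 2\<close>.

  Up to a positive constant, a positive solution is the Newtonian potential of its own right-hand side
  \<open>|y|\<^sup>\<alpha> u\<^sup>p\<close> (\<open>weak_solution_imp_henon_distributional\<close> and \<open>riesz_representation\<close>). Indeed, testing the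
  weak equation with the difference of two truncations of the fundamental solution compares the means
  of \<open>u\<close> at two scales around a point. The mean at scale \<open>R\<close> tends to \<open>0\<close> as \<open>R\<close> grows, because a mean bounded
  away from \<open>0\<close> would, through \<open>|y|\<^sup>\<alpha> u\<^sup>p\<close> and \<open>\<alpha> > -2\<close>, produce an infinite potential; so no harmonic
  part survives. The means at small scales increase to the potential and recover \<open>u\<close> almost everywhere.

  The Kelvin transform \<open>u\<^sub>l(x) = (l/|x|)\<^sup>n u(l\<^sup>2x/|x|\<^sup>2)\<close> solves the same equation with the right-hand side
  multiplied by \<open>(l/|x|)\<^sup>\<tau>\<close>, where \<open>\<tau> = N + 2 + 2\<alpha> - np\<close>. The exponent \<open>p\<close> is below its bound exactly when
  \<open>\<tau> > 0\<close>, and then \<open>u\<^sub>l\<close> is a strict subsolution outside the sphere of radius \<open>l\<close>. As all spheres are centred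
  at \<open>0\<close>, the weight only contributes a power of \<open>|x|\<close> and the sign of \<open>\<alpha>\<close> does not matter.

  Hence \<open>u\<^sub>l \<le> u\<close> outside the sphere of radius \<open>l\<close>, for every \<open>l > 0\<close> (\<open>dominates_all\<close>). For small \<open>l\<close> this holds
  since \<open>u\<close> is bounded near \<open>0\<close> and at least a multiple of \<open>|x|\<^sup>-\<^sup>n\<close> far away (\<open>dominates_small\<close>). If it holds for
  some \<open>l\<close>, then \<open>u - u\<^sub>l\<close> is positive and also at least a multiple of \<open>|x|\<^sup>-\<^sup>n\<close> far away (\<open>strictly_dominates\<close>,
  \<open>difference_decay\<close>), so for slightly larger radii the inequality can fail only in a thin shell, and there a
  contraction estimate excludes failure (\<open>dominates_if_violations_small\<close>). Nothing ever stops the spheres.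

  Comparing \<open>x\<close> with \<open>tx\<close> across the sphere of radius \<open>|x|\<surd>t\<close> shows that \<open>|x|\<^sup>n\<^sup>/\<^sup>2 u\<close> is nondecreasing along
  every ray (\<open>U_ray\<close>), so the minimum \<open>m(r)\<close> of \<open>u\<close> over the sphere of radius \<open>r\<close> is at least \<open>r\<^sup>-\<^sup>n\<^sup>/\<^sup>2 m(1)\<close> for
  \<open>r \<ge> 1\<close>. The integral equation gives \<open>m(r) \<ge> C r\<^sup>2\<^sup>+\<^sup>\<alpha> m(r)\<^sup>p\<close> (\<open>sphere_minimum_superlinear\<close>). Together these
  bound \<open>r\<^sup>\<tau>\<^sup>/\<^sup>2\<close> as \<open>r\<close> grows, which is absurd.
\<close>

section \<open>Inversion in a sphere as a change of variables\<close>

lemma nn_integral_lborel_affine: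
  fixes f :: "'a::euclidean_space \<Rightarrow> ennreal"
  assumes [measurable]: "f \<in> borel_measurable borel" and c: "c \<noteq> 0"
  shows "(\<integral>\<^sup>+x. f x \<partial>lborel) = ennreal (\<bar>c\<bar> ^ DIM('a)) * (\<integral>\<^sup>+x. f (t + c *\<^sub>R x) \<partial>lborel)"
  by (subst lborel_affine[OF c, of t])
     (simp add: nn_integral_density nn_integral_distr nn_integral_cmult)

lemma nn_integral_lborel_reflect:
  fixes f :: "'a::euclidean_space \<Rightarrow> ennreal"
  assumes [measurable]: "f \<in> borel_measurable borel"
  shows "(\<integral>\<^sup>+y. f (x - y) \<partial>lborel) = (\<integral>\<^sup>+y. f y \<partial>lborel)"
  using nn_integral_lborel_affine[of f "-1" x] by simp

definition inversion :: "real \<Rightarrow> 'a::real_inner \<Rightarrow> 'a" where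
  "inversion l x = (l\<^sup>2 / (norm x)\<^sup>2) *\<^sub>R x"

lemma norm_inversion: "norm (inversion l x) = l\<^sup>2 / norm x"
  by (simp add: inversion_def power2_eq_square)

lemma inversion_inversion: "l \<noteq> 0 \<Longrightarrow> x \<noteq> 0 \<Longrightarrow> inversion l (inversion l x) = x"
  by (simp add: inversion_def power2_eq_square)

lemma borel_measurable_inversion [measurable]:
  "(inversion l :: 'a::euclidean_space \<Rightarrow> 'a) \<in> borel_measurable borel"
  unfolding inversion_def[abs_def] by measurable

lemma inversion_image:
  assumes l: "l > 0" and A: "A \<subseteq> ball 0 l - {0}"
  shows "inversion l ` {y. norm y > l \<and> inversion l y \<in> A} = A"
proof -
  have "a \<in> inversion l ` {y. norm y > l \<and> inversion l y \<in> A}" if "a \<in> A" for a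
  proof (rule image_eqI)
    have a: "norm a < l" "a \<noteq> 0" using that A by auto
    show "a = inversion l (inversion l a)" using a l by (simp add: inversion_inversion)
    have "l * norm a < l * l" using a l by simp
    then show "inversion l a \<in> {y. norm y > l \<and> inversion l y \<in> A}"
      using a l that by (simp add: inversion_inversion norm_inversion field_simps power2_eq_square)
  qed
  then show ?thesis by auto
qed

lemma orthogonal_transformation_reflection:
  fixes e :: "'a::euclidean_space"
  assumes "norm e = 1"
  shows "orthogonal_transformation (\<lambda>h. h - (2 * (e \<bullet> h)) *\<^sub>R e)"
proof -
  have e: "e \<bullet> e = 1" using assms by (simp add: norm_eq_1)
  show ?thesis
    unfolding orthogonal_transformation_def
  proof safe
    show "linear (\<lambda>h. h - (2 * (e \<bullet> h)) *\<^sub>R e)"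
      by (rule linearI) (simp_all add: inner_add_right algebra_simps)
    show "(v - (2 * (e \<bullet> v)) *\<^sub>R e) \<bullet> (w - (2 * (e \<bullet> w)) *\<^sub>R e) = v \<bullet> w" for v w
      by (simp add: inner_diff_left inner_diff_right e inner_commute[of v e])
  qed
qed

text \<open>
  The derivative is a scalar multiple of the reflection in the hyperplane orthogonal to \<open>y\<close>; this
  is why the Jacobian determinant is a pure power of \<open>norm y\<close>.
\<close>
lemma inversion_has_derivative:
  fixes y :: "'a::euclidean_space"
  assumes "y \<noteq> 0"
  shows "(inversion l has_derivative
     (\<lambda>h. (l\<^sup>2 / (norm y)\<^sup>2) *\<^sub>R (h - (2 * ((y /\<^sub>R norm y) \<bullet> h)) *\<^sub>R (y /\<^sub>R norm y)))) (at y within S)"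
proof -
  have y: "y \<bullet> y \<noteq> 0" using assms by simp
  have "((\<lambda>x. (l\<^sup>2 / (x \<bullet> x)) *\<^sub>R x) has_derivative
     (\<lambda>h. (l\<^sup>2 / (y \<bullet> y)) *\<^sub>R h + (- (l\<^sup>2 * (2 * (y \<bullet> h))) / ((y \<bullet> y) * (y \<bullet> y))) *\<^sub>R y)) (at y within S)"
    using y by (auto intro!: derivative_eq_intros simp: inner_commute field_simps)
  moreover have "(\<lambda>h. (l\<^sup>2 / (y \<bullet> y)) *\<^sub>R h + (- (l\<^sup>2 * (2 * (y \<bullet> h))) / ((y \<bullet> y) * (y \<bullet> y))) *\<^sub>R y)
    = (\<lambda>h. (l\<^sup>2 / (norm y)\<^sup>2) *\<^sub>R (h - (2 * ((y /\<^sub>R norm y) \<bullet> h)) *\<^sub>R (y /\<^sub>R norm y)))"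
    using assms by (simp add: fun_eq_iff algebra_simps power2_norm_eq_inner[symmetric] power2_eq_square divide_inverse)
  ultimately show ?thesis
    by (simp add: inversion_def[abs_def] power2_norm_eq_inner)
qed

lemma emeasure_inversion_wellorder:
  fixes A :: "(real ^ 'n::{finite,wellorder}) set"
  assumes l: "l > 0" and A: "A \<in> sets borel" "A \<subseteq> ball 0 l - {0}"
  shows "emeasure lborel A =
    (\<integral>\<^sup>+y. ennreal ((l / norm y) ^ (2 * CARD('n))) * indicator {y. norm y > l \<and> inversion l y \<in> A} y \<partial>lborel)"
proof -
  define S where "S = {y::real^'n::_. norm y > l \<and> inversion l y \<in> A}"
  define f' where "f' y h = (l\<^sup>2 / (norm y)\<^sup>2) *\<^sub>R (h - (2 * ((y /\<^sub>R norm y) \<bullet> h)) *\<^sub>R (y /\<^sub>R norm y))"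
    for y h :: "real^'n::_"
  have [measurable]: "S \<in> sets borel" using A(1) unfolding S_def by measurable
  have S0: "y \<noteq> 0" "norm y > 0" if "y \<in> S" for y using that l by (auto simp: S_def)
  have im: "inversion l ` S = A" unfolding S_def using inversion_image[OF l A(2)] .
  have inj: "inj_on (inversion l) S"
    by (rule inj_on_inverseI[of _ "inversion l"]) (use S0 l in \<open>auto simp: inversion_inversion\<close>)
  have det: "\<bar>det (matrix (f' y))\<bar> = (l / norm y) ^ (2 * CARD('n))" if "y \<in> S" for y
  proof -
    have o: "orthogonal_transformation (\<lambda>h. h - (2 * ((y /\<^sub>R norm y) \<bullet> h)) *\<^sub>R (y /\<^sub>R norm y))"
      by (rule orthogonal_transformation_reflection) (use S0[OF that] in simp)
    have "f' y = (*\<^sub>R) (l\<^sup>2 / (norm y)\<^sup>2) \<circ> (\<lambda>h. h - (2 * ((y /\<^sub>R norm y) \<bullet> h)) *\<^sub>R (y /\<^sub>R norm y))"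
      by (simp add: f'_def[abs_def] o_def)
    then have "matrix (f' y) = matrix ((*\<^sub>R) (l\<^sup>2 / (norm y)\<^sup>2)) ** matrix (\<lambda>h. h - (2 * ((y /\<^sub>R norm y) \<bullet> h)) *\<^sub>R (y /\<^sub>R norm y))"
      using o by (simp only:) (rule matrix_compose, auto simp: orthogonal_transformation_linear)
    then show ?thesis
      using o by (simp add: det_mul abs_mult power_mult power_divide)
  qed
  have lm: "A \<in> lmeasurable"
    by (rule bounded_set_imp_lmeasurable) (use A in \<open>auto intro: bounded_subset[OF bounded_ball]\<close>)
  have "((\<lambda>y. \<bar>det (matrix (f' y))\<bar>) has_integral measure lebesgue A) S"
    using has_measure_differentiable_image[of S "inversion l" f' "measure lebesgue A"] inj lm im
      inversion_has_derivative[of _ l S] S0 unfolding f'_def by (auto simp: im)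
  then have "((\<lambda>y. (l / norm y) ^ (2 * CARD('n))) has_integral measure lebesgue A) S"
    by (subst (asm) has_integral_cong[OF det]) auto
  then have "((\<lambda>y. (l / norm y) ^ (2 * CARD('n)) * indicator S y) has_integral measure lebesgue A) UNIV"
    by (subst (asm) has_integral_restrict_UNIV[symmetric])
       (erule has_integral_eq_rhs[OF has_integral_eq, rotated 1], auto)
  then have "(\<integral>\<^sup>+y. ennreal ((l / norm y) ^ (2 * CARD('n)) * indicator S y) \<partial>lborel) = measure lebesgue A"
    by (intro nn_integral_has_integral_lborel) (use l in auto)
  moreover have "emeasure lborel A = measure lebesgue A"
    using A(1) emeasure_eq_measure2[OF lm] by simp
  ultimately show ?thesis using l by (simp add: S_def ennreal_mult ennreal_indicator)
qed

text \<open>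
  The change of variables theorem is stated for well-ordered index types. Copying a finite
  index type and ordering the copy by some enumeration makes the theorem available for every finite
  index type, because renaming coordinates preserves Lebesgue measure.
\<close>
typedef 'a well_ordered = "UNIV :: 'a set" by simp

instance well_ordered :: (finite) finite
proof
  have "(UNIV :: 'a well_ordered set) = Abs_well_ordered ` (UNIV :: 'a set)"
    by (metis Rep_well_ordered_inverse surj_def)
  then show "finite (UNIV :: 'a well_ordered set)" by (metis finite finite_imageI)
qed

definition rank_well_ordered :: "'a::finite well_ordered \<Rightarrow> nat" where
  "rank_well_ordered = (SOME f. inj f)"

lemma inj_rank_well_ordered: "inj rank_well_ordered"
proof -
  have "\<exists>f :: 'a well_ordered \<Rightarrow> nat. inj f"
    using finite_imp_inj_to_nat_seg[of "UNIV :: 'a well_ordered set"] by auto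
  then show ?thesis unfolding rank_well_ordered_def by (rule someI_ex)
qed

instantiation well_ordered :: (finite) wellorder
begin

definition "x \<le> y \<longleftrightarrow> rank_well_ordered x \<le> rank_well_ordered y"
definition "x < y \<longleftrightarrow> rank_well_ordered x < rank_well_ordered y"

instance
proof
  fix P :: "'a well_ordered \<Rightarrow> bool" and a :: "'a well_ordered"
  assume *: "\<And>x. (\<And>y. y < x \<Longrightarrow> P y) \<Longrightarrow> P x"
  show "P a"
    by (induction "rank_well_ordered a" arbitrary: a rule: less_induct) (metis * less_well_ordered_def)
qed (auto simp: less_eq_well_ordered_def less_well_ordered_def injD[OF inj_rank_well_ordered])

end

lemma CARD_well_ordered: "CARD('a::finite well_ordered) = CARD('a)"
  by (metis type_definition.card type_definition_well_ordered)

lemma prod_Basis_cart: "(\<Prod>b\<in>Basis. (v :: real ^ 'n) \<bullet> b) = (\<Prod>i\<in>UNIV. v $ i)"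
proof -
  have "bij_betw (\<lambda>i. axis i 1) UNIV (Basis :: (real^'n) set)"
    by (auto simp: bij_betw_def Basis_vec_def inj_def axis_eq_axis)
  from prod.reindex_bij_betw[OF this, of "\<lambda>b. v \<bullet> b"] show ?thesis by (simp add: inner_axis)
qed

definition unorder :: "real ^ 'n well_ordered \<Rightarrow> real ^ 'n::finite" where
  "unorder v = (\<chi> i. v $ Abs_well_ordered i)"

lemma bij_Abs_well_ordered: "bij Abs_well_ordered"
  by (metis Abs_well_ordered_inverse Rep_well_ordered_inverse UNIV_I bij_betwI')

lemma norm_unorder: "norm (unorder v) = norm v"
proof -
  have "(\<Sum>i\<in>UNIV. (norm (v $ Abs_well_ordered i))\<^sup>2) = (\<Sum>j\<in>UNIV. (norm (v $ j))\<^sup>2)"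
    using bij_Abs_well_ordered by (rule sum.reindex_bij_betw)
  then show ?thesis by (simp add: unorder_def norm_vec_def L2_set_def)
qed

lemma unorder_scaleR: "unorder (c *\<^sub>R v) = c *\<^sub>R unorder v"
  by (simp add: unorder_def vec_eq_iff)

lemma continuous_on_unorder: "continuous_on UNIV unorder"
  unfolding unorder_def[abs_def] by (intro continuous_intros)

lemma borel_measurable_unorder [measurable]: "unorder \<in> borel_measurable borel"
  using continuous_on_unorder by (rule borel_measurable_continuous_onI)

lemma lborel_distr_unorder: "lborel = distr lborel borel (unorder :: real ^ 'n well_ordered \<Rightarrow> real ^ 'n::finite)"
proof (rule lborel_eqI)
  fix l u :: "real ^ 'n" assume le: "\<And>b. b \<in> Basis \<Longrightarrow> l \<bullet> b \<le> u \<bullet> b"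
  define r where "r w = (\<chi> j. w $ Rep_well_ordered j)" for w :: "real ^ 'n"
  have bij: "bij (Rep_well_ordered :: 'n well_ordered \<Rightarrow> 'n)"
    by (metis Rep_well_ordered_inject Rep_well_ordered_cases UNIV_I bij_betwI')
  have le': "l $ i \<le> u $ i" for i using le[of "axis i 1"] by (simp add: inner_axis)
  have "unorder -` box l u = box (r l) (r u)"
    by (auto simp: mem_box_cart unorder_def r_def)
       (metis Rep_well_ordered_inverse Abs_well_ordered_inverse UNIV_I)+
  then have "emeasure (distr lborel borel unorder) (box l u) = emeasure lborel (box (r l) (r u))"
    by (simp add: emeasure_distr)
  also have "\<dots> = (\<Prod>b\<in>Basis. (r u - r l) \<bullet> b)"
    by (rule emeasure_lborel_box) (use le' in \<open>auto simp: Basis_vec_def inner_axis r_def\<close>)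
  also have "(\<Prod>b\<in>Basis. (r u - r l) \<bullet> b) = (\<Prod>b\<in>Basis. (u - l) \<bullet> b)"
    unfolding prod_Basis_cart using prod.reindex_bij_betw[OF bij, of "\<lambda>i. (u - l) $ i"]
    by (simp add: r_def)
  finally show "emeasure (distr lborel borel unorder) (box l u) = (\<Prod>b\<in>Basis. (u - l) \<bullet> b)" .
qed simp

lemma emeasure_inversion:
  fixes A :: "(real ^ 'n) set"
  assumes l: "l > 0" and A [measurable]: "A \<in> sets borel" and Al: "A \<subseteq> ball 0 l - {0}"
  shows "emeasure lborel A =
    (\<integral>\<^sup>+y. ennreal ((l / norm y) ^ (2 * CARD('n))) * indicator {y. norm y > l \<and> inversion l y \<in> A} y \<partial>lborel)"
proof -
  let ?A = "unorder -` A"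
  have [measurable]: "?A \<in> sets borel" using measurable_sets[OF borel_measurable_unorder A] by simp
  have "unorder v \<noteq> 0 \<longleftrightarrow> v \<noteq> 0" for v :: "real ^ 'n well_ordered"
    by (metis norm_eq_zero norm_unorder)
  then have sub: "?A \<subseteq> ball 0 l - {0}" using Al by (force simp: norm_unorder)
  have inv: "unorder (inversion l v) = inversion l (unorder v)" for v :: "real ^ 'n well_ordered"
    by (simp add: inversion_def unorder_scaleR norm_unorder)
  have "emeasure lborel A = emeasure lborel ?A"
    by (subst lborel_distr_unorder) (simp add: emeasure_distr)
  also have "\<dots> = (\<integral>\<^sup>+y. ennreal ((l / norm y) ^ (2 * CARD('n))) *
      indicator {y. norm y > l \<and> inversion l y \<in> ?A} y \<partial>lborel)"
    using emeasure_inversion_wellorder[OF l _ sub] by (simp add: CARD_well_ordered)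
  also have "\<dots> = (\<integral>\<^sup>+y. ennreal ((l / norm y) ^ (2 * CARD('n))) *
      indicator {y. norm y > l \<and> inversion l y \<in> A} y \<partial>distr lborel borel unorder)"
    by (subst nn_integral_distr) (auto simp: norm_unorder inv indicator_def intro!: nn_integral_cong)
  finally show ?thesis by (simp flip: lborel_distr_unorder)
qed

text \<open>
  The two sides integrate against two measures on the punctured ball, Lebesgue measure and the image of
  the weighted measure outside the ball. They agree on Borel sets by \<open>emeasure_inversion\<close>.
\<close>
lemma nn_integral_inversion:
  fixes F :: "real ^ 'n \<Rightarrow> ennreal"
  assumes l: "l > 0" and [measurable]: "F \<in> borel_measurable borel"
  shows "(\<integral>\<^sup>+y. F y * indicator {y. norm y < l} y \<partial>lborel) =
    (\<integral>\<^sup>+y. ennreal ((l / norm y) ^ (2 * CARD('n))) * F (inversion l y) * indicator {y. norm y > l} y \<partial>lborel)"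
proof -
  let ?J = "\<lambda>y::real^'n. ennreal ((l / norm y) ^ (2 * CARD('n))) * indicator {y. norm y > l} y"
  let ?B = "ball 0 l - {0} :: (real^'n) set"
  have [measurable]: "?B \<in> sets borel" by simp
  have eq: "density lborel (indicator ?B) = distr (density lborel ?J) borel (inversion l)"
  proof (rule measure_eqI)
    fix A :: "(real^'n) set" assume "A \<in> sets (density lborel (indicator ?B))"
    then have [measurable]: "A \<in> sets borel" by simp
    have out: "inversion l y \<in> ?B" if "norm y > l" for y :: "real^'n"
      using that l by (auto simp: norm_inversion field_simps power2_eq_square inversion_def)
    have "emeasure (density lborel (indicator ?B)) A = emeasure lborel (A \<inter> ?B)"
      by (subst emeasure_density) (auto simp: indicator_inter_arith[symmetric] Int_commute)
    also have "\<dots> = (\<integral>\<^sup>+y. ennreal ((l / norm y) ^ (2 * CARD('n))) *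
        indicator {y. norm y > l \<and> inversion l y \<in> A \<inter> ?B} y \<partial>lborel)"
      by (rule emeasure_inversion[OF l]) auto
    also have "\<dots> = (\<integral>\<^sup>+y. ?J y * indicator (inversion l -` A) y \<partial>lborel)"
      using out by (intro nn_integral_cong) (auto simp: indicator_def)
    also have "\<dots> = emeasure (density lborel ?J) (inversion l -` A \<inter> space lborel)"
      by (subst emeasure_density) (auto intro: measurable_sets_borel[of _ borel])
    finally show "emeasure (density lborel (indicator ?B)) A = emeasure (distr (density lborel ?J) borel (inversion l)) A"
      by (subst emeasure_distr) auto
  qed simp
  have "(\<integral>\<^sup>+y. F y * indicator {y. norm y < l} y \<partial>lborel) = (\<integral>\<^sup>+y. indicator ?B y * F y \<partial>lborel)"
    using AE_lborel_singleton[of 0]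
    by (intro nn_integral_cong_AE) (auto simp: indicator_def elim!: eventually_mono)
  also have "\<dots> = (\<integral>\<^sup>+y. F y \<partial>density lborel (indicator ?B))"
    by (subst nn_integral_density) auto
  also have "\<dots> = (\<integral>\<^sup>+y. ?J y * F (inversion l y) \<partial>lborel)"
    unfolding eq by (subst nn_integral_distr) (auto simp: nn_integral_density)
  finally show ?thesis by (simp add: mult_ac)
qed

section \<open>Integrals of powers of the norm\<close>

lemma nn_integral_ball_norm_powr_scale:
  fixes b r :: real
  assumes r: "r > 0"
  shows "(\<integral>\<^sup>+(z::'a::euclidean_space). ennreal (norm z powr b) * indicator {z. norm z < r} z \<partial>lborel)
    = ennreal (r powr (b + DIM('a))) * (\<integral>\<^sup>+(z::'a). ennreal (norm z powr b) * indicator {z. norm z < 1} z \<partial>lborel)"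
proof -
  have "(\<integral>\<^sup>+(z::'a). ennreal (norm z powr b) * indicator {z. norm z < r} z \<partial>lborel)
    = ennreal (r ^ DIM('a)) * (\<integral>\<^sup>+(z::'a). ennreal (norm (r *\<^sub>R z) powr b) * indicator {z. norm z < r} (r *\<^sub>R z) \<partial>lborel)"
    using r by (subst nn_integral_lborel_affine[where c = r and t = 0]) auto
  also have "(\<integral>\<^sup>+(z::'a). ennreal (norm (r *\<^sub>R z) powr b) * indicator {z. norm z < r} (r *\<^sub>R z) \<partial>lborel)
    = (\<integral>\<^sup>+(z::'a). ennreal (r powr b) * (ennreal (norm z powr b) * indicator {z. norm z < 1} z) \<partial>lborel)"
    using r by (intro nn_integral_cong) (auto simp: powr_mult ennreal_mult indicator_def)
  also have "\<dots> = ennreal (r powr b) * (\<integral>\<^sup>+(z::'a). ennreal (norm z powr b) * indicator {z. norm z < 1} z \<partial>lborel)"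
    by (subst nn_integral_cmult) auto
  finally show ?thesis
    using r by (simp add: powr_add powr_realpow ennreal_mult mult.assoc[symmetric] mult.commute)
qed

text \<open>
  Cut the unit ball into dyadic shells. By scaling, the integral \<open>I (Suc k)\<close> outside the ball of radius
  \<open>2\<^sup>-\<^sup>k\<^sup>-\<^sup>1\<close> is at most \<open>I 1 + q * I k\<close>, where \<open>q < 1\<close> is what the condition on \<open>b\<close> says; so all \<open>I k\<close> stay
  below the fixed point \<open>I 1 / (1 - q)\<close>.
\<close>
lemma nn_integral_unit_ball_norm_powr_finite:
  fixes b :: real
  assumes b: "b > - real DIM('a)"
  shows "(\<integral>\<^sup>+(z::'a::euclidean_space). ennreal (norm z powr b) * indicator {z. norm z < 1} z \<partial>lborel) < \<infinity>"
proof -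
  define d where "d = DIM('a)"
  define q where "q = (1/2 :: real) powr (b + d)"
  have q: "0 < q" "q < 1" using b by (auto simp: q_def d_def powr_less_one powr01_less_one)
  define I where "I k = (\<integral>\<^sup>+(z::'a). ennreal (norm z powr b) * indicator {z. (1/2)^k \<le> norm z \<and> norm z < 1} z \<partial>lborel)" for k
  define v where "v = emeasure lborel (ball 0 1 :: 'a set)"
  have v: "v < \<infinity>" unfolding v_def using emeasure_lborel_ball_finite by simp
  have I1: "I 1 < \<infinity>"
  proof -
    have "I 1 \<le> (\<integral>\<^sup>+(z::'a). ennreal (2 powr \<bar>b\<bar>) * indicator (ball 0 1) z \<partial>lborel)"
      unfolding I_def
    proof (intro nn_integral_mono)
      fix z :: 'a
      have "norm z powr b \<le> 2 powr \<bar>b\<bar>" if "1/2 \<le> norm z" "norm z < 1"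
      proof (cases "b \<ge> 0")
        case True
        then have "norm z powr b \<le> 1 powr b" using that by (intro powr_mono2) auto
        also have "\<dots> \<le> 2 powr \<bar>b\<bar>" by (simp add: ge_one_powr_ge_zero)
        finally show ?thesis .
      next
        case False
        then have "norm z powr b \<le> (1/2) powr b" using that by (intro powr_mono2') auto
        also have "\<dots> = 2 powr \<bar>b\<bar>" using False by (simp add: powr_divide powr_minus_divide)
        finally show ?thesis .
      qed
      then show "ennreal (norm z powr b) * indicator {z. (1/2)^1 \<le> norm z \<and> norm z < 1} z
          \<le> ennreal (2 powr \<bar>b\<bar>) * indicator (ball 0 1) z"
        by (auto simp: indicator_def ennreal_leI)
    qed
    also have "\<dots> = ennreal (2 powr \<bar>b\<bar>) * v" by (simp add: nn_integral_cmult_indicator v_def)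
    also have "\<dots> < \<infinity>" using v by (simp add: ennreal_mult_less_top)
    finally show ?thesis .
  qed
  have half: "norm ((1/2) *\<^sub>R z) powr b = (1/2) powr b * norm z powr b" for z :: 'a
    using powr_mult[of "1/2" "norm z" b] by simp
  have step: "I (Suc k) \<le> I 1 + ennreal q * I k" for k
  proof -
    have "I (Suc k) \<le> (\<integral>\<^sup>+(z::'a). ennreal (norm z powr b) * indicator {z. (1/2)^1 \<le> norm z \<and> norm z < 1} z
       + ennreal (norm z powr b) * indicator {z. (1/2)^Suc k \<le> norm z \<and> norm z < 1/2} z \<partial>lborel)"
      unfolding I_def by (intro nn_integral_mono) (auto simp: indicator_def)
    also have "\<dots> = I 1 + (\<integral>\<^sup>+(z::'a). ennreal (norm z powr b) * indicator {z. (1/2)^Suc k \<le> norm z \<and> norm z < 1/2} z \<partial>lborel)"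
      unfolding I_def by (rule nn_integral_add) auto
    also have "(\<integral>\<^sup>+(z::'a). ennreal (norm z powr b) * indicator {z. (1/2)^Suc k \<le> norm z \<and> norm z < 1/2} z \<partial>lborel)
      = ennreal ((1/2) ^ d) * (\<integral>\<^sup>+(z::'a). ennreal (norm ((1/2) *\<^sub>R z) powr b) * indicator {z. (1/2)^Suc k \<le> norm z \<and> norm z < 1/2} ((1/2) *\<^sub>R z) \<partial>lborel)"
      by (subst nn_integral_lborel_affine[where c = "1/2" and t = 0]) (auto simp: d_def)
    also have "\<dots> = ennreal ((1/2) ^ d) * (\<integral>\<^sup>+(z::'a). ennreal ((1/2) powr b) * (ennreal (norm z powr b) * indicator {z. (1/2)^k \<le> norm z \<and> norm z < 1} z) \<partial>lborel)"
      unfolding half by (intro arg_cong[where f = "\<lambda>t. ennreal ((1/2) ^ d) * t"] nn_integral_cong)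
         (auto simp: ennreal_mult indicator_def)
    also have "\<dots> = ennreal q * I k"
      unfolding I_def by (subst nn_integral_cmult)
        (auto simp: q_def powr_add powr_realpow ennreal_mult mult.assoc[symmetric] mult.commute)
    finally show ?thesis .
  qed
  obtain i where i: "I 1 = ennreal i" "i \<ge> 0" using I1 by (cases "I 1") auto
  have bound: "I k \<le> ennreal (i / (1 - q))" for k
  proof (induction k)
    case 0
    have "I 0 = (\<integral>\<^sup>+(z::'a). 0 \<partial>lborel)"
      unfolding I_def by (intro nn_integral_cong) (auto simp: indicator_def)
    then show ?case by simp
  next
    case (Suc k)
    have "I (Suc k) \<le> ennreal i + ennreal q * ennreal (i / (1 - q))"
      by (rule order_trans[OF step[of k]]) (unfold i(1), intro add_left_mono mult_left_mono Suc, simp)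
    also have "\<dots> = ennreal (i + q * (i / (1 - q)))" using i q ennreal_mult[of q "i / (1 - q)"] by (simp add: ennreal_plus)
    also have "i + q * (i / (1 - q)) = i / (1 - q)" using q by (simp add: field_simps)
    finally show ?case .
  qed
  have "(\<integral>\<^sup>+(z::'a). ennreal (norm z powr b) * indicator {z. norm z < 1} z \<partial>lborel)
     = (\<integral>\<^sup>+(z::'a). (SUP k. ennreal (norm z powr b) * indicator {z. (1/2)^k \<le> norm z \<and> norm z < 1} z) \<partial>lborel)"
  proof (intro nn_integral_cong antisym)
    fix z :: 'a
    show "ennreal (norm z powr b) * indicator {z. norm z < 1} z
      \<le> (SUP k. ennreal (norm z powr b) * indicator {z. (1/2)^k \<le> norm z \<and> norm z < 1} z)"
    proof (cases "z = 0")
      case False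
      then obtain k where "(1/2)^k < norm z" using real_arch_pow_inv[of "norm z" "1/2"] by auto
      then show ?thesis by (intro SUP_upper2[of k]) (auto simp: indicator_def)
    qed simp
  qed (auto intro!: SUP_least simp: indicator_def)
  also have "\<dots> = (SUP k. I k)"
    unfolding I_def
  proof (rule nn_integral_monotone_convergence_SUP)
    have dec: "(1/2 :: real) ^ k' \<le> (1/2) ^ k" if "k \<le> k'" for k k' :: nat
      using that by (intro power_decreasing) auto
    show "incseq (\<lambda>k (z::'a). ennreal (norm z powr b) * indicator {z. (1/2)^k \<le> norm z \<and> norm z < 1} z)"
      by (auto simp: incseq_def le_fun_def indicator_def) (use dec order_trans in blast)
  qed auto
  also have "\<dots> \<le> ennreal (i / (1 - q))" using bound by (intro SUP_least) auto
  finally show ?thesis by (simp add: order_le_less_trans)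
qed

text \<open>
  Both exponents are nonpositive, so the product of the two powers is at most the larger one of
  \<open>norm y powr (a - n)\<close> and \<open>norm (x - y) powr (a - n)\<close>. The bound does not see the position of \<open>x\<close>.
\<close>
lemma nn_integral_two_powers_near_le:
  fixes a n r :: real and x :: "'a::euclidean_space"
  assumes a: "a \<le> 0" and n: "n \<ge> 0" and an: "a - n > - real DIM('a)" and r: "r > 0"
  shows "(\<integral>\<^sup>+y. ennreal (norm y powr a * norm (x - y) powr - n) * indicator {y. norm (x - y) < r} y \<partial>lborel)
    \<le> 2 * ennreal (r powr (a - n + DIM('a))) *
       (\<integral>\<^sup>+(z::'a). ennreal (norm z powr (a - n)) * indicator {z. norm z < 1} z \<partial>lborel)"
proof -
  let ?g = "\<lambda>z::'a. ennreal (norm z powr (a - n)) * indicator {z. norm z < r} z"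
  have *: "s powr a * t powr - n \<le> s powr (a - n) * of_bool (s < r) + t powr (a - n)"
    if "t < r" "s > 0" "t \<ge> 0" for s t :: real
  proof (cases "s \<ge> t")
    case True
    show ?thesis
    proof (cases "t = 0")
      case False
      with True that have "s powr a \<le> t powr a" using a by (intro powr_mono2') auto
      then have "s powr a * t powr - n \<le> t powr a * t powr - n" by (intro mult_right_mono) auto
      also have "\<dots> = t powr (a - n)" by (simp add: powr_add[symmetric])
      finally show ?thesis by (simp add: add_increasing)
    qed simp
  next
    case False
    with that have "t powr - n \<le> s powr - n" using n by (intro powr_mono2') auto
    then have "s powr a * t powr - n \<le> s powr a * s powr - n" by (intro mult_left_mono) auto
    also have "\<dots> = s powr (a - n)" by (simp add: powr_add[symmetric])
    finally show ?thesis using False that by (simp add: add_increasing2)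
  qed
  have "(\<integral>\<^sup>+y. ennreal (norm y powr a * norm (x - y) powr - n) * indicator {y. norm (x - y) < r} y \<partial>lborel)
    \<le> (\<integral>\<^sup>+y. ?g y + ?g (x - y) \<partial>lborel)"
  proof (intro nn_integral_mono)
    fix y :: 'a
    show "ennreal (norm y powr a * norm (x - y) powr - n) * indicator {y. norm (x - y) < r} y \<le> ?g y + ?g (x - y)"
    proof (cases "norm (x - y) < r \<and> y \<noteq> 0")
      case True
      then have "ennreal (norm y powr a * norm (x - y) powr - n)
         \<le> ennreal (norm y powr (a - n) * of_bool (norm y < r) + norm (x - y) powr (a - n))"
        by (intro ennreal_leI *) auto
      also have "\<dots> = ?g y + ?g (x - y)" using True by (simp add: ennreal_plus indicator_def)
      finally show ?thesis using True by simp
    qed (auto simp: indicator_def)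
  qed
  also have "\<dots> = (\<integral>\<^sup>+y. ?g y \<partial>lborel) + (\<integral>\<^sup>+y. ?g (x - y) \<partial>lborel)"
    by (rule nn_integral_add) auto
  also have "(\<integral>\<^sup>+y. ?g (x - y) \<partial>lborel) = (\<integral>\<^sup>+y. ?g y \<partial>lborel)"
    by (rule nn_integral_lborel_reflect) auto
  also have "(\<integral>\<^sup>+y. ?g y \<partial>lborel) + (\<integral>\<^sup>+y. ?g y \<partial>lborel) = 2 * (\<integral>\<^sup>+y. ?g y \<partial>lborel)" by (simp add: mult_2)
  finally show ?thesis by (simp add: nn_integral_ball_norm_powr_scale[OF r] mult.assoc)
qed

text \<open>
  The exponent \<open>2 + min \<alpha> 0\<close> is positive: potentials of the weight \<open>norm y powr \<alpha>\<close> over small balls are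
  small, uniformly for bounded centres, even if the weight blows up at the origin. For \<open>\<alpha> > 0\<close> the weight is
  simply bounded.
\<close>
lemma riesz_kernel_near_le:
  fixes \<alpha> R :: real
  assumes d: "CARD('n) \<ge> 3" and \<alpha>: "\<alpha> > -2" and R: "R > 0"
  shows "\<exists>C\<ge>0. \<forall>(x :: real ^ 'n) r. norm x \<le> R \<longrightarrow> 0 < r \<longrightarrow> r \<le> R \<longrightarrow>
    (\<integral>\<^sup>+y. ennreal (norm y powr \<alpha> * norm (x - y) powr - (real CARD('n) - 2)) * indicator {y. norm (x - y) < r} y \<partial>lborel)
      \<le> ennreal (C * r powr (2 + min \<alpha> 0))"
proof -
  define n where "n = real CARD('n) - 2"
  define a where "a = min \<alpha> 0"
  have n: "n > 0" using d by (simp add: n_def)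
  have a: "a \<le> 0" "a > -2" "a \<le> \<alpha>" using \<alpha> by (auto simp: a_def)
  define I where "I = (\<integral>\<^sup>+(z::real^'n). ennreal (norm z powr (a - n)) * indicator {z. norm z < 1} z \<partial>lborel)"
  have "I < \<infinity>" unfolding I_def
    by (rule nn_integral_unit_ball_norm_powr_finite) (use a in \<open>simp add: n_def\<close>)
  then obtain i where i: "I = ennreal i" "i \<ge> 0" by (cases I) auto
  show ?thesis
  proof (intro exI[of _ "(2 * R) powr (\<alpha> - a) * (2 * i)"] conjI allI impI)
    fix x :: "real ^ 'n" and r :: real assume x: "norm x \<le> R" and r: "0 < r" "r \<le> R"
    have "(\<integral>\<^sup>+y. ennreal (norm y powr \<alpha> * norm (x - y) powr - n) * indicator {y. norm (x - y) < r} y \<partial>lborel)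
      \<le> (\<integral>\<^sup>+y. ennreal ((2 * R) powr (\<alpha> - a)) *
          (ennreal (norm y powr a * norm (x - y) powr - n) * indicator {y. norm (x - y) < r} y) \<partial>lborel)"
    proof (intro nn_integral_mono)
      fix y :: "real ^ 'n"
      have "norm y powr \<alpha> * norm (x - y) powr - n \<le> (2 * R) powr (\<alpha> - a) * (norm y powr a * norm (x - y) powr - n)"
        if "norm (x - y) < r"
      proof -
        have "norm y \<le> norm x + norm (x - y)" by (metis norm_minus_commute norm_triangle_sub)
        then have "norm y \<le> 2 * R" using that x r by simp
        then have "norm y powr (\<alpha> - a) \<le> (2 * R) powr (\<alpha> - a)" using a by (intro powr_mono2) auto
        then have "norm y powr (\<alpha> - a) * norm y powr a \<le> (2 * R) powr (\<alpha> - a) * norm y powr a"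
          by (intro mult_right_mono) auto
        then have "norm y powr \<alpha> \<le> (2 * R) powr (\<alpha> - a) * norm y powr a" by (simp add: powr_add[symmetric])
        from mult_right_mono[OF this, of "norm (x - y) powr - n"] show ?thesis by (simp add: mult.assoc)
      qed
      then show "ennreal (norm y powr \<alpha> * norm (x - y) powr - n) * indicator {y. norm (x - y) < r} y
        \<le> ennreal ((2 * R) powr (\<alpha> - a)) *
          (ennreal (norm y powr a * norm (x - y) powr - n) * indicator {y. norm (x - y) < r} y)"
        by (auto simp: indicator_def ennreal_mult[symmetric] intro!: ennreal_leI)
    qed
    also have "\<dots> = ennreal ((2 * R) powr (\<alpha> - a)) *
        (\<integral>\<^sup>+y. ennreal (norm y powr a * norm (x - y) powr - n) * indicator {y. norm (x - y) < r} y \<partial>lborel)"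
      by (rule nn_integral_cmult) auto
    also have "\<dots> \<le> ennreal ((2 * R) powr (\<alpha> - a)) * (2 * ennreal (r powr (a - n + DIM(real^'n))) * I)"
      unfolding I_def using a n r by (intro mult_left_mono nn_integral_two_powers_near_le) (auto simp: n_def)
    also have "\<dots> = ennreal ((2 * R) powr (\<alpha> - a) * (2 * i) * r powr (2 + a))"
    proof -
      have "2 * ennreal (r powr (a - n + DIM(real^'n))) * I = ennreal 2 * ennreal (r powr (2 + a)) * ennreal i"
        by (simp add: i n_def add.commute)
      also have "\<dots> = ennreal (2 * r powr (2 + a) * i)" using i by (simp add: ennreal_mult)
      finally show ?thesis using i by (simp add: ennreal_mult[symmetric] mult_ac)
    qed
    finally show "(\<integral>\<^sup>+y. ennreal (norm y powr \<alpha> * norm (x - y) powr - (real CARD('n) - 2)) * indicator {y. norm (x - y) < r} y \<partial>lborel)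
      \<le> ennreal ((2 * R) powr (\<alpha> - a) * (2 * i) * r powr (2 + min \<alpha> 0))"
      by (simp add: n_def a_def)
  qed (use i in auto)
qed

section \<open>Positive solutions of the integral equation are continuous\<close>

lemma ennreal_integral_le:
  assumes "integrable M g"
  shows "ennreal (\<integral>x. g x \<partial>M) \<le> (\<integral>\<^sup>+x. ennreal (g x) \<partial>M)"
proof -
  have i: "integrable M (\<lambda>x. max 0 (g x))" using assms by simp
  have "ennreal (\<integral>x. g x \<partial>M) \<le> ennreal (\<integral>x. max 0 (g x) \<partial>M)"
    using assms i by (intro ennreal_leI integral_mono) auto
  also have "\<dots> = (\<integral>\<^sup>+x. ennreal (max 0 (g x)) \<partial>M)"
    using i by (subst nn_integral_eq_integral) auto
  also have "\<dots> = (\<integral>\<^sup>+x. ennreal (g x) \<partial>M)"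
    by (intro nn_integral_cong) (simp add: max_def ennreal_neg)
  finally show ?thesis .
qed

text \<open>
  Everything that the moving sphere argument uses of a solution. The integral equation holds at every point
  and not only almost everywhere. Writing it with values in \<^typ>\<open>ennreal\<close> makes it include that the potential
  converges.
\<close>
locale riesz_solution =
  fixes \<alpha> p \<kappa> :: real and U :: "real ^ 'n \<Rightarrow> real"
  assumes dim: "CARD('n) \<ge> 3" and \<alpha>: "\<alpha> > -2" and p: "p > 1" and \<kappa>: "\<kappa> > 0"
    and U_measurable [measurable]: "U \<in> borel_measurable borel"
    and U_pos: "\<And>x. U x > 0"
    and U_locally_bounded: "\<And>r. \<exists>M. \<forall>x. norm x \<le> r \<longrightarrow> U x \<le> M"
    and U_eq: "\<And>x. ennreal (U x) = (\<integral>\<^sup>+y. ennreal (\<kappa> * norm y powr \<alpha> * U y powr p *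
        norm (x - y) powr - (real CARD('n) - 2)) \<partial>lborel)"
begin

definition n :: real where "n = real CARD('n) - 2"

definition f :: "real ^ 'n \<Rightarrow> real" where "f y = \<kappa> * norm y powr \<alpha> * U y powr p"

lemma n_pos: "n > 0" using dim by (simp add: n_def)

lemma f_nonneg: "f y \<ge> 0" using \<kappa> by (simp add: f_def)

lemma f_pos: "y \<noteq> 0 \<Longrightarrow> f y > 0" using \<kappa> U_pos[of y] by (simp add: f_def)

lemma f_measurable [measurable]: "f \<in> borel_measurable borel" unfolding f_def[abs_def] by measurable

lemma U_nn_integral: "ennreal (U x) = (\<integral>\<^sup>+y. ennreal (f y * norm (x - y) powr - n) \<partial>lborel)"
  using U_eq[of x] by (simp add: f_def n_def)

lemma integrable_potential: "integrable lborel (\<lambda>y. f y * norm (x - y) powr - n)"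
  by (rule integrableI_nn_integral_finite[OF _ _ U_nn_integral[symmetric]]) (use f_nonneg in auto)

lemma U_integral: "U x = (\<integral>y. f y * norm (x - y) powr - n \<partial>lborel)"
  using U_nn_integral[of x] U_pos[of x] f_nonneg
  by (subst integral_eq_nn_integral) (auto simp flip: U_nn_integral)

lemma U_bound: "\<exists>M>0. \<forall>x. norm x \<le> r \<longrightarrow> U x \<le> M"
proof -
  obtain M where "\<forall>x. norm x \<le> r \<longrightarrow> U x \<le> M" using U_locally_bounded by blast
  then show ?thesis by (intro exI[of _ "max M 1"]) force
qed

abbreviation near_potential :: "real \<Rightarrow> real ^ 'n \<Rightarrow> ennreal" where
  "near_potential r x \<equiv>
    (\<integral>\<^sup>+y. ennreal (f y * norm (x - y) powr - n) * indicator {y. norm (x - y) < r} y \<partial>lborel)"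

lemma potential_near_le:
  assumes R: "R > 0"
  shows "\<exists>C\<ge>0. \<forall>x r. norm x \<le> R \<longrightarrow> 0 < r \<longrightarrow> r \<le> R \<longrightarrow>
    near_potential r x
      \<le> ennreal (C * r powr (2 + min \<alpha> 0))"
proof -
  obtain C where C: "C \<ge> 0" "\<And>(x :: real ^ 'n) r. norm x \<le> R \<Longrightarrow> 0 < r \<Longrightarrow> r \<le> R \<Longrightarrow>
    (\<integral>\<^sup>+y. ennreal (norm y powr \<alpha> * norm (x - y) powr - n) * indicator {y. norm (x - y) < r} y \<partial>lborel)
      \<le> ennreal (C * r powr (2 + min \<alpha> 0))"
    using riesz_kernel_near_le[OF dim \<alpha> R] unfolding n_def by blast
  obtain M where M: "M > 0" "\<And>x. norm x \<le> 2 * R \<Longrightarrow> U x \<le> M" using U_bound by blast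
  show ?thesis
  proof (intro exI[of _ "\<kappa> * M powr p * C"] conjI allI impI)
    fix x :: "real ^ 'n" and r :: real assume x: "norm x \<le> R" and r: "0 < r" "r \<le> R"
    have "near_potential r x
      \<le> (\<integral>\<^sup>+y. ennreal (\<kappa> * M powr p) *
          (ennreal (norm y powr \<alpha> * norm (x - y) powr - n) * indicator {y. norm (x - y) < r} y) \<partial>lborel)"
    proof (intro nn_integral_mono)
      fix y :: "real ^ 'n"
      have "f y * norm (x - y) powr - n \<le> \<kappa> * M powr p * (norm y powr \<alpha> * norm (x - y) powr - n)"
        if "norm (x - y) < r"
      proof -
        have "norm y \<le> norm x + norm (x - y)" by (metis norm_minus_commute norm_triangle_sub)
        then have "U y \<le> M" using that x r by (intro M) simp
        then have "U y powr p \<le> M powr p" using U_pos[of y] p by (intro powr_mono2) auto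
        then have "\<kappa> * norm y powr \<alpha> * U y powr p \<le> \<kappa> * norm y powr \<alpha> * M powr p"
          using \<kappa> by (intro mult_left_mono) auto
        from mult_right_mono[OF this, of "norm (x - y) powr - n"] show ?thesis by (simp add: f_def mult_ac)
      qed
      then show "ennreal (f y * norm (x - y) powr - n) * indicator {y. norm (x - y) < r} y
        \<le> ennreal (\<kappa> * M powr p) *
          (ennreal (norm y powr \<alpha> * norm (x - y) powr - n) * indicator {y. norm (x - y) < r} y)"
        using \<kappa> by (auto simp: indicator_def ennreal_mult[symmetric] intro!: ennreal_leI)
    qed
    also have "\<dots> = ennreal (\<kappa> * M powr p) *
        (\<integral>\<^sup>+y. ennreal (norm y powr \<alpha> * norm (x - y) powr - n) * indicator {y. norm (x - y) < r} y \<partial>lborel)"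
      by (rule nn_integral_cmult) auto
    also have "\<dots> \<le> ennreal (\<kappa> * M powr p) * ennreal (C * r powr (2 + min \<alpha> 0))"
      by (intro mult_left_mono C x r) auto
    also have "\<dots> = ennreal (\<kappa> * M powr p * C * r powr (2 + min \<alpha> 0))"
      using \<kappa> C(1) by (simp add: ennreal_mult[symmetric] mult_ac)
    finally show "near_potential r x
      \<le> ennreal (\<kappa> * M powr p * C * r powr (2 + min \<alpha> 0))" .
  qed (use \<kappa> C(1) in auto)
qed

text \<open>
  The potential with the kernel cut off at height \<open>r powr - n\<close>: it is continuous in \<open>x\<close> by dominated
  convergence, and it approximates \<open>U\<close> locally uniformly.
\<close>
definition truncated :: "real \<Rightarrow> real ^ 'n \<Rightarrow> real" where
  "truncated r x = (\<integral>y. f y * max (norm (x - y)) r powr - n \<partial>lborel)"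

text \<open>
  The dominating function for dominated convergence: as long as \<open>x'\<close> stays within \<open>r\<close> of \<open>x\<close>, the kernel
  with pole \<open>x'\<close>, cut off at distance \<open>r\<close>, is at most a constant times the full kernel with pole \<open>x\<close>.
\<close>
lemma truncated_kernel_le:
  assumes "r > 0" "norm (x' - x) \<le> r" "y \<noteq> x"
  shows "max (norm (x' - y)) r powr - n \<le> 2 powr n * norm (x - y) powr - n"
proof -
  have "norm (x - y) \<le> norm (x' - y) + norm (x' - x)"
    using norm_triangle_ineq4[of "x' - y" "x' - x"] by simp
  then have "norm (x - y) / 2 \<le> max (norm (x' - y)) r" using assms by simp
  then have "max (norm (x' - y)) r powr - n \<le> (norm (x - y) / 2) powr - n"
    using assms n_pos by (intro powr_mono2') auto
  also have "\<dots> = 2 powr n * norm (x - y) powr - n" by (simp add: powr_divide powr_minus_divide)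
  finally show ?thesis .
qed

lemma integrable_truncated:
  assumes "r > 0"
  shows "integrable lborel (\<lambda>y. f y * max (norm (x - y)) r powr - n)"
proof (rule Bochner_Integration.integrable_bound)
  show "integrable lborel (\<lambda>y. 2 powr n * (f y * norm (x - y) powr - n))"
    using integrable_potential by simp
  show "AE y in lborel. norm (f y * max (norm (x - y)) r powr - n) \<le> norm (2 powr n * (f y * norm (x - y) powr - n))"
    using AE_lborel_singleton[of x]
  proof eventually_elim
    case (elim y)
    then show ?case using mult_left_mono[OF truncated_kernel_le[of r x x y] f_nonneg[of y]] assms f_nonneg[of y]
      by (simp add: mult_ac)
  qed
qed measurable

lemma continuous_on_truncated:
  assumes r: "r > 0"
  shows "continuous_on S (truncated r)"
proof -
  have "(\<lambda>i. truncated r (X i)) \<longlonglongrightarrow> truncated r x" if X: "X \<longlonglongrightarrow> x" for X x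
  proof -
    obtain N where N: "\<And>i. i \<ge> N \<Longrightarrow> norm (X i - x) \<le> r"
      using LIMSEQ_D[OF X r] less_imp_le by blast
    have "(\<lambda>i. truncated r (X (i + N))) \<longlonglongrightarrow> truncated r x"
      unfolding truncated_def
    proof (rule integral_dominated_convergence[where w = "\<lambda>y. 2 powr n * (f y * norm (x - y) powr - n)"])
      show "integrable lborel (\<lambda>y. 2 powr n * (f y * norm (x - y) powr - n))"
        using integrable_potential by simp
      have XN: "(\<lambda>i. X (i + N)) \<longlonglongrightarrow> x" using X by (rule LIMSEQ_ignore_initial_segment)
      show "AE y in lborel. (\<lambda>i. f y * max (norm (X (i + N) - y)) r powr - n) \<longlonglongrightarrow> f y * max (norm (x - y)) r powr - n"
        using r by (intro AE_I2 tendsto_intros XN) auto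
      show "AE y in lborel. norm (f y * max (norm (X (i + N) - y)) r powr - n) \<le> 2 powr n * (f y * norm (x - y) powr - n)" for i
        using AE_lborel_singleton[of x]
      proof eventually_elim
        case (elim y)
        then show ?case
          using mult_left_mono[OF truncated_kernel_le[of r "X (i + N)" x y] f_nonneg[of y]] r N[of "i + N"] f_nonneg[of y]
          by (simp add: mult_ac)
      qed
    qed measurable
    then show ?thesis by (rule LIMSEQ_offset)
  qed
  then show ?thesis unfolding continuous_on_sequentially o_def by blast
qed

lemma truncated_approx:
  assumes "r > 0"
  shows "ennreal \<bar>U x - truncated r x\<bar> \<le>
    near_potential r x"
proof -
  have "U x - truncated r x = (\<integral>y. f y * norm (x - y) powr - n - f y * max (norm (x - y)) r powr - n \<partial>lborel)"
    unfolding U_integral[of x] truncated_def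
    by (rule Bochner_Integration.integral_diff[symmetric, OF integrable_potential integrable_truncated[OF assms]])
  then have "ennreal \<bar>U x - truncated r x\<bar> = ennreal (norm (\<integral>y. f y * norm (x - y) powr - n - f y * max (norm (x - y)) r powr - n \<partial>lborel))"
    by simp
  also have "\<dots> \<le> (\<integral>\<^sup>+y. ennreal (norm (f y * norm (x - y) powr - n - f y * max (norm (x - y)) r powr - n)) \<partial>lborel)"
    by (rule integral_norm_bound_ennreal[OF Bochner_Integration.integrable_diff[OF integrable_potential integrable_truncated[OF assms]]])
  also have "\<dots> \<le> near_potential r x"
  proof (rule nn_integral_mono_AE)
    show "AE y in lborel. ennreal (norm (f y * norm (x - y) powr - n - f y * max (norm (x - y)) r powr - n))
      \<le> ennreal (f y * norm (x - y) powr - n) * indicator {y. norm (x - y) < r} y"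
      using AE_lborel_singleton[of x]
    proof eventually_elim
      case (elim y)
      have "r powr - n \<le> norm (x - y) powr - n" if "norm (x - y) < r"
        using elim that n_pos by (intro powr_mono2') auto
      from mult_left_mono[OF this f_nonneg[of y]] show ?case
        using f_nonneg[of y] by (auto simp: indicator_def max_def intro!: ennreal_leI)
    qed
  qed
  finally show ?thesis .
qed

text \<open>
  A locally uniform limit of the continuous functions \<open>truncated r\<close>; the error is the potential over a ball
  of radius \<open>r\<close>, controlled by \<open>potential_near_le\<close>.
\<close>
lemma continuous_on_U: "continuous_on S U"
proof -
  have "continuous_on (cball 0 R) U" if R: "R > 0" for R
  proof (rule uniform_limit_theorem[where f = "\<lambda>k. truncated (R * inverse (real (Suc k)))" and F = sequentially])
    show "\<forall>\<^sub>F k in sequentially. continuous_on (cball 0 R) (truncated (R * inverse (real (Suc k))))"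
      using R by (intro always_eventually allI continuous_on_truncated) auto
    obtain C where C: "C \<ge> 0" "\<And>x r. norm x \<le> R \<Longrightarrow> 0 < r \<Longrightarrow> r \<le> R \<Longrightarrow>
      near_potential r x
        \<le> ennreal (C * r powr (2 + min \<alpha> 0))"
      using potential_near_le[OF R] by blast
    have rad: "(\<lambda>k. R * inverse (real (Suc k))) \<longlonglongrightarrow> 0"
      using tendsto_mult_right_zero[OF LIMSEQ_inverse_real_of_nat, of R] by simp
    have "(\<lambda>k. (R * inverse (real (Suc k))) powr (2 + min \<alpha> 0)) \<longlonglongrightarrow> 0"
      by (rule tendsto_zero_powrI[OF rad tendsto_const]) (use R \<alpha> in \<open>auto intro!: always_eventually\<close>)
    from tendsto_mult_right_zero[OF this, of C] have lim: "(\<lambda>k. C * (R * inverse (real (Suc k))) powr (2 + min \<alpha> 0)) \<longlonglongrightarrow> 0" .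
    show "uniform_limit (cball 0 R) (\<lambda>k. truncated (R * inverse (real (Suc k)))) U sequentially"
    proof (rule uniform_limitI)
      fix e :: real assume "e > 0"
      with lim have "\<forall>\<^sub>F k in sequentially. C * (R * inverse (real (Suc k))) powr (2 + min \<alpha> 0) < e"
        by (rule order_tendstoD)
      then show "\<forall>\<^sub>F k in sequentially. \<forall>x\<in>cball 0 R. dist (truncated (R * inverse (real (Suc k))) x) (U x) < e"
      proof eventually_elim
        case (elim k)
        have r: "0 < R * inverse (real (Suc k))" "R * inverse (real (Suc k)) \<le> R" using R by (auto simp: field_simps)
        show ?case
        proof
          fix x :: "real ^ 'n" assume "x \<in> cball 0 R"
          then have "ennreal \<bar>U x - truncated (R * inverse (real (Suc k))) x\<bar> \<le> ennreal (C * (R * inverse (real (Suc k))) powr (2 + min \<alpha> 0))"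
            using order_trans[OF truncated_approx[OF r(1)] C(2)[OF _ r]] by simp
          then have "\<bar>U x - truncated (R * inverse (real (Suc k))) x\<bar> \<le> C * (R * inverse (real (Suc k))) powr (2 + min \<alpha> 0)"
            using C(1) by (subst (asm) ennreal_le_iff) auto
          then show "dist (truncated (R * inverse (real (Suc k))) x) (U x) < e" using elim by (simp add: dist_real_def)
        qed
      qed
    qed
  qed simp
  then have "continuous_on (ball 0 R) U" if "R > 0" for R
    using that continuous_on_subset ball_subset_cball by blast
  then have "isCont U x" for x
    using continuous_on_interior[of "ball 0 (norm x + 1)" U x] by (simp add: add_nonneg_pos)
  then show ?thesis by (simp add: continuous_at_imp_continuous_on)
qed

end

section \<open>Kelvin transform of the integral equation\<close>

context riesz_solution
begin

definition kelvin :: "real \<Rightarrow> real ^ 'n \<Rightarrow> real" where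
  "kelvin l x = (l / norm x) powr n * U (inversion l x)"

text \<open>
  The source term whose potential is the Kelvin transform of \<open>U\<close>: the Jacobian of the inversion times the
  factor by which the kernel changes under it (\<open>kernel_inversion\<close>).
\<close>
definition kelvin_source :: "real \<Rightarrow> real ^ 'n \<Rightarrow> real" where
  "kelvin_source l y = (l / norm y) ^ (2 * CARD('n)) * (norm y / l) powr n * f (inversion l y)"

definition kernel :: "real ^ 'n \<Rightarrow> real ^ 'n \<Rightarrow> real" where
  "kernel x y = norm (x - y) powr - n"

text \<open>
  The Kelvin transform of \<open>kernel\<close> in its first argument: a multiple of the kernel whose pole is the mirror
  image of \<open>x\<close>.
\<close>
definition reflected_kernel :: "real \<Rightarrow> real ^ 'n \<Rightarrow> real ^ 'n \<Rightarrow> real" where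
  "reflected_kernel l x y = (l / norm x) powr n * norm (inversion l x - y) powr - n"

abbreviation kernel_integral :: "(real ^ 'n) set \<Rightarrow> real ^ 'n \<Rightarrow> ennreal" where
  "kernel_integral S x \<equiv> (\<integral>\<^sup>+y. ennreal (norm y powr \<alpha> * kernel x y) * indicator S y \<partial>lborel)"

lemma kernels_measurable [measurable]:
  "kernel x \<in> borel_measurable borel" "reflected_kernel l x \<in> borel_measurable borel"
  "kelvin l \<in> borel_measurable borel" "kelvin_source l \<in> borel_measurable borel"
  unfolding kernel_def[abs_def] reflected_kernel_def[abs_def] kelvin_def[abs_def] kelvin_source_def[abs_def]
  by measurable

lemma kernels_nonneg: "kernel x y \<ge> 0" "reflected_kernel l x y \<ge> 0" "l > 0 \<Longrightarrow> kelvin_source l y \<ge> 0"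
  using f_nonneg by (auto simp: kernel_def reflected_kernel_def kelvin_source_def)

text \<open>
  The last summand is positive if \<open>x\<close> and \<open>y\<close> lie on the same side of the sphere. This is the reason why the
  reflected kernel is the smaller one there (\<open>kernel_gap\<close>).
\<close>
lemma norm_inversion_diff_sq:
  fixes x y :: "real ^ 'n"
  assumes "l > 0" "x \<noteq> 0"
  shows "(norm x * norm (inversion l x - y) / l)\<^sup>2 =
    (norm (x - y))\<^sup>2 + ((norm x)\<^sup>2 - l\<^sup>2) * ((norm y)\<^sup>2 - l\<^sup>2) / l\<^sup>2"
proof -
  have A: "(norm x)\<^sup>2 * (norm (inversion l x - y))\<^sup>2 = l\<^sup>2 * l\<^sup>2 - 2 * l\<^sup>2 * (x \<bullet> y) + (norm x)\<^sup>2 * (norm y)\<^sup>2"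
  proof -
    have "(norm (inversion l x - y))\<^sup>2 = (norm (inversion l x))\<^sup>2 - 2 * (inversion l x \<bullet> y) + (norm y)\<^sup>2"
      by (simp add: power2_norm_eq_inner inner_diff_left inner_diff_right inner_commute)
    also have "norm (inversion l x) = l\<^sup>2 / norm x" by (rule norm_inversion)
    also have "inversion l x \<bullet> y = l\<^sup>2 / (norm x)\<^sup>2 * (x \<bullet> y)" by (simp add: inversion_def)
    finally show ?thesis using assms by (simp add: field_simps power2_eq_square)
  qed
  have B: "(norm (x - y))\<^sup>2 = (norm x)\<^sup>2 - 2 * (x \<bullet> y) + (norm y)\<^sup>2"
    by (simp add: power2_norm_eq_inner inner_diff_left inner_diff_right inner_commute)
  show ?thesis
    unfolding power_mult_distrib power_divide A B using assms by (simp add: field_simps)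
qed

lemma norm_diff_inversion_swap:
  fixes x y :: "real ^ 'n"
  assumes "l > 0" "x \<noteq> 0" "y \<noteq> 0"
  shows "norm (x - inversion l y) * norm y = norm x * norm (inversion l x - y)"
proof -
  have "(norm y * norm (inversion l y - x) / l)\<^sup>2 = (norm x * norm (inversion l x - y) / l)\<^sup>2"
    unfolding norm_inversion_diff_sq[OF assms(1,2)] norm_inversion_diff_sq[OF assms(1,3)]
    by (simp only: norm_minus_commute[of y x] mult.commute[of "(norm y)\<^sup>2 - l\<^sup>2"])
  then have "norm y * norm (inversion l y - x) / l = norm x * norm (inversion l x - y) / l"
    by (rule power2_eq_imp_eq) (use assms in auto)
  then show ?thesis using assms by (simp add: norm_minus_commute[of x "inversion l y"] mult.commute[of _ "norm y"])
qed

lemma norm_diff_inversions: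
  fixes x y :: "real ^ 'n"
  assumes "l > 0" "x \<noteq> 0" "y \<noteq> 0"
  shows "norm (inversion l x - inversion l y) * (norm x * norm y) = l\<^sup>2 * norm (x - y)"
proof -
  have z: "inversion l x \<noteq> 0" using assms by (simp add: inversion_def)
  have "norm (inversion l x - inversion l y) * norm y = norm (inversion l x) * norm (inversion l (inversion l x) - y)"
    using norm_diff_inversion_swap[OF assms(1) z assms(3)] .
  then show ?thesis using assms by (simp add: inversion_inversion norm_inversion field_simps power2_eq_square)
qed

lemma reflected_kernel_eq:
  fixes x y :: "real ^ 'n"
  assumes "l > 0" "x \<noteq> 0"
  shows "reflected_kernel l x y = (norm x * norm (inversion l x - y) / l) powr - n"
proof -
  have "norm x * norm (inversion l x - y) / l = (norm x / l) * norm (inversion l x - y)" by simp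
  also have "\<dots> powr - n = (norm x / l) powr - n * norm (inversion l x - y) powr - n"
    by (rule powr_mult)
  also have "(norm x / l) powr - n = (l / norm x) powr n"
    using assms by (simp add: powr_divide powr_minus field_simps)
  finally show ?thesis by (simp add: reflected_kernel_def)
qed

lemma kernel_inversion:
  fixes x y :: "real ^ 'n"
  assumes "l > 0" "x \<noteq> 0" "y \<noteq> 0"
  shows "kernel x (inversion l y) = (norm y / l) powr n * reflected_kernel l x y"
proof -
  have "norm (x - inversion l y) = (l / norm y) * (norm x * norm (inversion l x - y) / l)"
    using norm_diff_inversion_swap[OF assms] assms by (simp add: field_simps)
  then have "kernel x (inversion l y) = ((l / norm y) * (norm x * norm (inversion l x - y) / l)) powr - n"
    by (simp add: kernel_def)
  also have "\<dots> = (l / norm y) powr - n * reflected_kernel l x y"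
    unfolding reflected_kernel_eq[OF assms(1,2)] by (rule powr_mult)
  also have "(l / norm y) powr - n = (norm y / l) powr n"
    using assms by (simp add: powr_divide powr_minus field_simps)
  finally show ?thesis .
qed

lemma reflected_kernel_inversion:
  fixes x y :: "real ^ 'n"
  assumes "l > 0" "x \<noteq> 0" "y \<noteq> 0"
  shows "reflected_kernel l x (inversion l y) = (norm y / l) powr n * kernel x y"
proof -
  have "norm x * norm (inversion l x - inversion l y) / l = (l / norm y) * norm (x - y)"
    using norm_diff_inversions[OF assms] assms by (simp add: field_simps power2_eq_square)
  then have "reflected_kernel l x (inversion l y) = ((l / norm y) * norm (x - y)) powr - n"
    by (simp add: reflected_kernel_eq[OF assms(1,2)])
  also have "\<dots> = (l / norm y) powr - n * kernel x y"
    unfolding kernel_def by (rule powr_mult)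
  also have "(l / norm y) powr - n = (norm y / l) powr n"
    using assms by (simp add: powr_divide powr_minus field_simps)
  finally show ?thesis .
qed

text \<open>
  The inversion carries the interior of the sphere to its exterior, so an integral over the whole space can be
  written over the exterior alone.
\<close>
lemma fold_nn_integral:
  fixes F :: "real ^ 'n \<Rightarrow> real"
  assumes l: "l > 0" and [measurable]: "F \<in> borel_measurable borel" and F: "\<And>y. F y \<ge> 0"
  shows "(\<integral>\<^sup>+y. ennreal (F y) \<partial>lborel) =
    (\<integral>\<^sup>+y. ennreal (indicator {y. norm y > l} y * (F y + (l / norm y) ^ (2 * CARD('n)) * F (inversion l y))) \<partial>lborel)"
proof -
  have "(\<integral>\<^sup>+y. ennreal (F y) \<partial>lborel) =
    (\<integral>\<^sup>+y. ennreal (F y) * indicator {y. norm y > l} y + ennreal (F y) * indicator {y. norm y < l} y \<partial>lborel)"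
  proof (rule nn_integral_cong_AE)
    have "AE y in lborel. y \<notin> sphere (0 :: real ^ 'n) l"
      by (rule AE_not_in) (metis negligible_sphere negligible_iff_null_sets null_sets_completion_iff sets_lborel borel_closed closed_sphere)
    then show "AE y in lborel. ennreal (F y) =
      ennreal (F y) * indicator {y. norm y > l} y + ennreal (F y) * indicator {y. norm y < l} y"
      by eventually_elim (auto simp: indicator_def)
  qed
  also have "\<dots> = (\<integral>\<^sup>+y. ennreal (F y) * indicator {y. norm y > l} y \<partial>lborel) +
      (\<integral>\<^sup>+y. ennreal (F y) * indicator {y. norm y < l} y \<partial>lborel)"
    by (rule nn_integral_add) auto
  also have "(\<integral>\<^sup>+y. ennreal (F y) * indicator {y. norm y < l} y \<partial>lborel) =
    (\<integral>\<^sup>+y. ennreal ((l / norm y) ^ (2 * CARD('n))) * ennreal (F (inversion l y)) * indicator {y. norm y > l} y \<partial>lborel)"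
    by (rule nn_integral_inversion[OF l]) auto
  also have "(\<integral>\<^sup>+y. ennreal (F y) * indicator {y. norm y > l} y \<partial>lborel) + \<dots> =
    (\<integral>\<^sup>+y. ennreal (F y) * indicator {y. norm y > l} y +
      ennreal ((l / norm y) ^ (2 * CARD('n))) * ennreal (F (inversion l y)) * indicator {y. norm y > l} y \<partial>lborel)"
    by (rule nn_integral_add[symmetric]) auto
  also have "\<dots> = (\<integral>\<^sup>+y. ennreal (indicator {y. norm y > l} y * (F y + (l / norm y) ^ (2 * CARD('n)) * F (inversion l y))) \<partial>lborel)"
    using F l by (intro nn_integral_cong) (auto simp: indicator_def ennreal_mult ennreal_plus)
  finally show ?thesis .
qed

abbreviation outside :: "real \<Rightarrow> real ^ 'n \<Rightarrow> real" where
  "outside l \<equiv> indicator {y. norm y > l}"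

lemma has_bochner_integral_from_nn:
  assumes "ennreal c = (\<integral>\<^sup>+y. ennreal (g y) \<partial>lborel)" "c \<ge> 0" "\<And>y. g y \<ge> 0"
    "g \<in> borel_measurable borel"
  shows "has_bochner_integral lborel g c"
  using assms by (intro has_bochner_integral_nn_integral) auto

text \<open>
  Folding the potential of \<open>f\<close> to the exterior pairs \<open>f\<close> with the kernel and the reflected source with the
  reflected kernel. For the Kelvin transform the roles are exchanged (\<open>kelvin_fold\<close>), so the difference of the
  two factorises (\<open>difference_formula\<close>).
\<close>
lemma U_fold:
  fixes x :: "real ^ 'n"
  assumes "l > 0" "norm x > l"
  shows "has_bochner_integral lborel
    (\<lambda>y. outside l y * (f y * kernel x y + kelvin_source l y * reflected_kernel l x y)) (U x)"
proof (rule has_bochner_integral_from_nn)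
  have "ennreal (U x) = (\<integral>\<^sup>+y. ennreal (f y * kernel x y) \<partial>lborel)"
    using U_nn_integral[of x] by (simp add: kernel_def)
  also have "\<dots> = (\<integral>\<^sup>+y. ennreal (outside l y * (f y * kernel x y +
      (l / norm y) ^ (2 * CARD('n)) * (f (inversion l y) * kernel x (inversion l y)))) \<partial>lborel)"
    using assms by (intro fold_nn_integral) (auto simp: f_nonneg kernels_nonneg)
  also have "\<dots> = (\<integral>\<^sup>+y. ennreal (outside l y * (f y * kernel x y + kelvin_source l y * reflected_kernel l x y)) \<partial>lborel)"
  proof (intro nn_integral_cong arg_cong[where f = ennreal])
    fix y :: "real ^ 'n"
    have "kernel x (inversion l y) = (norm y / l) powr n * reflected_kernel l x y" if "norm y > l"
      by (rule kernel_inversion) (use assms that in auto)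
    then show "outside l y * (f y * kernel x y + (l / norm y) ^ (2 * CARD('n)) * (f (inversion l y) * kernel x (inversion l y)))
      = outside l y * (f y * kernel x y + kelvin_source l y * reflected_kernel l x y)"
      by (auto simp: indicator_def kelvin_source_def)
  qed
  finally show "ennreal (U x) = \<dots>" .
qed (use assms in \<open>auto simp: f_nonneg kernels_nonneg less_imp_le[OF U_pos]\<close>)

lemma kelvin_fold:
  fixes x :: "real ^ 'n"
  assumes "l > 0" "norm x > l"
  shows "has_bochner_integral lborel
    (\<lambda>y. outside l y * (f y * reflected_kernel l x y + kelvin_source l y * kernel x y)) (kelvin l x)"
proof (rule has_bochner_integral_from_nn)
  have "ennreal (kelvin l x) = ennreal ((l / norm x) powr n) * ennreal (U (inversion l x))"
    by (simp add: kelvin_def ennreal_mult less_imp_le[OF U_pos])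
  also have "\<dots> = (\<integral>\<^sup>+y. ennreal ((l / norm x) powr n) * ennreal (f y * norm (inversion l x - y) powr - n) \<partial>lborel)"
    unfolding U_nn_integral[of "inversion l x"] by (rule nn_integral_cmult[symmetric]) auto
  also have "\<dots> = (\<integral>\<^sup>+y. ennreal (f y * reflected_kernel l x y) \<partial>lborel)"
    by (intro nn_integral_cong) (simp add: reflected_kernel_def ennreal_mult[symmetric] f_nonneg mult_ac)
  also have "\<dots> = (\<integral>\<^sup>+y. ennreal (outside l y * (f y * reflected_kernel l x y +
      (l / norm y) ^ (2 * CARD('n)) * (f (inversion l y) * reflected_kernel l x (inversion l y)))) \<partial>lborel)"
    using assms by (intro fold_nn_integral) (auto simp: f_nonneg kernels_nonneg)
  also have "\<dots> = (\<integral>\<^sup>+y. ennreal (outside l y * (f y * reflected_kernel l x y + kelvin_source l y * kernel x y)) \<partial>lborel)"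
  proof (intro nn_integral_cong arg_cong[where f = ennreal])
    fix y :: "real ^ 'n"
    have "reflected_kernel l x (inversion l y) = (norm y / l) powr n * kernel x y" if "norm y > l"
      by (rule reflected_kernel_inversion) (use assms that in auto)
    then show "outside l y * (f y * reflected_kernel l x y + (l / norm y) ^ (2 * CARD('n)) * (f (inversion l y) * reflected_kernel l x (inversion l y)))
      = outside l y * (f y * reflected_kernel l x y + kelvin_source l y * kernel x y)"
      by (auto simp: indicator_def kelvin_source_def)
  qed
  finally show "ennreal (kelvin l x) = \<dots>" .
qed (use assms in \<open>auto simp: f_nonneg kernels_nonneg kelvin_def less_imp_le[OF U_pos]\<close>)

abbreviation gap_integrand :: "real \<Rightarrow> real ^ 'n \<Rightarrow> real ^ 'n \<Rightarrow> real" where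
  "gap_integrand l x y \<equiv> outside l y * ((f y - kelvin_source l y) * (kernel x y - reflected_kernel l x y))"

lemma difference_formula:
  fixes x :: "real ^ 'n"
  assumes "l > 0" "norm x > l"
  shows "has_bochner_integral lborel
    (\<lambda>y. gap_integrand l x y) (U x - kelvin l x)"
  using has_bochner_integral_diff[OF U_fold[OF assms] kelvin_fold[OF assms]]
  by (simp add: algebra_simps)

lemma kernel_gap:
  fixes x y :: "real ^ 'n"
  assumes "l > 0" "norm x > l" "norm y > l" "x \<noteq> y"
  shows "reflected_kernel l x y < kernel x y"
proof -
  have "0 < (norm x)\<^sup>2 - l\<^sup>2" "0 < (norm y)\<^sup>2 - l\<^sup>2"
    using assms by (auto intro: power_strict_mono)
  then have "0 < ((norm x)\<^sup>2 - l\<^sup>2) * ((norm y)\<^sup>2 - l\<^sup>2) / l\<^sup>2" using assms by simp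
  moreover have x: "x \<noteq> 0" using assms by auto
  ultimately have "(norm (x - y))\<^sup>2 < (norm x * norm (inversion l x - y) / l)\<^sup>2"
    using norm_inversion_diff_sq[of l x y] assms by simp
  then have "norm (x - y) < norm x * norm (inversion l x - y) / l"
    by (rule power2_less_imp_less) (use assms in auto)
  then show ?thesis
    unfolding kernel_def reflected_kernel_eq[OF assms(1) x] by (intro powr_less_mono2_neg) (use assms n_pos in auto)
qed

text \<open>
  The Kelvin transform solves the original equation up to the last factor, whose exponent is positive precisely
  for subcritical \<open>p\<close>.
\<close>
lemma kelvin_source_eq:
  fixes y :: "real ^ 'n"
  assumes "l > 0" "y \<noteq> 0"
  shows "kelvin_source l y = \<kappa> * norm y powr \<alpha> * kelvin l y powr p *
    (l / norm y) powr (real CARD('n) + 2 + 2 * \<alpha> - n * p)"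
proof -
  define t where "t = l / norm y"
  define u where "u = U (inversion l y)"
  have t: "t > 0" and u: "u > 0" using assms U_pos by (auto simp: t_def u_def)
  have "norm (inversion l y) = t powr 2 * norm y" using assms by (simp add: norm_inversion t_def field_simps power2_eq_square)
  then have "f (inversion l y) = \<kappa> * (t powr (2 * \<alpha>) * norm y powr \<alpha>) * u powr p"
    by (simp add: f_def u_def powr_mult powr_powr)
  moreover have "(l / norm y) ^ (2 * CARD('n)) = t powr (2 * real CARD('n))"
    using t powr_realpow[of t "2 * CARD('n)"] by (simp add: t_def)
  moreover have "(norm y / l) powr n = t powr - n" using assms by (simp add: t_def powr_divide powr_minus field_simps)
  ultimately have "kelvin_source l y = \<kappa> * norm y powr \<alpha> * u powr p * (t powr (2 * real CARD('n)) * t powr - n * t powr (2 * \<alpha>))"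
    by (simp add: kelvin_source_def mult_ac)
  also have "t powr (2 * real CARD('n)) * t powr - n * t powr (2 * \<alpha>) = t powr (n * p) * t powr (real CARD('n) + 2 + 2 * \<alpha> - n * p)"
    by (simp add: powr_add[symmetric] n_def add.assoc)
  finally show ?thesis
    using t u by (simp add: kelvin_def powr_mult powr_powr t_def[symmetric] u_def[symmetric] mult_ac)
qed

end

section \<open>Smallness of potentials over small sets\<close>

lemma powr_diff_le:
  fixes a b M p :: real
  assumes "0 < b" "b \<le> a" "a \<le> M" "p > 1"
  shows "a powr p - b powr p \<le> p * M powr (p - 1) * (a - b)"
proof (cases "a = b")
  case False
  then have "b < a" using assms by simp
  moreover have "((\<lambda>x. x powr p) has_real_derivative p * x powr (p - 1)) (at x)" if "b \<le> x" for x
    using that assms by (auto intro!: derivative_eq_intros)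
  ultimately obtain z where z: "b < z" "z < a" "a powr p - b powr p = (a - b) * (p * z powr (p - 1))"
    using MVT2[of b a "\<lambda>x. x powr p" "\<lambda>x. p * x powr (p - 1)"] by auto
  have "z powr (p - 1) \<le> M powr (p - 1)" using z assms by (intro powr_mono2) auto
  then have "(a - b) * (p * z powr (p - 1)) \<le> (a - b) * (p * M powr (p - 1))"
    using assms by (intro mult_left_mono) auto
  then show ?thesis using z by (simp add: mult_ac)
qed simp

lemma AE_avoids_open_imp_empty:
  fixes A :: "'a::euclidean_space set"
  assumes "AE y in lborel. y \<notin> A" "open A"
  shows "A = {}"
proof -
  have "A \<in> null_sets lborel" using assms by (subst (asm) AE_iff_null) auto
  then have "negligible A" by (simp add: negligible_iff_null_sets null_sets_completionI)
  then show ?thesis using open_not_negligible assms(2) by blast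
qed

lemma integral_pos_if_pos_on_open:
  fixes g :: "'a::euclidean_space \<Rightarrow> real"
  assumes "integrable lborel g" "AE y in lborel. g y \<ge> 0" "open A" "A \<noteq> {}"
    "AE y in lborel. y \<in> A \<longrightarrow> g y > 0"
  shows "0 < (\<integral>y. g y \<partial>lborel)"
proof (rule ccontr)
  assume "\<not> ?thesis"
  moreover have "0 \<le> (\<integral>y. g y \<partial>lborel)" using assms(2) by (rule integral_nonneg_AE)
  ultimately have "AE y in lborel. g y = 0"
    using integral_nonneg_eq_0_iff_AE[OF assms(1,2)] by simp
  with assms(5) have "AE y in lborel. y \<notin> A" by eventually_elim auto
  then show False using AE_avoids_open_imp_empty assms(3,4) by blast
qed

context riesz_solution
begin

lemma kelvin_le:
  assumes "l > 0" "norm x \<ge> l" "\<And>z. norm z \<le> l \<Longrightarrow> U z \<le> M" "M > 0"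
  shows "kelvin l x \<le> M * (l / norm x) powr n" "kelvin l x \<le> M"
proof -
  have "l * l \<le> l * norm x" using assms by simp
  then have "norm (inversion l x) \<le> l"
    using assms by (simp add: norm_inversion divide_le_eq power2_eq_square)
  then show *: "kelvin l x \<le> M * (l / norm x) powr n"
    using assms(3)[of "inversion l x"] by (simp add: kelvin_def mult.commute mult_right_mono)
  have "l / norm x \<le> 1" using assms by (auto simp: divide_le_eq)
  then have "(l / norm x) powr n \<le> 1 powr n" using assms n_pos by (intro powr_mono2) auto
  then have "M * (l / norm x) powr n \<le> M * 1" using assms by (intro mult_left_mono) auto
  with * show "kelvin l x \<le> M" by simp
qed

lemma kelvin_pos: "l > 0 \<Longrightarrow> x \<noteq> 0 \<Longrightarrow> kelvin l x > 0"
  using U_pos by (simp add: kelvin_def)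

lemma kernel_integral_near_small:
  assumes R: "R > 0" and e: "e > 0"
  shows "\<exists>r>0. r < R \<and> (\<forall>x. norm x \<le> R \<longrightarrow> kernel_integral {y. norm (x - y) < r} x \<le> ennreal e)"
proof -
  obtain C where C: "C \<ge> 0" "\<And>(x :: real ^ 'n) r. norm x \<le> R \<Longrightarrow> 0 < r \<Longrightarrow> r \<le> R \<Longrightarrow>
    kernel_integral {y. norm (x - y) < r} x \<le> ennreal (C * r powr (2 + min \<alpha> 0))"
    using riesz_kernel_near_le[OF dim \<alpha> R] unfolding n_def[symmetric] kernel_def by blast
  have "((\<lambda>r. r powr (2 + min \<alpha> 0)) \<longlongrightarrow> 0) (at_right 0)"
    by (rule tendsto_zero_powrI[OF _ tendsto_const])
       (use \<alpha> in \<open>auto intro: eventually_at_right_less eventually_mono[OF eventually_at_right_less]\<close>)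
  from tendsto_mult_right_zero[OF this, of C]
  have "\<forall>\<^sub>F r in at_right 0. C * r powr (2 + min \<alpha> 0) < e" using e by (rule order_tendstoD)
  moreover have "\<forall>\<^sub>F r::real in at_right 0. 0 < r \<and> r < R" by (rule eventually_at_rightI[of 0 R]) (use R in auto)
  ultimately have "\<forall>\<^sub>F r in at_right 0. C * r powr (2 + min \<alpha> 0) < e \<and> 0 < r \<and> r < R"
    by eventually_elim auto
  then obtain r where r: "C * r powr (2 + min \<alpha> 0) < e" "0 < r" "r < R"
    using eventually_happens trivial_limit_at_right_real by blast
  have "kernel_integral {y. norm (x - y) < r} x \<le> ennreal e" if "norm x \<le> R" for x
    by (rule order_trans[OF C(2)[OF that r(2)] ennreal_leI]) (use r in auto)
  with r show ?thesis by blast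
qed

lemma small_potential_ball:
  assumes "e > 0"
  shows "\<exists>r>0. \<forall>x. norm x < r \<longrightarrow> kernel_integral {y. norm y < r} x \<le> ennreal e"
proof -
  obtain r where r: "r > 0" "r < 1" "\<And>x. norm x \<le> 1 \<Longrightarrow> kernel_integral {y. norm (x - y) < r} x \<le> ennreal e"
    using kernel_integral_near_small[of 1 e] assms by auto
  show ?thesis
  proof (intro exI[of _ "r / 2"] conjI allI impI)
    fix x :: "real ^ 'n" assume x: "norm x < r / 2"
    have "kernel_integral {y. norm y < r / 2} x \<le> kernel_integral {y. norm (x - y) < r} x"
    proof (intro nn_integral_mono)
      fix y :: "real ^ 'n"
      show "ennreal (norm y powr \<alpha> * kernel x y) * indicator {y. norm y < r / 2} y
        \<le> ennreal (norm y powr \<alpha> * kernel x y) * indicator {y. norm (x - y) < r} y"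
        using x norm_triangle_ineq4[of x y] by (auto simp: indicator_def)
    qed
    also have "\<dots> \<le> ennreal e" using x r by (intro r(3)) auto
    finally show "kernel_integral {y. norm y < r / 2} x \<le> ennreal e" .
  qed (use r in auto)
qed

text \<open>
  As \<open>d\<close> decreases to \<open>0\<close> the open shells decrease to the empty set.
\<close>
lemma emeasure_thin_shell:
  assumes "l > 0" "e > 0"
  shows "\<exists>d>0. d < l \<and> emeasure lborel {y :: real ^ 'n. l < norm y \<and> norm y < l + d} < ennreal e"
proof -
  define A where "A k = {y :: real ^ 'n. l < norm y \<and> norm y < l + l * inverse (real (Suc (Suc k)))}" for k
  have mono: "l * inverse (real (Suc (Suc k'))) \<le> l * inverse (real (Suc (Suc k)))" if "k \<le> k'" for k k'
    using that assms by (intro mult_left_mono le_imp_inverse_le) auto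
  have "(\<lambda>k. emeasure lborel (A k)) \<longlonglongrightarrow> emeasure lborel (\<Inter>k. A k)"
  proof (rule Lim_emeasure_decseq)
    show "range A \<subseteq> sets lborel" unfolding A_def by auto
    show "decseq A" unfolding decseq_def A_def using mono by (force intro: order_less_le_trans)
    fix k
    have "emeasure lborel (A k) \<le> emeasure lborel (ball 0 (2 * l) :: (real^'n) set)"
    proof (rule emeasure_mono)
      have "l * inverse (real (Suc (Suc k))) \<le> l * 1"
        using assms by (intro mult_left_mono) (auto simp: inverse_le_1_iff)
      then show "A k \<subseteq> ball 0 (2 * l)" unfolding A_def by auto
    qed simp
    also have "\<dots> < \<infinity>" using emeasure_lborel_ball_finite by simp
    finally show "emeasure lborel (A k) \<noteq> \<infinity>" by simp
  qed
  moreover have "(\<Inter>k. A k) = {}"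
  proof -
    have lim: "(\<lambda>k. l * inverse (real (Suc (Suc k)))) \<longlonglongrightarrow> 0"
      using tendsto_mult_right_zero[OF LIMSEQ_Suc[OF LIMSEQ_inverse_real_of_nat], of l] by simp
    have False if "\<And>k. y \<in> A k" for y
    proof -
      have "norm y - l > 0" using that[of 0] by (simp add: A_def)
      from order_tendstoD(2)[OF lim this] obtain k where "l * inverse (real (Suc (Suc k))) < norm y - l"
        by (auto simp: eventually_sequentially)
      then show False using that[of k] by (simp add: A_def)
    qed
    then show ?thesis by auto
  qed
  ultimately have "(\<lambda>k. emeasure lborel (A k)) \<longlonglongrightarrow> 0" by simp
  then have "\<forall>\<^sub>F k in sequentially. emeasure lborel (A k) < ennreal e"
    using assms by (intro order_tendstoD) auto
  then obtain k where k: "emeasure lborel (A k) < ennreal e" by (auto simp: eventually_sequentially)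
  have "l * inverse (real (Suc (Suc k))) < l * 1"
    using assms by (intro mult_strict_left_mono) (auto simp: inverse_less_1_iff)
  then show ?thesis using k assms unfolding A_def by (intro exI[of _ "l * inverse (real (Suc (Suc k)))"]) auto
qed

text \<open>
  Near \<open>x\<close> the potential is small by \<open>kernel_integral_near_small\<close>; away from \<open>x\<close> the integrand is bounded
  and the shell has small measure.
\<close>
lemma small_potential_shell:
  assumes l: "l > 0" and e: "e > 0"
  shows "\<exists>d>0. d < l \<and> (\<forall>x. norm x \<le> 2 * l \<longrightarrow>
    kernel_integral {y. l < norm y \<and> norm y < l + d} x \<le> ennreal e)"
proof -
  obtain r where r: "r > 0" "\<And>x. norm x \<le> 2 * l \<Longrightarrow> kernel_integral {y. norm (x - y) < r} x \<le> ennreal (e / 2)"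
    using kernel_integral_near_small[of "2 * l" "e / 2"] l e by auto
  define A where "A = max (l powr \<alpha>) ((2 * l) powr \<alpha>)"
  define B where "B = A * r powr - n"
  have B: "B > 0" using l r by (auto simp: A_def B_def less_max_iff_disj)
  obtain d where d: "d > 0" "d < l" "emeasure lborel {y :: real ^ 'n. l < norm y \<and> norm y < l + d} < ennreal (e / (2 * B))"
    using emeasure_thin_shell[OF l, of "e / (2 * B)"] e B by auto
  let ?S = "{y :: real ^ 'n. l < norm y \<and> norm y < l + d}"
  show ?thesis
  proof (intro exI[of _ d] conjI allI impI)
    fix x :: "real ^ 'n" assume x: "norm x \<le> 2 * l"
    have "kernel_integral ?S x
      \<le> (\<integral>\<^sup>+y. ennreal (norm y powr \<alpha> * kernel x y) * indicator {y. norm (x - y) < r} y + ennreal B * indicator ?S y \<partial>lborel)"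
    proof (intro nn_integral_mono)
      fix y :: "real ^ 'n"
      have "norm y powr \<alpha> * kernel x y \<le> B" if y: "l < norm y" "norm y < l + d" "\<not> norm (x - y) < r"
      proof -
        have "norm y powr \<alpha> \<le> A"
        proof (cases "\<alpha> \<ge> 0")
          case True
          then have "norm y powr \<alpha> \<le> (2 * l) powr \<alpha>" using y d by (intro powr_mono2) auto
          then show ?thesis by (simp add: A_def)
        next
          case False
          then have "norm y powr \<alpha> \<le> l powr \<alpha>" using y l by (intro powr_mono2') auto
          then show ?thesis by (simp add: A_def)
        qed
        moreover have "kernel x y \<le> r powr - n"
          unfolding kernel_def using y r n_pos by (intro powr_mono2') auto
        ultimately show ?thesis unfolding B_def using kernels_nonneg(1) by (intro mult_mono) (auto simp: A_def le_max_iff_disj)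
      qed
      then show "ennreal (norm y powr \<alpha> * kernel x y) * indicator ?S y
        \<le> ennreal (norm y powr \<alpha> * kernel x y) * indicator {y. norm (x - y) < r} y + ennreal B * indicator ?S y"
        by (auto simp: indicator_def intro!: ennreal_leI)
    qed
    also have "\<dots> = kernel_integral {y. norm (x - y) < r} x +
        (\<integral>\<^sup>+y. ennreal B * indicator ?S y \<partial>lborel)"
      by (rule nn_integral_add) auto
    also have "(\<integral>\<^sup>+y. ennreal B * indicator ?S y \<partial>lborel) = ennreal B * emeasure lborel ?S"
      by (rule nn_integral_cmult_indicator) auto
    also have "kernel_integral {y. norm (x - y) < r} x + \<dots>
      \<le> ennreal (e / 2) + ennreal B * ennreal (e / (2 * B))"
    proof (intro add_mono mult_left_mono)
      show "kernel_integral {y. norm (x - y) < r} x \<le> ennreal (e / 2)"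
        by (rule r(2)[OF x])
    qed (use d in auto)
    also have "\<dots> = ennreal e" using B e by (simp add: ennreal_mult[symmetric] ennreal_plus[symmetric] del: ennreal_plus)
    finally show "kernel_integral ?S x \<le> ennreal e" .
  qed (use d in auto)
qed

end

section \<open>Comparison of a solution with its Kelvin transform\<close>

locale subcritical_riesz_solution = riesz_solution \<alpha> p \<kappa> U
  for \<alpha> p \<kappa> and U :: "real ^ 'n \<Rightarrow> real" +
  assumes subcritical: "(real CARD('n) - 2) * p < real CARD('n) + 2 + 2 * \<alpha>"
begin

definition \<tau> :: real where "\<tau> = real CARD('n) + 2 + 2 * \<alpha> - n * p"

lemma \<tau>_pos: "\<tau> > 0" using subcritical by (simp add: \<tau>_def n_def)

lemma kelvin_source_le:
  assumes "l > 0" "norm y > l"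
  shows "kelvin_source l y \<le> \<kappa> * norm y powr \<alpha> * kelvin l y powr p"
proof -
  have y: "y \<noteq> 0" using assms by auto
  have "(l / norm y) powr \<tau> \<le> 1 powr \<tau>"
    using assms \<tau>_pos y by (intro powr_mono2) (auto simp: divide_le_eq)
  then have "\<kappa> * norm y powr \<alpha> * kelvin l y powr p * (l / norm y) powr \<tau> \<le> \<kappa> * norm y powr \<alpha> * kelvin l y powr p * 1"
    using \<kappa> by (intro mult_left_mono) auto
  then show ?thesis using kelvin_source_eq[OF assms(1) y] by (simp add: \<tau>_def)
qed

text \<open>
  The sphere of radius \<open>l\<close> has been passed: the solution lies above its Kelvin transform outside.
\<close>
definition dominates :: "real \<Rightarrow> bool" where
  "dominates l \<longleftrightarrow> (\<forall>x. norm x > l \<longrightarrow> kelvin l x \<le> U x)"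

text \<open>
  If \<open>U\<close> dominates its Kelvin transform, then \<open>f\<close> exceeds the reflected source by a definite factor. Here
  subcriticality enters, as \<open>(l / norm y) powr \<tau> < 1\<close> outside the sphere.
\<close>
lemma kelvin_source_gap:
  assumes "dominates l" "l > 0" "norm y > l"
  shows "f y * (1 - (l / norm y) powr \<tau>) \<le> f y - kelvin_source l y"
proof -
  have y: "y \<noteq> 0" using assms by auto
  have "kelvin l y powr p \<le> U y powr p"
    using assms p kelvin_pos[of l y] y by (intro powr_mono2) (auto simp: dominates_def)
  then have "\<kappa> * norm y powr \<alpha> * kelvin l y powr p * (l / norm y) powr \<tau> \<le> f y * (l / norm y) powr \<tau>"
    unfolding f_def using \<kappa> by (intro mult_right_mono mult_left_mono) auto
  then show ?thesis using kelvin_source_eq[OF assms(2) y] by (simp add: \<tau>_def algebra_simps)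
qed

lemma kelvin_source_less:
  assumes "dominates l" "l > 0" "norm y > l"
  shows "kelvin_source l y < f y"
proof -
  have y: "y \<noteq> 0" using assms by auto
  have "(l / norm y) powr \<tau> < 1 powr \<tau>"
    using assms \<tau>_pos y by (intro powr_less_mono2) (auto simp: divide_less_eq)
  then have "0 < f y * (1 - (l / norm y) powr \<tau>)" using f_pos[OF y] by simp
  with kelvin_source_gap[OF assms] show ?thesis by simp
qed

text \<open>
  Let \<open>\<Phi>\<close> be the supremum of the violations \<open>kelvin l x - U x\<close>. In the difference formula only the points of violation
  have the wrong sign, and there the mean value theorem bounds the source by \<open>\<Phi>\<close> times a constant. So every
  violation is at most \<open>\<Phi>\<close> times a small potential over \<open>S\<close>, hence at most \<open>\<Phi> / 2\<close>, and there is none.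
\<close>
lemma dominates_if_violations_small:
  assumes l: "l > 0" and S [measurable]: "S \<in> sets borel"
    and BS: "\<And>x. norm x > l \<Longrightarrow> U x < kelvin l x \<Longrightarrow> x \<in> S"
    and M: "M > 0" "\<And>x. norm x \<le> l \<Longrightarrow> U x \<le> M"
    and Q: "Q \<ge> 0" "\<And>x. norm x > l \<Longrightarrow> x \<in> S \<Longrightarrow>
      kernel_integral S x \<le> ennreal Q"
    and small: "\<kappa> * (p * M powr (p - 1)) * Q \<le> 1 / 2"
  shows "dominates l"
proof (rule ccontr)
  define B where "B = {x. norm x > l \<and> U x < kelvin l x}"
  assume "\<not> dominates l"
  then obtain b where b: "b \<in> B" by (auto simp: dominates_def B_def not_le)
  define \<Phi> where "\<Phi> = (SUP x\<in>B. kelvin l x - U x)"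
  have le_M: "kelvin l x - U x \<le> M" if "x \<in> B" for x
    using kelvin_le(2)[OF l _ M(2,1), of x] that U_pos[of x] by (auto simp: B_def)
  then have bdd: "bdd_above ((\<lambda>x. kelvin l x - U x) ` B)" by (rule bdd_aboveI2)
  then have up: "kelvin l x - U x \<le> \<Phi>" if "x \<in> B" for x
    unfolding \<Phi>_def using that by (rule cSUP_upper[rotated])
  have \<Phi>: "\<Phi> > 0" using up[OF b] b by (auto simp: B_def)
  define c where "c = \<kappa> * (p * M powr (p - 1)) * \<Phi>"
  have c: "c \<ge> 0" using \<kappa> p \<Phi> by (simp add: c_def)
  have "kelvin l x - U x \<le> \<Phi> / 2" if x: "x \<in> B" for x
  proof -
    define g where "g y = outside l y * ((kelvin_source l y - f y) * (kernel x y - reflected_kernel l x y))" for y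
    have xl: "norm x > l" "x \<in> S" using x BS by (auto simp: B_def)
    have "has_bochner_integral lborel g (kelvin l x - U x)"
      using has_bochner_integral_minus[OF difference_formula[OF l xl(1)]]
      unfolding g_def by (simp add: algebra_simps)
    then have "ennreal (kelvin l x - U x) \<le> (\<integral>\<^sup>+y. ennreal (g y) \<partial>lborel)"
      using ennreal_integral_le[of lborel g] by (auto simp: has_bochner_integral_iff)
    also have "\<dots> \<le> (\<integral>\<^sup>+y. ennreal c * (ennreal (norm y powr \<alpha> * kernel x y) * indicator S y) \<partial>lborel)"
    proof (rule nn_integral_mono_AE)
      show "AE y in lborel. ennreal (g y) \<le> ennreal c * (ennreal (norm y powr \<alpha> * kernel x y) * indicator S y)"
        using AE_lborel_singleton[of x]
      proof eventually_elim
        case (elim y)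
        show ?case
        proof (cases "norm y > l \<and> kelvin_source l y > f y")
          case True
          then have yl: "norm y > l" and src: "f y < kelvin_source l y" by auto
          have y0: "y \<noteq> 0" using yl l by auto
          have yB: "y \<in> B"
          proof (rule ccontr)
            assume "y \<notin> B"
            then have "kelvin l y powr p \<le> U y powr p"
              using yl kelvin_pos[OF l y0] p by (intro powr_mono2) (auto simp: B_def)
            then have "\<kappa> * norm y powr \<alpha> * kelvin l y powr p \<le> f y"
              unfolding f_def using \<kappa> by (intro mult_left_mono) auto
            with kelvin_source_le[OF l yl] src show False by simp
          qed
          have "kelvin l y powr p - U y powr p \<le> p * M powr (p - 1) * (kelvin l y - U y)"
            using yB kelvin_le(2)[OF l _ M(2,1), of y] U_pos[of y] p
            by (intro powr_diff_le) (auto simp: B_def)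
          also have "\<dots> \<le> p * M powr (p - 1) * \<Phi>" using up[OF yB] p by (intro mult_left_mono) auto
          finally have "\<kappa> * norm y powr \<alpha> * (kelvin l y powr p - U y powr p) \<le> \<kappa> * norm y powr \<alpha> * (p * M powr (p - 1) * \<Phi>)"
            using \<kappa> by (intro mult_left_mono) auto
          then have "kelvin_source l y - f y \<le> c * norm y powr \<alpha>"
            using kelvin_source_le[OF l yl] by (simp add: f_def c_def algebra_simps)
          moreover have "kernel x y - reflected_kernel l x y \<le> kernel x y" "0 \<le> kernel x y - reflected_kernel l x y"
            using kernels_nonneg kernel_gap[OF l xl(1) yl] elim by (auto simp: less_imp_le)
          ultimately have "g y \<le> c * norm y powr \<alpha> * kernel x y"
            using yl c src unfolding g_def by (auto intro!: mult_mono)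
          moreover have "y \<in> S" using yB BS by (auto simp: B_def)
          ultimately show ?thesis using c by (simp add: ennreal_mult[symmetric] kernels_nonneg ennreal_leI mult.assoc)
        next
          case False
          then have "g y \<le> 0"
            using kernel_gap[OF l xl(1), of y] elim
            by (auto simp: g_def indicator_def mult_nonpos_nonneg)
          then show ?thesis by (simp add: ennreal_neg)
        qed
      qed
    qed
    also have "\<dots> = ennreal c * kernel_integral S x"
      by (rule nn_integral_cmult) auto
    also have "\<dots> \<le> ennreal c * ennreal Q" by (intro mult_left_mono Q(2) xl) auto
    also have "\<dots> = ennreal (c * Q)" using c Q(1) by (simp add: ennreal_mult)
    finally have "kelvin l x - U x \<le> c * Q" using c Q(1) by (subst (asm) ennreal_le_iff) auto
    also have "c * Q = (\<kappa> * (p * M powr (p - 1)) * Q) * \<Phi>" by (simp add: c_def)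
    also have "\<dots> \<le> 1 / 2 * \<Phi>" using small \<Phi> by (intro mult_right_mono) auto
    finally show ?thesis by simp
  qed
  then have "\<Phi> \<le> \<Phi> / 2" unfolding \<Phi>_def by (intro cSUP_least) (use b in auto)
  with \<Phi> show False by simp
qed

lemma difference_integrand_nonneg:
  assumes "dominates l" "l > 0" "norm x > l" "y \<noteq> x"
  shows "0 \<le> gap_integrand l x y"
proof (cases "norm y > l")
  case True
  then show ?thesis
    using kelvin_source_less[of l y] kernel_gap[of l x y] assms by (auto intro!: mult_nonneg_nonneg)
qed simp

text \<open>
  The integrand of the difference formula is nonnegative, and positive almost everywhere outside the sphere.
\<close>
lemma strictly_dominates:
  assumes "dominates l" "l > 0" "norm x > l"
  shows "kelvin l x < U x"
proof -
  define g where "g y = gap_integrand l x y" for y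
  have hb: "has_bochner_integral lborel g (U x - kelvin l x)"
    unfolding g_def using difference_formula[OF assms(2,3)] .
  have "0 < (\<integral>y. g y \<partial>lborel)"
  proof (rule integral_pos_if_pos_on_open[where A = "- cball 0 l"])
    show "integrable lborel g" using hb by (auto simp: has_bochner_integral_iff)
    show "AE y in lborel. 0 \<le> g y"
      using AE_lborel_singleton[of x] by eventually_elim (auto simp: g_def intro: difference_integrand_nonneg assms)
    have "x \<in> - cball 0 l" using assms by simp
    then show "- cball 0 l \<noteq> ({} :: (real ^ 'n) set)" by blast
    show "AE y in lborel. y \<in> - cball 0 l \<longrightarrow> 0 < g y"
      using AE_lborel_singleton[of x]
      by eventually_elim
        (use kelvin_source_less[OF assms(1,2)] kernel_gap[OF assms(2,3)] in \<open>auto simp: g_def\<close>)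
  qed auto
  then show ?thesis using hb by (simp add: has_bochner_integral_iff)
qed

text \<open>
  For \<open>y\<close> in a fixed shell and \<open>x\<close> far away, the summand in \<open>norm_inversion_diff_sq\<close> that separates the two
  kernels is comparable with \<open>(norm x)\<^sup>2\<close>. In fact \<open>norm (x - y)\<close> is at most \<open>5/2 * norm x\<close> and the summand at
  least \<open>9/4 * (norm x)\<^sup>2\<close>, which makes the ratio of the squared distances at least \<open>1 + 9/25 = 34/25\<close>.
\<close>
lemma kernel_gap_far:
  fixes x y :: "real ^ 'n"
  assumes l: "l > 0" and x: "norm x \<ge> 2 * l" and y: "2 * l < norm y" "norm y < 3 * l" and xy: "x \<noteq> y"
  shows "(1 - sqrt (34 / 25) powr - n) * (5 / 2 * norm x) powr - n \<le> kernel x y - reflected_kernel l x y"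
proof -
  have x0: "x \<noteq> 0" using l x by auto
  have x2: "3 / 4 * (norm x)\<^sup>2 \<le> (norm x)\<^sup>2 - l\<^sup>2"
    using power_mono[OF x, of 2] l by (simp add: power_mult_distrib)
  have y2: "3 * l\<^sup>2 \<le> (norm y)\<^sup>2 - l\<^sup>2"
    using power_mono[of "2 * l" "norm y" 2] y l by (simp add: power_mult_distrib)
  have "3 / 4 * (norm x)\<^sup>2 * (3 * l\<^sup>2) \<le> ((norm x)\<^sup>2 - l\<^sup>2) * ((norm y)\<^sup>2 - l\<^sup>2)"
    by (rule mult_mono[OF x2 y2]) (rule order_trans[OF _ x2], auto)
  then have P: "9 / 4 * (norm x)\<^sup>2 \<le> ((norm x)\<^sup>2 - l\<^sup>2) * ((norm y)\<^sup>2 - l\<^sup>2) / l\<^sup>2"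
    using l by (simp add: field_simps)
  have A: "norm (x - y) \<le> 5 / 2 * norm x"
    using norm_triangle_ineq4[of x y] x y by simp
  then have "(norm (x - y))\<^sup>2 \<le> (5 / 2 * norm x)\<^sup>2" by (intro power_mono) auto
  then have "34 / 25 * (norm (x - y))\<^sup>2 \<le> (norm x * norm (inversion l x - y) / l)\<^sup>2"
    using P unfolding norm_inversion_diff_sq[OF l x0] by (simp add: power_mult_distrib power2_eq_square)
  then have "(sqrt (34 / 25) * norm (x - y))\<^sup>2 \<le> (norm x * norm (inversion l x - y) / l)\<^sup>2"
    by (simp add: power_mult_distrib)
  then have "sqrt (34 / 25) * norm (x - y) \<le> norm x * norm (inversion l x - y) / l"
    by (rule power2_le_imp_le) (use l in auto)
  then have "(norm x * norm (inversion l x - y) / l) powr - n \<le> (sqrt (34 / 25) * norm (x - y)) powr - n"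
    using xy n_pos by (intro powr_mono2') auto
  then have "reflected_kernel l x y \<le> sqrt (34 / 25) powr - n * kernel x y"
    unfolding reflected_kernel_eq[OF l x0] powr_mult kernel_def by (simp add: powr_mult)
  moreover have "(5 / 2 * norm x) powr - n \<le> kernel x y"
    unfolding kernel_def using A xy n_pos by (intro powr_mono2') auto
  moreover have "sqrt (34 / 25) powr - n \<le> 1"
    using powr_mono[of "- n" 0 "sqrt (34 / 25)"] n_pos by simp
  ultimately show ?thesis
    using mult_left_mono[of "(5 / 2 * norm x) powr - n" "kernel x y" "1 - sqrt (34 / 25) powr - n"]
    by (simp add: algebra_simps)
qed

text \<open>
  The potential at the origin converges, and on the ball its kernel is bounded below.
\<close>
lemma integrable_f_ball:
  assumes r: "r > 0"
  shows "integrable lborel (\<lambda>y. indicator (ball 0 r) y * f y)"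
proof (rule Bochner_Integration.integrable_bound)
  show "integrable lborel (\<lambda>y. r powr n * (f y * norm (0 - y) powr - n))"
    by (intro integrable_mult_right integrable_potential)
  show "AE y in lborel. norm (indicator (ball 0 r) y * f y) \<le> norm (r powr n * (f y * norm (0 - y) powr - n))"
    using AE_lborel_singleton[of 0]
  proof eventually_elim
    case (elim y)
    have "f y \<le> r powr n * (f y * norm y powr - n)" if "norm y < r"
    proof -
      have "r powr - n \<le> norm y powr - n" using that elim n_pos by (intro powr_mono2') auto
      then have "f y * r powr n * r powr - n \<le> f y * r powr n * norm y powr - n"
        using f_nonneg by (intro mult_left_mono) auto
      then show ?thesis using r by (simp add: powr_minus field_simps)
    qed
    then show ?case using f_nonneg[of y] by (auto simp: indicator_def)
  qed
  show "(\<lambda>y. indicator (ball 0 r) y * f y) \<in> borel_measurable lborel"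
    using f_measurable by (intro borel_measurable_times borel_measurable_indicator) auto
qed

text \<open>
  The difference is at least the part of its integral over the shell between \<open>2 * l\<close> and \<open>3 * l\<close>, and there
  \<open>kernel_gap_far\<close> applies. This quantitative form keeps control at infinity when the radius changes.
\<close>
lemma difference_decay:
  assumes "dominates l" "l > 0"
  shows "\<exists>c>0. \<forall>x. norm x \<ge> 2 * l \<longrightarrow> c \<le> norm x powr n * (U x - kelvin l x)"
proof -
  let ?A = "{y :: real ^ 'n. 2 * l < norm y \<and> norm y < 3 * l}"
  define h where "h y = indicator ?A y * (f y - kelvin_source l y)" for y
  define s where "s = 1 - sqrt (34 / 25) powr - n"
  have "sqrt (34 / 25) powr - n < sqrt (34 / 25) powr 0"
    using n_pos by (intro powr_less_mono) auto
  then have s: "s > 0" by (simp add: s_def)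
  have openA: "open ?A" by (intro open_Collect_conj open_Collect_less continuous_intros)
  obtain v :: "real ^ 'n" where v: "norm v = 5 / 2 * l"
    using vector_choose_size[of "5 / 2 * l"] assms(2) by auto
  then have neA: "?A \<noteq> {}" using assms(2) by (auto intro!: exI[of _ v])
  have h_nonneg: "h y \<ge> 0" for y
    using kelvin_source_less[OF assms, of y] assms(2) by (auto simp: h_def indicator_def)
  have int_h: "integrable lborel h"
  proof (rule Bochner_Integration.integrable_bound)
    show "integrable lborel (\<lambda>y. indicator (ball 0 (3 * l)) y * f y)"
      using assms(2) by (intro integrable_f_ball) simp
    show "AE y in lborel. norm (h y) \<le> norm (indicator (ball 0 (3 * l)) y * f y)"
      using h_nonneg kernels_nonneg(3)[OF assms(2)] f_nonneg
      by (intro AE_I2) (auto simp: h_def indicator_def)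
    show "h \<in> borel_measurable lborel" unfolding h_def by measurable
  qed
  define I where "I = (\<integral>y. h y \<partial>lborel)"
  have I: "I > 0" unfolding I_def
  proof (rule integral_pos_if_pos_on_open[OF int_h _ openA neA])
    show "AE y in lborel. y \<in> ?A \<longrightarrow> 0 < h y"
      using kelvin_source_less[OF assms] assms(2) by (intro AE_I2) (auto simp: h_def)
  qed (use h_nonneg in auto)
  show ?thesis
  proof (intro exI[of _ "s * (5 / 2) powr - n * I"] conjI allI impI)
    fix x :: "real ^ 'n" assume x: "2 * l \<le> norm x"
    then have xl: "norm x > l" using assms(2) by simp
    note hb = difference_formula[OF assms(2) xl]
    have "(s * (5 / 2 * norm x) powr - n) * I = (\<integral>y. (s * (5 / 2 * norm x) powr - n) * h y \<partial>lborel)"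
      unfolding I_def by simp
    also have "\<dots> \<le> (\<integral>y. gap_integrand l x y \<partial>lborel)"
    proof (rule integral_mono_AE)
      show "integrable lborel (\<lambda>y. (s * (5 / 2 * norm x) powr - n) * h y)" using int_h by simp
      show "integrable lborel (\<lambda>y. gap_integrand l x y)"
        using hb by (auto simp: has_bochner_integral_iff)
      show "AE y in lborel. (s * (5 / 2 * norm x) powr - n) * h y
        \<le> gap_integrand l x y"
        using AE_lborel_singleton[of x]
      proof eventually_elim
        case (elim y)
        show ?case
        proof (cases "y \<in> ?A")
          case True
          then have "s * (5 / 2 * norm x) powr - n \<le> kernel x y - reflected_kernel l x y"
            unfolding s_def using assms(2) x elim by (intro kernel_gap_far) auto
          from mult_right_mono[OF this h_nonneg[of y]] show ?thesis
            using True assms(2) by (simp add: h_def mult.commute)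
        next
          case False
          then show ?thesis using difference_integrand_nonneg[OF assms xl, of y] elim by (simp add: h_def)
        qed
      qed
    qed
    also have "\<dots> = U x - kelvin l x" using hb by (simp add: has_bochner_integral_iff)
    finally have *: "(s * (5 / 2 * norm x) powr - n) * I \<le> U x - kelvin l x" .
    have x0: "norm x > 0" using xl assms(2) by linarith
    have "s * (5 / 2) powr - n * I = norm x powr n * ((s * (5 / 2 * norm x) powr - n) * I)"
      unfolding powr_mult using x0 by (simp add: powr_minus)
    also have "\<dots> \<le> norm x powr n * (U x - kelvin l x)" using * by (intro mult_left_mono) auto
    finally show "s * (5 / 2) powr - n * I \<le> norm x powr n * (U x - kelvin l x)" .
  qed (use s I in auto)
qed

end

section \<open>Moving spheres\<close>

context subcritical_riesz_solution
begin

lemma U_lower_bound_far: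
  assumes r: "r > 0"
  shows "\<exists>c>0. \<forall>x. norm x \<ge> r \<longrightarrow> c * norm x powr - n \<le> U x"
proof -
  define h where "h y = indicator (ball 0 r) y * f y" for y
  have int_h: "integrable lborel h" unfolding h_def using r by (rule integrable_f_ball)
  define I where "I = (\<integral>y. h y \<partial>lborel)"
  have I: "I > 0" unfolding I_def
  proof (rule integral_pos_if_pos_on_open[OF int_h _ open_ball])
    show "AE y in lborel. y \<in> ball 0 r \<longrightarrow> 0 < h y"
      using AE_lborel_singleton[of 0] by eventually_elim (auto simp: h_def f_pos)
  qed (use r f_nonneg in \<open>auto simp: h_def\<close>)
  show ?thesis
  proof (intro exI[of _ "2 powr - n * I"] conjI allI impI)
    fix x :: "real ^ 'n" assume x: "r \<le> norm x"
    have "2 powr - n * I * norm x powr - n = (\<integral>y. (2 * norm x) powr - n * h y \<partial>lborel)"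
      by (simp add: I_def powr_mult)
    also have "\<dots> \<le> (\<integral>y. f y * norm (x - y) powr - n \<partial>lborel)"
    proof (rule integral_mono)
      show "integrable lborel (\<lambda>y. (2 * norm x) powr - n * h y)" using int_h by simp
      show "integrable lborel (\<lambda>y. f y * norm (x - y) powr - n)" by (rule integrable_potential)
      fix y
      show "(2 * norm x) powr - n * h y \<le> f y * norm (x - y) powr - n"
      proof (cases "norm y < r")
        case True
        have "norm (x - y) \<le> 2 * norm x" using norm_triangle_ineq4[of x y] x True by simp
        moreover have "x \<noteq> y" using x True by auto
        ultimately have "(2 * norm x) powr - n \<le> norm (x - y) powr - n" using n_pos by (intro powr_mono2') auto
        from mult_left_mono[OF this f_nonneg[of y]] show ?thesis using True by (simp add: h_def mult.commute)
      qed (simp add: h_def f_nonneg)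
    qed
    also have "\<dots> = U x" by (rule U_integral[symmetric])
    finally show "2 powr - n * I * norm x powr - n \<le> U x" .
  qed (use I in auto)
qed

text \<open>
  By the lower bound at infinity a violation can occur only in a small ball, where \<open>dominates_if_violations_small\<close>
  excludes it.
\<close>
lemma dominates_small: "\<exists>l0>0. \<forall>l. 0 < l \<longrightarrow> l \<le> l0 \<longrightarrow> dominates l"
proof -
  obtain M where M: "M > 0" "\<And>x. norm x \<le> 1 \<Longrightarrow> U x \<le> M" using U_bound by blast
  define Q where "Q = 1 / (2 * (\<kappa> * (p * M powr (p - 1))))"
  have Q: "Q > 0" "\<kappa> * (p * M powr (p - 1)) * Q \<le> 1 / 2" using \<kappa> p M by (auto simp: Q_def)
  obtain r where r: "r > 0" "\<And>x. norm x < r \<Longrightarrow>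
    kernel_integral {y. norm y < r} x \<le> ennreal Q"
    using small_potential_ball[OF Q(1)] by blast
  obtain c where c: "c > 0" "\<And>x. norm x \<ge> r \<Longrightarrow> c * norm x powr - n \<le> U x"
    using U_lower_bound_far[OF r(1)] by blast
  \<comment> \<open>Chosen so that \<open>M * l powr n \<le> c\<close>: the Kelvin transform stays below the lower bound for \<open>U\<close>.\<close>
  define l0 where "l0 = min 1 ((c / M) powr (1 / n))"
  have l0: "l0 > 0" "l0 \<le> 1" using c M by (auto simp: l0_def)
  show ?thesis
  proof (intro exI[of _ l0] conjI allI impI l0(1))
    fix l assume l: "0 < l" "l \<le> l0"
    have "l powr n \<le> ((c / M) powr (1 / n)) powr n"
      using l n_pos by (intro powr_mono2) (auto simp: l0_def)
    also have "\<dots> = c / M" using n_pos c M by (simp add: powr_powr)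
    finally have ln: "M * l powr n \<le> c" using M by (simp add: field_simps)
    have Ml: "U z \<le> M" if "norm z \<le> l" for z using that l l0 by (intro M(2)) simp
    show "dominates l"
    proof (rule dominates_if_violations_small[where S = "{y. norm y < r}" and Q = Q and M = M])
      fix x :: "real ^ 'n" assume x: "norm x > l" "U x < kelvin l x"
      show "x \<in> {y. norm y < r}"
      proof (rule ccontr)
        assume "x \<notin> {y. norm y < r}"
        then have "c * norm x powr - n \<le> U x" using c by simp
        moreover have "kelvin l x \<le> M * (l / norm x) powr n"
          using kelvin_le(1)[OF l(1) _ Ml M(1)] x by simp
        moreover have "M * (l / norm x) powr n = M * l powr n * norm x powr - n"
          by (simp add: powr_divide powr_minus_divide)
        moreover have "M * l powr n * norm x powr - n \<le> c * norm x powr - n"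
          using ln by (intro mult_right_mono) auto
        ultimately show False using x by simp
      qed
    qed (use l Ml M Q r in auto)
  qed
qed

text \<open>
  After multiplication by \<open>norm x powr n\<close> the Kelvin transform depends continuously on \<open>l\<close> and on the point
  \<open>inversion 1 x\<close>, which ranges over a bounded set as \<open>x\<close> ranges over the exterior. So neighbourhoods of infinity are
  compactified.
\<close>
lemma kelvin_scaled:
  assumes "x \<noteq> 0"
  shows "norm x powr n * kelvin l x = l powr n * U (l\<^sup>2 *\<^sub>R (inversion 1 x))"
  using assms by (simp add: kelvin_def powr_divide inversion_def)

text \<open>
  At distance at least \<open>d1\<close> from the sphere the gap, scaled by \<open>norm x powr n\<close>, has a positive lower bound: on
  bounded sets by compactness and strict domination, at infinity by \<open>difference_decay\<close>. Uniform continuity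
  preserves it for nearby radii, so that violations are left only in a thin shell.
\<close>
lemma dominates_open:
  assumes "dominates l" and l: "l > 0"
  shows "\<exists>d>0. \<forall>l'. l \<le> l' \<longrightarrow> l' < l + d \<longrightarrow> dominates l'"
proof -
  obtain c where c: "c > 0" "\<And>x. norm x \<ge> 2 * l \<Longrightarrow> c \<le> norm x powr n * (U x - kelvin l x)"
    using difference_decay[OF assms] by blast
  obtain M where M: "M > 0" "\<And>x. norm x \<le> 2 * l \<Longrightarrow> U x \<le> M" using U_bound by blast
  define Q where "Q = 1 / (2 * (\<kappa> * (p * M powr (p - 1))))"
  have Q: "Q > 0" "\<kappa> * (p * M powr (p - 1)) * Q \<le> 1 / 2" using \<kappa> p M by (auto simp: Q_def)
  obtain d1 where d1: "d1 > 0" "d1 < l" "\<And>x. norm x \<le> 2 * l \<Longrightarrow>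
    kernel_integral {y. l < norm y \<and> norm y < l + d1} x \<le> ennreal Q"
    using small_potential_shell[OF l Q(1)] by blast
  define A where "A = {x :: real ^ 'n. l + d1 \<le> norm x \<and> norm x \<le> 2 * l}"
  have A: "compact A"
  proof -
    have "A = cball 0 (2 * l) - ball 0 (l + d1)" by (auto simp: A_def)
    then show ?thesis by (simp add: compact_diff)
  qed
  have A0: "x \<noteq> 0" if "x \<in> A" for x using that l d1 by (auto simp: A_def)
  have cont: "continuous_on A (\<lambda>x. norm x powr n * (U x - kelvin l x))"
    unfolding kelvin_def inversion_def
    by (intro continuous_intros continuous_on_compose2[OF continuous_on_U[of UNIV]]) (use A0 l in auto)
  have "\<exists>m>0. \<forall>x\<in>A. m \<le> norm x powr n * (U x - kelvin l x)"
  proof (cases "A = {}")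
    case False
    from continuous_attains_inf[OF A this cont] obtain x where x: "x \<in> A"
      "\<And>z. z \<in> A \<Longrightarrow> norm x powr n * (U x - kelvin l x) \<le> norm z powr n * (U z - kelvin l z)" by blast
    have "0 < norm x powr n * (U x - kelvin l x)"
      using strictly_dominates[OF assms, of x] x(1) d1 A0[OF x(1)] by (auto simp: A_def)
    with x show ?thesis by blast
  qed (auto intro: exI[of _ 1])
  then obtain m1 where m1: "m1 > 0" "\<And>x. x \<in> A \<Longrightarrow> m1 \<le> norm x powr n * (U x - kelvin l x)" by blast
  define m where "m = min m1 c"
  have m: "m \<le> norm x powr n * (U x - kelvin l x)" if "norm x \<ge> l + d1" for x
  proof (cases "norm x \<ge> 2 * l")
    case True
    then show ?thesis using c(2)[of x] by (simp add: m_def)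
  next
    case False
    then show ?thesis using m1(2)[of x] that by (simp add: m_def A_def)
  qed
  have m0: "m > 0" using m1 c by (simp add: m_def)
  \<comment> \<open>The right-hand side of \<open>kelvin_scaled\<close>, as a function on a compact set.\<close>
  define g where "g u = fst u powr n * U ((fst u)\<^sup>2 *\<^sub>R (snd u :: real ^ 'n))" for u
  let ?K = "{l..2 * l} \<times> cball (0 :: real ^ 'n) (1 / l)"
  have "continuous_on ?K g"
    unfolding g_def
    by (intro continuous_intros continuous_on_compose2[OF continuous_on_U[of UNIV]]) (use l in auto)
  then have "uniformly_continuous_on ?K g"
    by (intro compact_uniformly_continuous compact_Times) auto
  from this[unfolded uniformly_continuous_on_def, rule_format, OF m0]
  obtain d2 where d2: "d2 > 0" "\<And>u w. u \<in> ?K \<Longrightarrow> w \<in> ?K \<Longrightarrow> dist w u < d2 \<Longrightarrow> dist (g w) (g u) < m"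
    by blast
  show ?thesis
  proof (intro exI[of _ "min d1 d2"] conjI allI impI)
    fix l' assume l': "l \<le> l'" "l' < l + min d1 d2"
    show "dominates l'"
    proof (rule dominates_if_violations_small[where S = "{y. l < norm y \<and> norm y < l + d1}" and Q = Q and M = M])
      fix x :: "real ^ 'n" assume x: "norm x > l'" "U x < kelvin l' x"
      have x0: "x \<noteq> 0" using x l l' by auto
      have "norm x < l + d1"
      proof (rule ccontr)
        assume "\<not> norm x < l + d1"
        then have far: "m \<le> norm x powr n * (U x - kelvin l x)" using m by simp
        have "norm (inversion 1 x) \<le> 1 / l"
          using x l l' by (simp add: norm_inversion frac_le)
        then have "dist (g (l', inversion 1 x)) (g (l, inversion 1 x)) < m"
          using l l' d1 by (intro d2) (auto simp: dist_Pair_Pair dist_real_def)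
        then have "norm x powr n * kelvin l' x - norm x powr n * kelvin l x < m"
          unfolding kelvin_scaled[OF x0] by (simp add: dist_real_def g_def)
        moreover have "norm x powr n * U x < norm x powr n * kelvin l' x"
          using x x0 by simp
        ultimately show False using far by (simp add: algebra_simps)
      qed
      then show "x \<in> {y. l < norm y \<and> norm y < l + d1}" using x l' by simp
    next
      fix x :: "real ^ 'n" assume "x \<in> {y. l < norm y \<and> norm y < l + d1}"
      then show "kernel_integral {y. l < norm y \<and> norm y < l + d1} x \<le> ennreal Q"
        using d1 by auto
    next
      fix x :: "real ^ 'n" assume "norm x \<le> l'"
      then show "U x \<le> M" using l' d1 by (intro M) auto
    qed (use l l' M Q in auto)
  qed (use d1 d2 in auto)
qed

text \<open>
  Otherwise let \<open>s\<close> be the infimum of the bad radii. It is positive and by continuity a good radius, but then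
  the radii slightly beyond \<open>s\<close> are good as well.
\<close>
lemma dominates_all:
  assumes "l > 0"
  shows "dominates l"
proof (rule ccontr)
  assume nd: "\<not> dominates l"
  define s where "s = Inf {l. l > 0 \<and> \<not> dominates l}"
  obtain l0 where l0: "l0 > 0" "\<And>l. 0 < l \<Longrightarrow> l \<le> l0 \<Longrightarrow> dominates l" using dominates_small by blast
  have ne: "{l. l > 0 \<and> \<not> dominates l} \<noteq> {}" using assms nd by auto
  have bdd: "bdd_below {l. l > 0 \<and> \<not> dominates l}" by (auto intro: bdd_belowI[of _ 0])
  have "l0 \<le> s" unfolding s_def using l0 by (intro cInf_greatest ne) force
  then have s: "s > 0" using l0 by simp
  have below: "dominates l" if "0 < l" "l < s" for l
    using that cInf_lower[OF _ bdd, of l] unfolding s_def by force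
  have "dominates s"
    unfolding dominates_def
  proof (intro allI impI)
    fix x :: "real ^ 'n" assume x: "norm x > s"
    have x0: "x \<noteq> 0" using x s by auto
    have "((\<lambda>l. kelvin l x) \<longlongrightarrow> kelvin s x) (at_left s)"
      unfolding kelvin_def inversion_def
      by (intro tendsto_intros isCont_tendsto_compose[of _ U] continuous_on_interior[OF continuous_on_U[of UNIV]])
         (use s x0 in auto)
    moreover have "\<forall>\<^sub>F l in at_left s. kelvin l x \<le> U x"
      by (rule eventually_at_leftI[of 0]) (use below x s in \<open>auto simp: dominates_def\<close>)
    ultimately show "kelvin s x \<le> U x" by (intro tendsto_upperbound) auto
  qed
  from dominates_open[OF this s] obtain d where d: "d > 0" "\<And>l'. s \<le> l' \<Longrightarrow> l' < s + d \<Longrightarrow> dominates l'" by blast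
  have "s + d \<le> Inf {l. l > 0 \<and> \<not> dominates l}"
  proof (rule cInf_greatest[OF ne])
    fix l assume "l \<in> {l. l > 0 \<and> \<not> dominates l}"
    then show "s + d \<le> l" using d(2)[of l] below[of l] by (auto simp: not_le) (meson not_le)
  qed
  then have "s + d \<le> s" unfolding s_def .
  with d show False by simp
qed

section \<open>Monotonicity along rays\<close>

text \<open>
  The sphere of radius \<open>norm x * sqrt t\<close> exchanges \<open>x\<close> and \<open>t *\<^sub>R x\<close>.
\<close>
lemma U_ray:
  assumes "x \<noteq> 0" "t \<ge> 1"
  shows "t powr (- n / 2) * U x \<le> U (t *\<^sub>R x)"
proof (cases "t = 1")
  case False
  then have t: "t > 1" using assms by simp
  define l where "l = norm x * sqrt t"
  have l: "l > 0" using assms t by (simp add: l_def)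
  have "sqrt t * 1 < sqrt t * sqrt t" using t by (intro mult_strict_left_mono) auto
  then have "l < norm (t *\<^sub>R x)" using assms t by (simp add: l_def mult.commute)
  then have "kelvin l (t *\<^sub>R x) \<le> U (t *\<^sub>R x)" using dominates_all[OF l] by (simp add: dominates_def)
  moreover have "inversion l (t *\<^sub>R x) = x"
    using t assms by (simp add: inversion_def l_def power_mult_distrib power2_eq_square)
  moreover have "(l / norm (t *\<^sub>R x)) powr n = t powr (- n / 2)"
  proof -
    have "l / norm (t *\<^sub>R x) = t powr (- 1 / 2)"
      using t assms by (simp add: l_def powr_half_sqrt[symmetric] powr_minus powr_divide field_simps powr_add[symmetric])
    then show ?thesis using t by (simp add: powr_powr)
  qed
  ultimately show ?thesis by (simp add: kelvin_def)
qed simp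

lemma sphere_minimum:
  assumes "r > 0"
  obtains x where "norm x = r" "\<And>z. norm z = r \<Longrightarrow> U x \<le> U z"
proof -
  obtain v :: "real ^ 'n" where v: "norm v = r" using vector_choose_size[of r] assms by auto
  have "sphere (0 :: real ^ 'n) r \<noteq> {}" using v by auto
  from continuous_attains_inf[OF compact_sphere this continuous_on_U]
  obtain x where "x \<in> sphere 0 r" "\<And>z. z \<in> sphere 0 r \<Longrightarrow> U x \<le> U z" by blast
  then show ?thesis using that[of x] by simp
qed

text \<open>
  Integrate only over a ball of radius \<open>r / 2\<close> inside the shell between \<open>r\<close> and \<open>2 * r\<close>. By monotonicity along
  rays \<open>U\<close> is there at least a constant times its minimum over the sphere of radius \<open>r\<close>, and the exponents of
  \<open>r\<close> add up to \<open>\<alpha> - n + CARD('n) = 2 + \<alpha>\<close>.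
\<close>
lemma sphere_minimum_superlinear:
  "\<exists>C>0. \<forall>r x. r > 0 \<longrightarrow> norm x = r \<longrightarrow> (\<forall>z. norm z = r \<longrightarrow> U x \<le> U z) \<longrightarrow>
     C * r powr (2 + \<alpha>) * U x powr p \<le> U x"
proof -
  define v where "v = unit_ball_vol (real CARD('n))"
  have v: "v > 0" by (simp add: v_def)
  define A where "A = min 1 (2 powr \<alpha>)"
  have A: "A > 0" by (simp add: A_def)
  define C where "C = \<kappa> * A * (2 powr (- n / 2)) powr p * 3 powr - n * (v * (1 / 2) powr real CARD('n))"
  show ?thesis
  proof (intro exI[of _ C] conjI allI impI)
    show "C > 0" using \<kappa> A v by (simp add: C_def)
    fix r :: real and x :: "real ^ 'n"
    assume r: "r > 0" and x: "norm x = r" and min: "\<forall>z. norm z = r \<longrightarrow> U x \<le> U z"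
    obtain e :: "real ^ 'n" where e: "norm e = 3 / 2 * r" using vector_choose_size[of "3 / 2 * r"] r by auto
    let ?B = "ball e (r / 2)"
    define b where "b = \<kappa> * (A * r powr \<alpha>) * (2 powr (- n / 2) * U x) powr p * (3 * r) powr - n"
    have low: "b \<le> f y * norm (x - y) powr - n" if "y \<in> ?B" for y
    proof -
      have "norm (e - y) < r / 2" using that by (simp add: dist_norm)
      then have y: "r < norm y" "norm y < 2 * r"
        using norm_triangle_ineq2[of e y] norm_triangle_ineq2[of y e] e by (auto simp: norm_minus_commute)
      have "A * r powr \<alpha> \<le> norm y powr \<alpha>"
      proof (cases "\<alpha> \<ge> 0")
        case True
        have "A * r powr \<alpha> \<le> 1 * r powr \<alpha>" by (intro mult_right_mono) (auto simp: A_def)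
        also have "\<dots> \<le> norm y powr \<alpha>" using True r y by (simp add: powr_mono2)
        finally show ?thesis .
      next
        case False
        have "A * r powr \<alpha> \<le> 2 powr \<alpha> * r powr \<alpha>" by (intro mult_right_mono) (auto simp: A_def)
        also have "\<dots> = (2 * r) powr \<alpha>" by (rule powr_mult[symmetric])
        also have "\<dots> \<le> norm y powr \<alpha>" using False r y by (intro powr_mono2') auto
        finally show ?thesis .
      qed
      moreover have "2 powr (- n / 2) * U x \<le> U y"
      proof -
        define t where "t = norm y / r"
        have t: "t > 1" "t < 2" using y r by (auto simp: t_def field_simps)
        have "norm y > 0" using y r by linarith
        then have "norm (y /\<^sub>R t) = r" using r by (simp add: t_def)
        then have "U x \<le> U (y /\<^sub>R t)" using min by blast
        then have "2 powr (- n / 2) * U x \<le> t powr (- n / 2) * U (y /\<^sub>R t)"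
          using t n_pos U_pos[of x] by (intro mult_mono powr_mono2') auto
        also have "\<dots> \<le> U (t *\<^sub>R (y /\<^sub>R t))" using t \<open>norm (y /\<^sub>R t) = r\<close> r by (intro U_ray) auto
        also have "t *\<^sub>R (y /\<^sub>R t) = y" using t by simp
        finally show ?thesis .
      qed
      then have "(2 powr (- n / 2) * U x) powr p \<le> U y powr p"
        using p U_pos[of x] by (intro powr_mono2) auto
      moreover have "(3 * r) powr - n \<le> norm (x - y) powr - n"
        using norm_triangle_ineq4[of x y] x y r n_pos by (intro powr_mono2') auto
      ultimately show ?thesis
        unfolding b_def f_def using \<kappa> A by (intro mult_mono) auto
    qed
    have "ennreal b * ennreal (v * (r / 2) ^ CARD('n)) = ennreal b * emeasure lborel ?B"
      using r by (simp add: emeasure_ball v_def)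
    also have "\<dots> = (\<integral>\<^sup>+y. ennreal b * indicator ?B y \<partial>lborel)" by (simp add: nn_integral_cmult_indicator)
    also have "\<dots> \<le> (\<integral>\<^sup>+y. ennreal (f y * norm (x - y) powr - n) \<partial>lborel)"
      using low by (intro nn_integral_mono) (auto simp: indicator_def intro: ennreal_leI)
    also have "\<dots> = ennreal (U x)" by (rule U_nn_integral[symmetric])
    finally have "b * (v * (r / 2) ^ CARD('n)) \<le> U x"
      using less_imp_le[OF U_pos[of x]] v r \<kappa> A by (subst (asm) ennreal_mult[symmetric]) (auto simp: b_def)
    moreover have "b * (v * (r / 2) ^ CARD('n)) = C * r powr (2 + \<alpha>) * U x powr p"
    proof -
      have "(r / 2) ^ CARD('n) = r powr real CARD('n) * (1 / 2) powr real CARD('n)"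
        using r powr_mult[of r "1 / 2" "real CARD('n)"] by (simp add: powr_realpow[symmetric])
      then have "b * (v * (r / 2) ^ CARD('n)) = C * (r powr \<alpha> * r powr - n * r powr real CARD('n)) * U x powr p"
        by (simp add: b_def C_def powr_mult mult_ac)
      also have "r powr \<alpha> * r powr - n * r powr real CARD('n) = r powr (2 + \<alpha>)"
        by (simp add: powr_add[symmetric] n_def add.commute)
      finally show ?thesis .
    qed
    ultimately show "C * r powr (2 + \<alpha>) * U x powr p \<le> U x" by simp
  qed
qed

text \<open>
  On a sphere of radius \<open>r\<close> the minimum is bounded above by superlinearity and below by monotonicity along rays.
  The two bounds are incompatible for large \<open>r\<close> by a factor \<open>r powr (\<tau> / 2)\<close>.
\<close>
lemma no_subcritical_riesz_solution: False
proof -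
  obtain C where C: "C > 0" "\<And>r x. r > 0 \<Longrightarrow> norm x = r \<Longrightarrow> (\<And>z. norm z = r \<Longrightarrow> U x \<le> U z) \<Longrightarrow>
     C * r powr (2 + \<alpha>) * U x powr p \<le> U x"
    using sphere_minimum_superlinear by blast
  obtain x1 where x1: "norm x1 = 1" "\<And>z. norm z = 1 \<Longrightarrow> U x1 \<le> U z" using sphere_minimum[of 1] by auto
  define m where "m = U x1"
  have m: "m > 0" using U_pos by (simp add: m_def)
  have bound: "C * m powr (p - 1) * r powr (\<tau> / 2) \<le> 1" if r: "r \<ge> 1" for r
  proof -
    obtain x where x: "norm x = r" "\<And>z. norm z = r \<Longrightarrow> U x \<le> U z" using sphere_minimum[of r] r by auto
    have "r powr (- n / 2) * m \<le> r powr (- n / 2) * U (x /\<^sub>R r)"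
      unfolding m_def using x r by (intro mult_left_mono x1) auto
    also have "\<dots> \<le> U (r *\<^sub>R (x /\<^sub>R r))" using x r by (intro U_ray) auto
    also have "r *\<^sub>R (x /\<^sub>R r) = x" using r by simp
    finally have low: "r powr (- n / 2) * m \<le> U x" .
    have Ux: "U x > 0" by (rule U_pos)
    have "C * r powr (2 + \<alpha>) * U x powr p \<le> U x" using C(2)[OF _ x] r by simp
    moreover have "U x powr p = U x powr (p - 1) * U x"
      using Ux by (simp add: powr_diff)
    ultimately have "C * r powr (2 + \<alpha>) * U x powr (p - 1) \<le> 1" using Ux by simp
    moreover have "(r powr (- n / 2) * m) powr (p - 1) \<le> U x powr (p - 1)"
      using low p m by (intro powr_mono2) auto
    then have "C * r powr (2 + \<alpha>) * (r powr (- n / 2) * m) powr (p - 1) \<le> C * r powr (2 + \<alpha>) * U x powr (p - 1)"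
      using C by (intro mult_left_mono) auto
    ultimately have "C * r powr (2 + \<alpha>) * (r powr (- n / 2) * m) powr (p - 1) \<le> 1" by simp
    also have "C * r powr (2 + \<alpha>) * (r powr (- n / 2) * m) powr (p - 1)
      = C * m powr (p - 1) * (r powr (2 + \<alpha>) * r powr (- n / 2 * (p - 1)))"
      by (simp add: powr_mult powr_powr mult_ac)
    also have "r powr (2 + \<alpha>) * r powr (- n / 2 * (p - 1)) = r powr (\<tau> / 2)"
      by (simp add: powr_add[symmetric] \<tau>_def n_def field_simps)
    finally show ?thesis .
  qed
  define D where "D = 2 / (C * m powr (p - 1))"
  have D: "D > 0" using C m by (simp add: D_def)
  \<comment> \<open>At this radius \<open>bound\<close> would read \<open>2 \<le> 1\<close>.\<close>
  define r where "r = max 1 (D powr (2 / \<tau>))"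
  have "D = (D powr (2 / \<tau>)) powr (\<tau> / 2)" using D \<tau>_pos by (simp add: powr_powr)
  also have "\<dots> \<le> r powr (\<tau> / 2)" using \<tau>_pos by (intro powr_mono2) (auto simp: r_def)
  finally have "C * m powr (p - 1) * D \<le> C * m powr (p - 1) * r powr (\<tau> / 2)"
    using C m by (intro mult_left_mono) auto
  also have "\<dots> \<le> 1" by (rule bound) (simp add: r_def)
  finally show False using C m by (simp add: D_def)
qed

end

section \<open>Smooth functions of a real variable\<close>

primrec times_differentiable :: "nat \<Rightarrow> (real \<Rightarrow> real) \<Rightarrow> bool" where
  "times_differentiable 0 f \<longleftrightarrow> True"
| "times_differentiable (Suc k) f \<longleftrightarrow> (\<exists>f'. (\<forall>x. (f has_real_derivative f' x) (at x)) \<and> times_differentiable k f')"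

definition smooth :: "(real \<Rightarrow> real) \<Rightarrow> bool" where
  "smooth f \<longleftrightarrow> (\<forall>k. times_differentiable k f)"

lemma times_differentiable_Suc_imp: "times_differentiable (Suc k) f \<Longrightarrow> times_differentiable k f"
  by (induction k arbitrary: f) auto

lemma times_differentiable_add:
  "times_differentiable k f \<Longrightarrow> times_differentiable k g \<Longrightarrow> times_differentiable k (\<lambda>x. f x + g x)"
proof (induction k arbitrary: f g)
  case (Suc k)
  then obtain f' g' where "\<forall>x. (f has_real_derivative f' x) (at x)" "times_differentiable k f'"
    "\<forall>x. (g has_real_derivative g' x) (at x)" "times_differentiable k g'" by auto
  with Suc.IH[of f' g'] show ?case
    by (auto intro!: exI[of _ "\<lambda>x. f' x + g' x"] DERIV_add)
qed simp

lemma times_differentiable_mult: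
  "times_differentiable k f \<Longrightarrow> times_differentiable k g \<Longrightarrow> times_differentiable k (\<lambda>x. f x * g x)"
proof (induction k arbitrary: f g)
  case (Suc k)
  then obtain f' g' where *: "\<forall>x. (f has_real_derivative f' x) (at x)" "times_differentiable k f'"
    "\<forall>x. (g has_real_derivative g' x) (at x)" "times_differentiable k g'" by auto
  have "times_differentiable k (\<lambda>x. f' x * g x + g' x * f x)"
    using Suc * times_differentiable_Suc_imp by (intro times_differentiable_add Suc.IH) blast+
  with * show ?case
    by (auto intro!: exI[of _ "\<lambda>x. f' x * g x + g' x * f x"] DERIV_mult)
qed simp

lemma times_differentiable_affine:
  "times_differentiable k f \<Longrightarrow> times_differentiable k (\<lambda>x. f (a * x + b) * c)"
proof (induction k arbitrary: f c)
  case (Suc k)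
  then obtain f' where *: "\<And>x. (f has_real_derivative f' x) (at x)" "times_differentiable k f'" by auto
  have "((\<lambda>x. f (a * x + b) * c) has_real_derivative f' (a * x + b) * a * c) (at x)" for x
    by (intro DERIV_cmult_right DERIV_chain2[OF *(1)]) (auto intro!: derivative_eq_intros)
  moreover have "times_differentiable k (\<lambda>x. f' (a * x + b) * a * c)"
    using Suc.IH[OF *(2), of "a * c"] by (simp add: mult.assoc)
  ultimately show ?case
    unfolding times_differentiable.simps by (intro exI[of _ "\<lambda>x. f' (a * x + b) * a * c"] conjI allI)
qed simp

lemma smooth_add: "smooth f \<Longrightarrow> smooth g \<Longrightarrow> smooth (\<lambda>x. f x + g x)"
  and smooth_mult: "smooth f \<Longrightarrow> smooth g \<Longrightarrow> smooth (\<lambda>x. f x * g x)"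
  and smooth_affine: "smooth f \<Longrightarrow> smooth (\<lambda>x. f (a * x + b) * c)"
  by (auto simp: smooth_def times_differentiable_add times_differentiable_mult times_differentiable_affine)

lemma smooth_derivative:
  assumes "smooth f" "\<And>x. (f has_real_derivative f' x) (at x)"
  shows "smooth f'"
  unfolding smooth_def
proof
  fix k
  have "times_differentiable (Suc k) f" using assms(1) by (simp add: smooth_def)
  then obtain g where g: "\<And>x. (f has_real_derivative g x) (at x)" "times_differentiable k g" by auto
  have "f' = g" using DERIV_unique[OF assms(2) g(1)] by auto
  with g show "times_differentiable k f'" by simp
qed

lemma smooth_obtain_derivative:
  assumes "smooth f"
  obtains f' where "smooth f'" "\<And>x. (f has_real_derivative f' x) (at x)"
proof -
  have "times_differentiable (Suc 0) f" using assms unfolding smooth_def by blast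
  then obtain f' where "\<And>x. (f has_real_derivative f' x) (at x)" by auto
  with smooth_derivative[OF assms this] show ?thesis using that by blast
qed

lemma smooth_antiderivative:
  assumes "smooth f'" "\<And>x. (f has_real_derivative f' x) (at x)"
  shows "smooth f"
  unfolding smooth_def
proof
  fix k show "times_differentiable k f"
    using assms by (cases k) (auto simp: smooth_def)
qed

lemma smooth_continuous: "smooth f \<Longrightarrow> continuous_on S f"
  by (erule smooth_obtain_derivative) (auto intro!: continuous_at_imp_continuous_on DERIV_isCont)


text \<open>
  With \<open>P = 1\<close> this is the standard function that is smooth but not analytic at \<open>0\<close>; admitting a polynomial in
  \<open>1 / x\<close> makes the family closed under differentiation.
\<close>
definition flat :: "real poly \<Rightarrow> real \<Rightarrow> real" where
  "flat P x = (if x > 0 then poly P (1 / x) * exp (- (1 / x)) else 0)"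

lemma poly_times_exp_neg_tendsto_0: "((\<lambda>y. poly P y * exp (- y)) \<longlongrightarrow> (0 :: real)) at_top"
proof -
  have "((\<lambda>y. \<Sum>i\<le>degree P. coeff P i * (y ^ i / exp y)) \<longlongrightarrow> (\<Sum>i\<le>degree P. coeff P i * 0)) at_top"
    by (intro tendsto_intros tendsto_power_div_exp_0)
  then show ?thesis by (simp add: poly_altdef sum_distrib_right exp_minus divide_inverse mult.assoc)
qed

lemma flat_has_derivative:
  "(flat P has_real_derivative flat ([:0, 0, 1:] * (P - pderiv P)) x) (at x)"
proof -
  consider "x > 0" | "x = 0" | "x < 0" by linarith
  then show ?thesis
  proof cases
    case 1
    have "((\<lambda>x. poly P (1 / x) * exp (- (1 / x))) has_real_derivative
        poly P (1 / x) * (exp (- (1 / x)) * (1 / x\<^sup>2)) + (poly (pderiv P) (1 / x) * (- (1 / x\<^sup>2))) * exp (- (1 / x))) (at x)"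
    proof -
      have inv: "((\<lambda>x. 1 / x) has_real_derivative - (1 / x\<^sup>2)) (at x)"
        using 1 by (auto intro!: derivative_eq_intros simp: power2_eq_square)
      have p: "((\<lambda>x. poly P (1 / x)) has_real_derivative poly (pderiv P) (1 / x) * - (1 / x\<^sup>2)) (at x)"
        by (rule DERIV_chain2[OF poly_DERIV inv])
      have e: "((\<lambda>x. exp (- (1 / x))) has_real_derivative exp (- (1 / x)) * - (- (1 / x\<^sup>2))) (at x)"
        by (rule DERIV_chain2[OF DERIV_exp DERIV_minus[OF inv]])
      show ?thesis using DERIV_mult[OF p e] by (simp add: algebra_simps)
    qed
    moreover have "poly P (1 / x) * (exp (- (1 / x)) * (1 / x\<^sup>2)) + (poly (pderiv P) (1 / x) * (- (1 / x\<^sup>2))) * exp (- (1 / x))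
       = flat ([:0, 0, 1:] * (P - pderiv P)) x"
      using 1 by (simp add: flat_def power2_eq_square algebra_simps)
    moreover have "\<forall>\<^sub>F y in nhds x. flat P y = poly P (1 / y) * exp (- (1 / y))"
      using eventually_nhds_in_open[of "{0<..}" x] 1 by (auto simp: flat_def elim!: eventually_mono)
    ultimately show ?thesis by (subst DERIV_cong_ev[OF refl _ refl]) auto
  next
    case 2
    have "((\<lambda>h. flat P h / h) \<longlongrightarrow> 0) (at 0)"
    proof (rule filterlim_split_at)
      have "((\<lambda>h::real. 0) \<longlongrightarrow> (0 :: real)) (at_left 0)" by simp
      then show "((\<lambda>h. flat P h / h) \<longlongrightarrow> 0) (at_left 0)"
        by (rule Lim_transform_eventually) (auto simp: eventually_at_left_field flat_def intro!: exI[of _ "-1"])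
      have "((\<lambda>h. poly ([:0, 1:] * P) (inverse h) * exp (- inverse h)) \<longlongrightarrow> (0 :: real)) (at_right 0)"
        by (rule filterlim_compose[OF poly_times_exp_neg_tendsto_0 filterlim_inverse_at_top_right])
      then show "((\<lambda>h. flat P h / h) \<longlongrightarrow> 0) (at_right 0)"
        by (rule Lim_transform_eventually)
           (auto simp: eventually_at_right_field flat_def divide_inverse intro!: exI[of _ 1])
    qed
    then show ?thesis using 2 by (simp add: DERIV_def flat_def)
  next
    case 3
    have "\<forall>\<^sub>F y in nhds x. flat P y = 0"
      using eventually_nhds_in_open[of "{..<0}" x] 3 by (auto simp: flat_def elim!: eventually_mono)
    then have "(flat P has_real_derivative 0) (at x)"
      by (subst DERIV_cong_ev[OF refl _ refl]) auto
    then show ?thesis using 3 by (simp add: flat_def)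
  qed
qed

lemma smooth_flat: "smooth (flat P)"
proof -
  have "times_differentiable k (flat P)" for k
    by (induction k arbitrary: P) (auto intro: flat_has_derivative)
  then show ?thesis by (simp add: smooth_def)
qed

text \<open>
  The support is the interval from \<open>1/4\<close> to \<open>1\<close>. As a function of a squared distance it lives in the shell
  between \<open>1/2\<close> and \<open>1\<close>.
\<close>
definition bump :: "real \<Rightarrow> real" where
  "bump s = flat 1 (s - 1 / 4) * flat 1 (1 - s)"

lemma smooth_bump: "smooth bump"
proof -
  have "smooth (\<lambda>s. (flat 1 (1 * s + - (1 / 4)) * 1) * (flat 1 (- 1 * s + 1) * 1))"
    by (intro smooth_mult smooth_affine smooth_flat)
  then show ?thesis by (simp add: bump_def[abs_def])
qed

lemma bump_nonneg: "bump s \<ge> 0"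
  and bump_pos: "1 / 4 < s \<Longrightarrow> s < 1 \<Longrightarrow> bump s > 0"
  and bump_zero: "s \<le> 1 / 4 \<or> s \<ge> 1 \<Longrightarrow> bump s = 0"
  by (auto simp: bump_def flat_def)


section \<open>A smooth truncation of the fundamental solution\<close>

lemma integral_from_0_has_derivative:
  fixes h :: "real \<Rightarrow> real"
  assumes "continuous_on UNIV h" "\<And>s. s \<le> 1 / 4 \<Longrightarrow> h s = 0"
  shows "((\<lambda>s. integral {0..s} h) has_real_derivative h s) (at s)"
proof (cases "s > 0")
  case True
  have "((\<lambda>s. integral {0..s} h) has_real_derivative h s) (at s within {0..s + 1})"
    using True by (intro integral_has_real_derivative continuous_on_subset[OF assms(1)]) auto
  moreover have "at s within {0..s + 1} = at s" using True by (intro at_within_Icc_at) auto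
  ultimately show ?thesis by simp
next
  case False
  have "integral {0..t} h = 0" if "t < 1 / 4" for t
  proof -
    have "integral {0..t} h = integral {0..t} (\<lambda>_. 0)" using that assms(2) by (intro integral_cong) auto
    then show ?thesis by simp
  qed
  then have "\<forall>\<^sub>F t in nhds s. integral {0..t} h = 0"
    using eventually_nhds_in_open[of "{..<1 / 4}" s] False by (auto elim!: eventually_mono)
  then show ?thesis using False assms(2)[of s] by (subst DERIV_cong_ev[OF refl _ refl]) auto
qed

text \<open>
  The zero set of \<open>q\<close> contains a neighbourhood of the singularity of the power, so differentiating any number
  of times stays within products of the same kind.
\<close>
lemma smooth_times_powr:
  assumes "smooth q" "\<And>s. s \<le> 1 / 4 \<Longrightarrow> q s = 0"
  shows "smooth (\<lambda>s. q s * s powr b)"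
proof -
  have "times_differentiable k (\<lambda>s. q s * s powr b)" if "smooth q" "\<And>s. s \<le> 1 / 4 \<Longrightarrow> q s = 0" for k b q
    using that
  proof (induction k arbitrary: q b)
    case (Suc k)
    obtain q' where q': "smooth q'" "\<And>x. (q has_real_derivative q' x) (at x)"
      using smooth_obtain_derivative[OF Suc.prems(1)] by blast
    have lt: "q' s = 0" if "s < 1 / 4" for s
    proof -
      have "\<forall>\<^sub>F t in nhds s. q t = 0"
        using eventually_nhds_in_open[of "{..<1 / 4}" s] that Suc.prems(2) by (auto elim!: eventually_mono)
      then have "(q has_real_derivative 0) (at s)" by (subst DERIV_cong_ev[OF refl _ refl]) auto
      then show ?thesis using DERIV_unique q'(2) by blast
    qed
    have "q' s = 0" if "s \<le> 1 / 4" for s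
    proof (cases "s = 1 / 4")
      case True
      have "(q' \<longlongrightarrow> q' (1 / 4)) (at_left (1 / 4))"
        using smooth_continuous[OF q'(1), of UNIV] by (auto simp: continuous_on_def intro: tendsto_within_subset)
      moreover have "(q' \<longlongrightarrow> 0) (at_left (1 / 4))"
        by (rule Lim_transform_eventually[OF tendsto_const])
           (auto simp: eventually_at_left_field lt intro!: exI[of _ 0])
      ultimately show ?thesis using True tendsto_unique trivial_limit_at_left_real by blast
    qed (use that lt in auto)
    note q'0 = this
    have "((\<lambda>s. q s * s powr b) has_real_derivative q' s * s powr b + b * q s * s powr (b - 1)) (at s)" for s
    proof (cases "s > 0")
      case True
      then show ?thesis by (auto intro!: derivative_eq_intros q'(2) simp: algebra_simps)
    next
      case False
      have "\<forall>\<^sub>F t in nhds s. q t * t powr b = 0"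
        using eventually_nhds_in_open[of "{..<1 / 4}" s] False Suc.prems(2) by (auto elim!: eventually_mono)
      then have "((\<lambda>s. q s * s powr b) has_real_derivative 0) (at s)"
        by (subst DERIV_cong_ev[OF refl _ refl]) (assumption, simp)
      then show ?thesis using False Suc.prems(2)[of s] q'0[of s] by simp
    qed
    moreover have "times_differentiable k (\<lambda>s. q' s * s powr b + b * q s * s powr (b - 1))"
    proof (rule times_differentiable_add)
      show "times_differentiable k (\<lambda>s. q' s * s powr b)" using Suc.IH q'(1) q'0 by blast
      have "smooth (\<lambda>s. b * q s)" using smooth_affine[OF Suc.prems(1), of 1 0 b] by (simp add: mult.commute)
      then show "times_differentiable k (\<lambda>s. b * q s * s powr (b - 1))" using Suc.prems(2) by (intro Suc.IH) auto
    qed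
    ultimately show ?case
      unfolding times_differentiable.simps
      by (intro exI[of _ "\<lambda>s. q' s * s powr b + b * q s * s powr (b - 1)"] conjI allI)
  qed simp
  with assms show ?thesis unfolding smooth_def by blast
qed

definition step :: "real \<Rightarrow> real" where "step s = integral {0..s} bump"

lemma step_has_derivative: "(step has_real_derivative bump s) (at s)"
  unfolding step_def[abs_def]
  by (rule integral_from_0_has_derivative) (auto intro: smooth_continuous smooth_bump bump_zero)

lemma smooth_step: "smooth step"
  using smooth_antiderivative[OF smooth_bump step_has_derivative] .

lemma step_zero: "s \<le> 1 / 4 \<Longrightarrow> step s = 0"
proof -
  assume s: "s \<le> 1 / 4"
  have "integral {0..s} bump = integral {0..s} (\<lambda>_. 0)" using s by (intro integral_cong) (auto intro: bump_zero)
  then show ?thesis by (simp add: step_def)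
qed

lemma step_mono: "s \<le> t \<Longrightarrow> step s \<le> step t"
  by (rule DERIV_nonneg_imp_nondecreasing[where f = step])
     (assumption, intro exI conjI, rule step_has_derivative, rule bump_nonneg)

lemma step_nonneg: "step s \<ge> 0"
  using step_mono[of "min s 0" s] step_zero[of "min s 0"] by simp

lemma step_const: "s \<ge> 1 \<Longrightarrow> step s = step 1"
proof -
  assume s: "s \<ge> 1"
  have "step 1 \<ge> step s"
  proof (rule DERIV_nonpos_imp_nonincreasing[OF s, where f = step])
    fix x :: real assume "1 \<le> x"
    then show "\<exists>y. (step has_real_derivative y) (at x) \<and> y \<le> 0"
      using step_has_derivative[of x] bump_zero[of x] by auto
  qed
  with step_mono[OF s] show ?thesis by simp
qed

lemma step_1_pos: "step 1 > 0"
proof -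
  have "step (1 / 4) < step 1"
  proof (rule DERIV_pos_imp_increasing_open[where f = step])
    fix x :: real assume "1 / 4 < x" "x < 1"
    then show "\<exists>y. (step has_real_derivative y) (at x) \<and> 0 < y"
      using step_has_derivative[of x] bump_pos[of x] by blast
  qed (auto intro: smooth_continuous smooth_step)
  then show ?thesis by (simp add: step_zero)
qed

text \<open>
  Radial functions are written as functions of the squared norm, since this is smooth. In this variable the
  fundamental solution in dimension \<open>N\<close> is \<open>s powr (1 - N / 2)\<close>, and the Laplacian of \<open>g\<close> is
  \<open>4 * s powr (1 - N / 2)\<close> times the derivative of \<open>s powr (N / 2) * g' s\<close>.
\<close>
locale newtonian_profile =
  fixes N :: real
  assumes N: "N > 2"
begin

definition antiderivative :: "real \<Rightarrow> real" where
  "antiderivative s = integral {0..s} (\<lambda>t. step t * t powr (- N / 2))"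

lemma smooth_antiderivative_integrand: "smooth (\<lambda>t. step t * t powr (- N / 2))"
  by (rule smooth_times_powr[OF smooth_step step_zero])

lemma antiderivative_has_derivative: "(antiderivative has_real_derivative step s * s powr (- N / 2)) (at s)"
  unfolding antiderivative_def[abs_def]
  by (rule integral_from_0_has_derivative) (use smooth_continuous[OF smooth_antiderivative_integrand] step_zero in auto)

definition mass :: real where "mass = 2 / (N - 2) * step 1"

text \<open>
  A smooth radial function with \<open>s powr (N / 2) * profile' s = - step s\<close> for \<open>s > 0\<close>. It equals the multiple \<open>mass\<close> of the
  fundamental solution for \<open>s \<ge> 1\<close>, is constant near \<open>0\<close>, and is superharmonic because \<open>step\<close> is nondecreasing.
\<close>
definition profile :: "real \<Rightarrow> real" where
  "profile s = mass + antiderivative 1 - antiderivative s"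

lemma mass_pos: "mass > 0" using N step_1_pos by (simp add: mass_def)

lemma profile_has_derivative: "(profile has_real_derivative - (step s * s powr (- N / 2))) (at s)"
  unfolding profile_def[abs_def] by (auto intro!: derivative_eq_intros antiderivative_has_derivative)

lemma smooth_profile: "smooth profile"
proof (rule smooth_antiderivative[OF _ profile_has_derivative])
  show "smooth (\<lambda>s. - (step s * s powr (- N / 2)))"
    using smooth_affine[OF smooth_antiderivative_integrand, of 1 0 "-1"] by simp
qed

text \<open>
  The derivative reduces to the term with \<open>bump\<close>, which has a sign.
\<close>
lemma profile_gap_antimono:
  assumes "0 < s" "s \<le> t"
  shows "profile t - 2 / (N - 2) * (step t * t powr (1 - N / 2)) \<le> profile s - 2 / (N - 2) * (step s * s powr (1 - N / 2))"
proof (rule DERIV_nonpos_imp_nonincreasing[OF assms(2)])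
  fix x assume x: "s \<le> x" "x \<le> t"
  then have x0: "x > 0" using assms by simp
  have "((\<lambda>x. profile x - 2 / (N - 2) * (step x * x powr (1 - N / 2))) has_real_derivative
     - (step x * x powr (- N / 2)) - 2 / (N - 2) * (bump x * x powr (1 - N / 2) + step x * ((1 - N / 2) * x powr (1 - N / 2 - 1)))) (at x)"
    using x0 N by (auto intro!: derivative_eq_intros profile_has_derivative step_has_derivative)
  moreover have "- (step x * x powr (- N / 2)) - 2 / (N - 2) * (bump x * x powr (1 - N / 2) + step x * ((1 - N / 2) * x powr (1 - N / 2 - 1)))
     = - (2 / (N - 2) * (bump x * x powr (1 - N / 2)))"
  proof -
    have e1: "2 / (N - 2) * (bump x * x powr (1 - N / 2) + step x * ((1 - N / 2) * x powr (1 - N / 2 - 1)))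
      = 2 / (N - 2) * (bump x * x powr (1 - N / 2)) + (2 / (N - 2) * (1 - N / 2)) * (step x * x powr (1 - N / 2 - 1))"
      by (simp only: distrib_left mult_ac)
    have e2: "2 / (N - 2) * (1 - N / 2) = - 1" using N by (simp add: field_simps)
    show ?thesis unfolding e1 e2 by simp
  qed
  ultimately show "\<exists>y. ((\<lambda>x. profile x - 2 / (N - 2) * (step x * x powr (1 - N / 2))) has_real_derivative y) (at x) \<and> y \<le> 0"
    using N bump_nonneg[of x] by (intro exI[of _ "- (2 / (N - 2) * (bump x * x powr (1 - N / 2)))"]) auto
qed

lemma profile_outside:
  assumes "s \<ge> 1"
  shows "profile s = mass * s powr (1 - N / 2)"
proof -
  have "\<exists>c. \<forall>x\<in>{1..}. profile x - mass * x powr (1 - N / 2) = c"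
  proof (rule has_field_derivative_zero_constant)
    fix x :: real assume x: "x \<in> {1..}"
    have "((\<lambda>x. profile x - mass * x powr (1 - N / 2)) has_real_derivative
       - (step x * x powr (- N / 2)) - mass * ((1 - N / 2) * x powr (1 - N / 2 - 1))) (at x)"
      using x by (auto intro!: derivative_eq_intros profile_has_derivative)
    moreover have "- (step x * x powr (- N / 2)) - mass * ((1 - N / 2) * x powr (1 - N / 2 - 1)) = 0"
    proof -
      have e1: "mass * ((1 - N / 2) * x powr (1 - N / 2 - 1)) = (2 / (N - 2) * (1 - N / 2)) * (step 1 * x powr (1 - N / 2 - 1))"
        unfolding mass_def by (simp only: mult_ac)
      have e2: "2 / (N - 2) * (1 - N / 2) = - 1" using N by (simp add: field_simps)
      have e3: "step x = step 1" using x by (intro step_const) simp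
      show ?thesis unfolding e1 e2 e3 by simp
    qed
    ultimately show "((\<lambda>x. profile x - mass * x powr (1 - N / 2)) has_real_derivative 0) (at x within {1..})"
      by (simp add: has_field_derivative_at_within)
  qed simp
  then obtain c where c: "\<And>x. x \<ge> 1 \<Longrightarrow> profile x - mass * x powr (1 - N / 2) = c" by auto
  have "c = 0" using c[of 1] by (simp add: profile_def)
  with c[OF assms] show ?thesis by simp
qed

lemma profile_ge_step:
  assumes "s > 0"
  shows "2 / (N - 2) * (step s * s powr (1 - N / 2)) \<le> profile s"
proof (cases "s \<le> 1")
  case True
  have "profile 1 - 2 / (N - 2) * (step 1 * 1 powr (1 - N / 2)) = 0"
    unfolding profile_def mass_def by simp
  with profile_gap_antimono[OF assms True] show ?thesis by simp
next
  case False
  then have s: "s \<ge> 1" by simp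
  show ?thesis unfolding profile_outside[OF s] step_const[OF s] mass_def by simp
qed

lemma profile_nonneg: "s > 0 \<Longrightarrow> profile s \<ge> 0"
proof -
  assume "s > 0"
  have "0 \<le> 2 / (N - 2) * (step s * s powr (1 - N / 2))" using step_nonneg[of s] N by simp
  also have "\<dots> \<le> profile s" using \<open>s > 0\<close> by (rule profile_ge_step)
  finally show ?thesis .
qed

text \<open>
  The scaled form of the statement that the truncations of the fundamental solution increase as the truncation
  radius shrinks (\<open>green_antimono\<close>).
\<close>
lemma profile_scaled_mono:
  assumes "0 < s" "s \<le> t"
  shows "s powr (N / 2 - 1) * profile s \<le> t powr (N / 2 - 1) * profile t"
proof (rule DERIV_nonneg_imp_nondecreasing[OF assms(2)])
  fix x assume x: "s \<le> x" "x \<le> t"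
  then have x0: "x > 0" using assms by simp
  have "((\<lambda>x. x powr (N / 2 - 1) * profile x) has_real_derivative
     (N / 2 - 1) * x powr (N / 2 - 1 - 1) * profile x + x powr (N / 2 - 1) * - (step x * x powr (- N / 2))) (at x)"
    using x0 by (auto intro!: derivative_eq_intros profile_has_derivative)
  moreover have "0 \<le> (N / 2 - 1) * x powr (N / 2 - 1 - 1) * profile x + x powr (N / 2 - 1) * - (step x * x powr (- N / 2))"
  proof -
    have "(N / 2 - 1) * x powr (N / 2 - 1 - 1) * (2 / (N - 2) * (step x * x powr (1 - N / 2))) \<le> (N / 2 - 1) * x powr (N / 2 - 1 - 1) * profile x"
      using profile_ge_step[OF x0] N by (intro mult_left_mono) auto
    moreover have "(N / 2 - 1) * x powr (N / 2 - 1 - 1) * (2 / (N - 2) * (step x * x powr (1 - N / 2)))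
      = ((N / 2 - 1) * (2 / (N - 2))) * (step x * (x powr (N / 2 - 1 - 1) * x powr (1 - N / 2)))"
      by (simp only: mult_ac)
    moreover have "(N / 2 - 1) * (2 / (N - 2)) = 1" using N by (simp add: field_simps)
    moreover have "x powr (N / 2 - 1 - 1) * x powr (1 - N / 2) = x powr (N / 2 - 1) * x powr (- N / 2)"
      by (simp add: powr_add[symmetric])
    ultimately have "step x * (x powr (N / 2 - 1) * x powr (- N / 2)) \<le> (N / 2 - 1) * x powr (N / 2 - 1 - 1) * profile x"
      by simp
    then show ?thesis by (simp add: mult.left_commute)
  qed
  ultimately show "\<exists>y. ((\<lambda>x. x powr (N / 2 - 1) * profile x) has_real_derivative y) (at x) \<and> 0 \<le> y" by blast
qed

end

section \<open>Radial test functions\<close>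

text \<open>
  A class of smooth functions that contains the radial functions and is closed under partial derivatives; so
  its members satisfy \<open>Ck k\<close> for all \<open>k\<close> by induction on \<open>k\<close>.
\<close>
inductive_set radial_algebra :: "(real ^ 'n \<Rightarrow> real) set" where
  affine: "(\<lambda>x. c + x \<bullet> v) \<in> radial_algebra"
| radial: "smooth G \<Longrightarrow> (\<lambda>x. G ((x - a) \<bullet> (x - a))) \<in> radial_algebra"
| add: "f \<in> radial_algebra \<Longrightarrow> g \<in> radial_algebra \<Longrightarrow> (\<lambda>x. f x + g x) \<in> radial_algebra"
| mult: "f \<in> radial_algebra \<Longrightarrow> g \<in> radial_algebra \<Longrightarrow> (\<lambda>x. f x * g x) \<in> radial_algebra"

lemma radial_algebra_linear: "(\<lambda>x. 2 * ((x - a) \<bullet> v)) \<in> radial_algebra"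
proof -
  have "(\<lambda>x. 2 * ((x - a) \<bullet> v)) = (\<lambda>x. - 2 * (a \<bullet> v) + x \<bullet> (2 *\<^sub>R v))"
    by (auto simp: inner_diff_left)
  then show ?thesis by (simp only:) (rule radial_algebra.affine)
qed

lemma radial_has_derivative:
  fixes a :: "real ^ 'n"
  assumes "\<And>s. (G has_real_derivative G' s) (at s)"
  shows "((\<lambda>x. G ((x - a) \<bullet> (x - a))) has_derivative (\<lambda>h. G' ((x - a) \<bullet> (x - a)) * (2 * ((x - a) \<bullet> h)))) (at x within S)"
proof -
  have "((\<lambda>x. (x - a) \<bullet> (x - a)) has_derivative (\<lambda>h. 2 * ((x - a) \<bullet> h))) (at x within S)"
    by (auto intro!: derivative_eq_intros simp: inner_commute)
  from has_derivative_compose[OF this assms[unfolded has_field_derivative_def]] show ?thesis by simp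
qed

lemma radial_algebra_derivative:
  fixes f :: "real ^ 'n \<Rightarrow> real"
  assumes "f \<in> radial_algebra"
  shows "\<exists>D. (\<forall>x. (f has_derivative D x) (at x)) \<and> (\<forall>v. (\<lambda>x. D x v) \<in> radial_algebra)"
  using assms
proof induction
  case (affine c v)
  have "(\<lambda>x. w \<bullet> v) \<in> radial_algebra" for w :: "real ^ 'n" using radial_algebra.affine[of "w \<bullet> v" 0] by simp
  then show ?case by (intro exI[of _ "\<lambda>x h. h \<bullet> v"]) (auto intro!: derivative_eq_intros)
next
  case (radial G a)
  then obtain G' where G': "smooth G'" "\<And>s. (G has_real_derivative G' s) (at s)" using smooth_obtain_derivative by blast
  show ?case
    by (intro exI[of _ "\<lambda>x h. G' ((x - a) \<bullet> (x - a)) * (2 * ((x - a) \<bullet> h))"] conjI allI radial_has_derivative G'(2)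
        radial_algebra.mult radial_algebra.radial G'(1) radial_algebra_linear)
next
  case (add f g)
  then obtain D E where "\<And>x. (f has_derivative D x) (at x)" "\<And>v. (\<lambda>x. D x v) \<in> radial_algebra"
    "\<And>x. (g has_derivative E x) (at x)" "\<And>v. (\<lambda>x. E x v) \<in> radial_algebra" by auto
  then show ?case
    by (intro exI[of _ "\<lambda>x h. D x h + E x h"] conjI allI has_derivative_add radial_algebra.add)
next
  case (mult f g)
  then obtain D E where "\<And>x. (f has_derivative D x) (at x)" "\<And>v. (\<lambda>x. D x v) \<in> radial_algebra"
    "\<And>x. (g has_derivative E x) (at x)" "\<And>v. (\<lambda>x. E x v) \<in> radial_algebra" by auto
  then show ?case
    by (intro exI[of _ "\<lambda>x h. f x * E x h + D x h * g x"] conjI allI has_derivative_mult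
        radial_algebra.add radial_algebra.mult mult.hyps)
qed

lemma radial_algebra_Ck: "f \<in> radial_algebra \<Longrightarrow> Ck k f"
proof (induction k arbitrary: f)
  case 0
  then obtain D where "\<And>x. (f has_derivative D x) (at x)" using radial_algebra_derivative by blast
  then show ?case by (auto intro!: continuous_at_imp_continuous_on has_derivative_continuous)
next
  case (Suc k)
  then obtain D where D: "\<And>x. (f has_derivative D x) (at x)" "\<And>v. (\<lambda>x. D x v) \<in> radial_algebra"
    using radial_algebra_derivative by blast
  have "frechet_derivative f (at x) = D x" for x using frechet_derivative_at[OF D(1)] by simp
  then show ?case using D Suc.IH by (auto simp: differentiable_def)
qed

lemma test_function_radial_algebra:
  assumes "f \<in> radial_algebra" "\<And>x. x \<notin> cball a R \<Longrightarrow> f x = 0"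
  shows "test_function f"
proof -
  have "{x. f x \<noteq> 0} \<subseteq> cball a R" using assms(2) by blast
  then have "closure {x. f x \<noteq> 0} \<subseteq> cball a R" by (rule closure_minimal) simp
  then have "compact (closure {x. f x \<noteq> 0})"
    by (metis closed_closure compact_Int_closed compact_cball inf.absorb_iff2)
  then show ?thesis using radial_algebra_Ck[OF assms(1)] by (simp add: test_function_def)
qed

lemma grad_component:
  assumes "(f has_derivative D) (at x)"
  shows "grad f x $ i = D (axis i 1)"
  using frechet_derivative_at[OF assms] by (simp add: grad_def)

lemma integrable_L1_loc_mult:
  fixes w :: "real ^ 'n \<Rightarrow> 'b::euclidean_space"
  assumes w: "w \<in> L1_loc" and \<psi>: "continuous_on UNIV \<psi>" "\<And>x. x \<notin> cball a R \<Longrightarrow> \<psi> x = 0"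
  shows "integrable lebesgue (\<lambda>x. \<psi> x *\<^sub>R w x)"
proof -
  have wm: "w \<in> borel_measurable lebesgue" and wi: "set_integrable lebesgue (cball a R) w"
    using w by (auto simp: L1_loc_def)
  have \<psi>m: "\<psi> \<in> borel_measurable lebesgue"
    using borel_measurable_continuous_onI[OF \<psi>(1)] by (intro measurable_completion) simp
  have "bounded (\<psi> ` cball a R)"
    by (intro compact_imp_bounded compact_continuous_image continuous_on_subset[OF \<psi>(1)]) auto
  then obtain B where B: "\<forall>x\<in>cball a R. \<bar>\<psi> x\<bar> \<le> B" by (auto simp: bounded_iff)
  show ?thesis
  proof (rule Bochner_Integration.integrable_bound)
    show "integrable lebesgue (\<lambda>x. B *\<^sub>R (indicator (cball a R) x *\<^sub>R w x))"
      using wi unfolding set_integrable_def by (rule integrable_scaleR_right)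
    show "(\<lambda>x. \<psi> x *\<^sub>R w x) \<in> borel_measurable lebesgue"
      by (intro borel_measurable_scaleR \<psi>m wm)
    show "AE x in lebesgue. norm (\<psi> x *\<^sub>R w x) \<le> norm (B *\<^sub>R (indicator (cball a R) x *\<^sub>R w x))"
    proof (intro AE_I2)
      fix x
      show "norm (\<psi> x *\<^sub>R w x) \<le> norm (B *\<^sub>R (indicator (cball a R) x *\<^sub>R w x))"
      proof (cases "x \<in> cball a R")
        case True
        from bspec[OF B this] have "\<bar>\<psi> x\<bar> \<le> \<bar>B\<bar>" by simp
        with True show ?thesis by (auto intro!: mult_right_mono)
      qed (simp add: \<psi>(2))
    qed
  qed
qed

lemma derivative_zero_beyond:
  fixes f f' :: "real \<Rightarrow> real"
  assumes "\<And>s. (f has_real_derivative f' s) (at s)" "\<And>s. s > r \<Longrightarrow> f s = 0" "s > r"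
  shows "f' s = 0"
proof -
  have "(f has_real_derivative 0) (at s)"
    by (rule has_field_derivative_transform_within_open[OF DERIV_const, of "{r<..}"]) (use assms in auto)
  from DERIV_unique[OF assms(1) this] show ?thesis .
qed

text \<open>
  The partial derivatives of a test function are test functions, so the definition of the weak gradient can be
  applied to each of them and the results summed.
\<close>
lemma weak_laplacian_radial:
  fixes u :: "real ^ 'n \<Rightarrow> real" and G G' G'' :: "real \<Rightarrow> real"
  assumes G: "smooth G" "\<And>s. (G has_real_derivative G' s) (at s)" "\<And>s. (G' has_real_derivative G'' s) (at s)"
    and R: "R > 0" "\<And>s. s \<ge> R\<^sup>2 \<Longrightarrow> G s = 0"
    and u: "has_weak_gradient u Gr"
  shows "test_function (\<lambda>x. G ((x - a) \<bullet> (x - a)))"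
    and "(\<integral>x. Gr x \<bullet> grad (\<lambda>x. G ((x - a) \<bullet> (x - a))) x \<partial>lebesgue) =
      - (\<integral>x. u x * (4 * ((x - a) \<bullet> (x - a)) * G'' ((x - a) \<bullet> (x - a)) + 2 * real CARD('n) * G' ((x - a) \<bullet> (x - a))) \<partial>lebesgue)"
proof -
  define S where "S x = (x - a) \<bullet> (x - a)" for x :: "real ^ 'n"
  define \<phi> where "\<phi> x = G (S x)" for x
  define \<psi> where "\<psi> i x = G' (S x) * (2 * ((x - a) \<bullet> axis i 1))" for i and x :: "real ^ 'n"
  have smooth': "smooth G'" using smooth_derivative[OF G(1,2)] .
  have out: "S x > R\<^sup>2" if "x \<notin> cball a R" for x
  proof -
    have "R\<^sup>2 < (norm (x - a))\<^sup>2" using that R by (intro power_strict_mono) (auto simp: dist_norm norm_minus_commute)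
    then show ?thesis by (simp add: S_def power2_norm_eq_inner)
  qed
  have zero': "G' s = 0" if "s > R\<^sup>2" for s
    using derivative_zero_beyond[OF G(2) _ that] R(2) by simp
  have zero'': "G'' s = 0" if "s > R\<^sup>2" for s
    using derivative_zero_beyond[OF G(3) _ that] zero' by simp
  have \<phi>: "\<phi> \<in> radial_algebra" unfolding \<phi>_def S_def by (rule radial_algebra.radial[OF G(1)])
  have \<psi>: "\<psi> i \<in> radial_algebra" for i
    unfolding \<psi>_def S_def by (intro radial_algebra.mult radial_algebra.radial smooth' radial_algebra_linear)
  have \<psi>0: "\<psi> i x = 0" if "x \<notin> cball a R" for i x using zero' out[OF that] by (simp add: \<psi>_def)
  have t\<psi>: "test_function (\<psi> i)" for i using test_function_radial_algebra[OF \<psi> \<psi>0] by blast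
  show "test_function (\<lambda>x. G ((x - a) \<bullet> (x - a)))"
    using test_function_radial_algebra[OF \<phi>, of a R] out R(2) unfolding \<phi>_def S_def by (simp add: less_imp_le)
  have grad\<phi>: "grad \<phi> x $ i = \<psi> i x" for x i
    unfolding \<phi>_def \<psi>_def S_def by (rule grad_component[OF radial_has_derivative[OF G(2)]])
  define d where "d i x = 4 * (((x - a) $ i)\<^sup>2 * G'' (S x)) + 2 * G' (S x)" for i x
  have grad\<psi>: "grad (\<psi> i) x $ i = d i x" for x i
  proof -
    have "(\<psi> i has_derivative (\<lambda>h. G' (S x) * (2 * (h \<bullet> axis i 1)) +
        G'' (S x) * (2 * ((x - a) \<bullet> h)) * (2 * ((x - a) \<bullet> axis i 1)))) (at x)"
      unfolding \<psi>_def S_def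
      by (intro has_derivative_mult radial_has_derivative[OF G(3)]) (auto intro!: derivative_eq_intros)
    from grad_component[OF this, of i] show ?thesis
      by (simp add: d_def inner_axis power2_eq_square algebra_simps)
  qed
  have uL: "u \<in> L1_loc" and GrL: "Gr \<in> L1_loc" using u by (auto simp: has_weak_gradient_def)
  have ibp: "(\<integral>x. u x * d i x \<partial>lebesgue) = - (\<integral>x. Gr x $ i * \<psi> i x \<partial>lebesgue)" for i
  proof -
    have "(\<integral>x. u x * grad (\<psi> i) x $ i \<partial>lebesgue) = - (\<integral>x. Gr x $ i * \<psi> i x \<partial>lebesgue)"
      using u t\<psi>[of i] unfolding has_weak_gradient_def by blast
    then show ?thesis by (simp only: grad\<psi>)
  qed
  have cS: "continuous_on UNIV S" unfolding S_def by (intro continuous_intros)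
  have int1: "integrable lebesgue (\<lambda>x. u x * d i x)" for i
  proof -
    obtain H where H: "smooth G''" using smooth_derivative[OF smooth' G(3)] by blast
    have "continuous_on UNIV (d i)" unfolding d_def
      by (intro continuous_intros continuous_on_compose2[OF smooth_continuous[OF H, of UNIV] cS]
          continuous_on_compose2[OF smooth_continuous[OF smooth', of UNIV] cS]) auto
    then have "integrable lebesgue (\<lambda>x. d i x *\<^sub>R u x)"
      by (rule integrable_L1_loc_mult[OF uL, where a = a and R = R]) (use zero' zero'' out in \<open>simp add: d_def\<close>)
    then show ?thesis by (simp add: mult.commute)
  qed
  have int2: "integrable lebesgue (\<lambda>x. Gr x $ i * \<psi> i x)" for i
  proof -
    have "continuous_on UNIV (\<psi> i)" using radial_algebra_Ck[OF \<psi>, of 0] by simp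
    then have "integrable lebesgue (\<lambda>x. \<psi> i x *\<^sub>R Gr x)"
      by (rule integrable_L1_loc_mult[OF GrL, where a = a and R = R]) (use \<psi>0 in auto)
    from integrable_inner_left[OF this, of "axis i 1"] show ?thesis
      by (simp add: inner_axis mult.commute)
  qed
  have "(\<integral>x. Gr x \<bullet> grad \<phi> x \<partial>lebesgue) = (\<integral>x. (\<Sum>i\<in>UNIV. Gr x $ i * \<psi> i x) \<partial>lebesgue)"
    by (simp add: inner_vec_def grad\<phi>)
  also have "\<dots> = (\<Sum>i\<in>UNIV. \<integral>x. Gr x $ i * \<psi> i x \<partial>lebesgue)" by (rule Bochner_Integration.integral_sum[OF int2])
  also have "\<dots> = - (\<Sum>i\<in>UNIV. \<integral>x. u x * d i x \<partial>lebesgue)" by (simp add: ibp sum_negf)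
  also have "(\<Sum>i\<in>UNIV. \<integral>x. u x * d i x \<partial>lebesgue) = (\<integral>x. (\<Sum>i\<in>UNIV. u x * d i x) \<partial>lebesgue)"
    by (rule Bochner_Integration.integral_sum[OF int1, symmetric])
  also have "(\<lambda>x. \<Sum>i\<in>UNIV. u x * d i x) = (\<lambda>x. u x * (4 * S x * G'' (S x) + 2 * real CARD('n) * G' (S x)))"
  proof
    fix x
    have "(\<Sum>i\<in>UNIV. d i x) = 4 * ((\<Sum>i\<in>UNIV. ((x - a) $ i)\<^sup>2) * G'' (S x)) + 2 * real CARD('n) * G' (S x)"
      by (simp add: d_def sum.distrib sum_distrib_left[symmetric] sum_distrib_right[symmetric])
    also have "(\<Sum>i\<in>UNIV. ((x - a) $ i)\<^sup>2) = S x" by (simp add: S_def inner_vec_def power2_eq_square)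
    finally show "(\<Sum>i\<in>UNIV. u x * d i x) = u x * (4 * S x * G'' (S x) + 2 * real CARD('n) * G' (S x))"
      by (simp add: sum_distrib_left[symmetric])
  qed
  finally show "(\<integral>x. Gr x \<bullet> grad (\<lambda>x. G ((x - a) \<bullet> (x - a))) x \<partial>lebesgue) =
      - (\<integral>x. u x * (4 * ((x - a) \<bullet> (x - a)) * G'' ((x - a) \<bullet> (x - a)) + 2 * real CARD('n) * G' ((x - a) \<bullet> (x - a))) \<partial>lebesgue)"
    unfolding \<phi>_def S_def .
qed

section \<open>Rescaled truncations of the fundamental solution\<close>

lemma flat_1_le: "flat 1 x \<le> 1" by (simp add: flat_def)

lemma bump_le: "bump s \<le> 1"
  unfolding bump_def using flat_1_le by (intro mult_le_one) (auto simp: flat_def)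

lemma step_powr_has_derivative:
  "((\<lambda>s. step s * s powr b) has_real_derivative bump s * s powr b + b * step s * s powr (b - 1)) (at s)"
proof (cases "s > 0")
  case True
  then show ?thesis by (auto intro!: derivative_eq_intros step_has_derivative simp: algebra_simps)
next
  case False
  have "((\<lambda>s. step s * s powr b) has_real_derivative 0) (at s)"
    by (rule has_field_derivative_transform_within_open[OF DERIV_const, of "{..<1 / 4}"]) (use False step_zero in auto)
  then show ?thesis using False step_zero[of s] bump_zero[of s] by simp
qed

context newtonian_profile
begin

lemma profile_antimono: "s \<le> t \<Longrightarrow> profile t \<le> profile s"
  by (rule DERIV_nonpos_imp_nonincreasing[where f = profile])
     (assumption, intro exI conjI, rule profile_has_derivative, use step_nonneg in simp)

text \<open>
  The truncation of the fundamental solution at distance \<open>e\<close>, in the squared distance \<open>s\<close>. Far away it is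
  \<open>mass\<close> times the fundamental solution, so the difference of two truncations has compact support.
\<close>
definition green :: "real \<Rightarrow> real \<Rightarrow> real" where
  "green e s = e powr (2 - N) * profile (s / e\<^sup>2)"

text \<open>
  Minus the Laplacian of \<open>green e\<close> (\<open>green_laplacian\<close>); it is supported in the shell between \<open>e / 2\<close> and \<open>e\<close>.
\<close>
definition mollifier :: "real \<Rightarrow> real \<Rightarrow> real" where
  "mollifier e s = e powr - N * (4 * (s / e\<^sup>2) powr (1 - N / 2) * bump (s / e\<^sup>2))"

lemma mollifier_nonneg: "mollifier e s \<ge> 0" using bump_nonneg by (simp add: mollifier_def)

lemma mollifier_support: "e > 0 \<Longrightarrow> mollifier e s \<noteq> 0 \<Longrightarrow> e\<^sup>2 / 4 < s \<and> s < e\<^sup>2"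
proof -
  assume e: "e > 0" and "mollifier e s \<noteq> 0"
  then have "bump (s / e\<^sup>2) \<noteq> 0" by (auto simp: mollifier_def)
  then have "1 / 4 < s / e\<^sup>2 \<and> s / e\<^sup>2 < 1" using bump_zero[of "s / e\<^sup>2"] by (meson not_le)
  then show ?thesis using e by (simp add: field_simps)
qed

lemma mollifier_le:
  assumes "e > 0"
  shows "mollifier e s \<le> 4 * 4 powr (N / 2 - 1) * e powr - N"
proof (cases "mollifier e s = 0")
  case False
  then have "1 / 4 < s / e\<^sup>2" using mollifier_support[OF assms False] assms by (simp add: field_simps)
  then have "(s / e\<^sup>2) powr (1 - N / 2) \<le> (1 / 4) powr (1 - N / 2)" using N by (intro powr_mono2') auto
  also have "\<dots> = 4 powr (N / 2 - 1)"
    using powr_minus_divide[of 4 "1 - N / 2"] by (simp add: powr_divide)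
  finally have "(s / e\<^sup>2) powr (1 - N / 2) * bump (s / e\<^sup>2) \<le> 4 powr (N / 2 - 1) * 1"
    using bump_le bump_nonneg by (intro mult_mono) auto
  then have "e powr - N * (4 * ((s / e\<^sup>2) powr (1 - N / 2) * bump (s / e\<^sup>2))) \<le> e powr - N * (4 * (4 powr (N / 2 - 1) * 1))"
    by (intro mult_left_mono) auto
  then show ?thesis by (simp add: mollifier_def mult_ac)
qed simp

text \<open>
  In this form the dependence on \<open>e\<close> sits in one monotone function of \<open>s / e\<^sup>2\<close>.
\<close>
lemma green_eq:
  assumes "e > 0" "s > 0"
  shows "green e s = s powr (1 - N / 2) * ((s / e\<^sup>2) powr (N / 2 - 1) * profile (s / e\<^sup>2))"
proof -
  have "s powr (1 - N / 2) * (s / e\<^sup>2) powr (N / 2 - 1) = (e powr 2) powr (1 - N / 2)"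
    using assms by (simp add: powr_divide powr_diff powr_minus field_simps powr_add[symmetric] powr_numeral[symmetric] del: powr_numeral)
  also have "\<dots> = e powr (2 - N)" by (simp add: powr_powr)
  finally show ?thesis by (simp add: green_def)
qed

lemma green_antimono:
  assumes "0 < e" "e \<le> r" "s > 0"
  shows "green r s \<le> green e s"
proof -
  have "s / r\<^sup>2 \<le> s / e\<^sup>2" using assms by (intro divide_left_mono power_mono) auto
  then have "(s / r\<^sup>2) powr (N / 2 - 1) * profile (s / r\<^sup>2) \<le> (s / e\<^sup>2) powr (N / 2 - 1) * profile (s / e\<^sup>2)"
    using assms by (intro profile_scaled_mono) auto
  then show ?thesis using assms by (simp add: green_eq mult_left_mono)
qed

lemma green_antimono_0:
  assumes "0 < e" "e \<le> r"
  shows "green r 0 \<le> green e 0"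
  using assms N mass_pos profile_outside[of 1] profile_antimono[of 0 1]
  by (auto simp: green_def intro!: mult_right_mono powr_mono2')

lemma green_outside:
  assumes "e > 0" "s \<ge> e\<^sup>2"
  shows "green e s = mass * s powr (1 - N / 2)"
proof -
  have s: "s > 0" using assms by (smt (verit) zero_less_power)
  have "s / e\<^sup>2 \<ge> 1" using assms by simp
  from profile_outside[OF this] have "(s / e\<^sup>2) powr (N / 2 - 1) * profile (s / e\<^sup>2) = mass * ((s / e\<^sup>2) powr (N / 2 - 1) * (s / e\<^sup>2) powr (1 - N / 2))"
    by simp
  also have "(s / e\<^sup>2) powr (N / 2 - 1) * (s / e\<^sup>2) powr (1 - N / 2) = 1"
    using s assms by (simp add: powr_add[symmetric])
  finally show ?thesis using green_eq[OF assms(1) s] by simp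
qed

lemma green_nonneg: "e > 0 \<Longrightarrow> s \<ge> 0 \<Longrightarrow> green e s \<ge> 0"
  using profile_nonneg[of "s / e\<^sup>2"] profile_antimono[of 0 1] profile_outside[of 1] mass_pos
  by (cases "s = 0") (auto simp: green_def)

lemma green_le: "e > 0 \<Longrightarrow> s \<ge> 0 \<Longrightarrow> green e s \<le> e powr (2 - N) * profile 0"
  unfolding green_def by (intro mult_left_mono profile_antimono) auto

lemma smooth_green: "smooth (green e)"
  using smooth_affine[OF smooth_profile, of "1 / e\<^sup>2" 0 "e powr (2 - N)"]
  by (simp add: green_def[abs_def] mult.commute)

definition green' :: "real \<Rightarrow> real \<Rightarrow> real" where
  "green' e s = e powr (2 - N) / e\<^sup>2 * - (step (s / e\<^sup>2) * (s / e\<^sup>2) powr (- N / 2))"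

definition green'' :: "real \<Rightarrow> real \<Rightarrow> real" where
  "green'' e s = e powr (2 - N) / e\<^sup>2 / e\<^sup>2 * - (bump (s / e\<^sup>2) * (s / e\<^sup>2) powr (- N / 2)
      + - N / 2 * step (s / e\<^sup>2) * (s / e\<^sup>2) powr (- N / 2 - 1))"

lemma green_has_derivative: "(green e has_real_derivative green' e s) (at s)"
proof -
  have "((\<lambda>s. e powr (2 - N) * profile (s / e\<^sup>2)) has_real_derivative
      e powr (2 - N) * (- (step (s / e\<^sup>2) * (s / e\<^sup>2) powr (- N / 2)) * (1 / e\<^sup>2))) (at s)"
    by (intro DERIV_cmult DERIV_chain2[OF profile_has_derivative] DERIV_cdivide DERIV_ident)
  then show ?thesis by (simp add: green_def[abs_def] green'_def)
qed

lemma green'_has_derivative: "(green' e has_real_derivative green'' e s) (at s)"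
proof -
  have "((\<lambda>s. e powr (2 - N) / e\<^sup>2 * - (step (s / e\<^sup>2) * (s / e\<^sup>2) powr (- N / 2))) has_real_derivative
      e powr (2 - N) / e\<^sup>2 * - ((bump (s / e\<^sup>2) * (s / e\<^sup>2) powr (- N / 2)
      + - N / 2 * step (s / e\<^sup>2) * (s / e\<^sup>2) powr (- N / 2 - 1)) * (1 / e\<^sup>2))) (at s)"
    by (intro DERIV_cmult DERIV_minus DERIV_chain2[OF step_powr_has_derivative] DERIV_cdivide DERIV_ident)
  moreover have "c * - (a * (1 / d)) = c / d * - a" for a c d :: real by simp
  ultimately show ?thesis unfolding green'_def[abs_def] green''_def by (simp only:)
qed

lemma green_laplacian:
  assumes "e > 0" "s \<ge> 0"
  shows "4 * s * green'' e s + 2 * N * green' e s = - mollifier e s"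
proof (cases "s = 0")
  case True
  then show ?thesis using step_zero[of 0] bump_zero[of 0] by (simp add: green'_def mollifier_def)
next
  case False
  define t where "t = s / e\<^sup>2"
  have t: "t > 0" "s = t * e\<^sup>2" using assms False by (auto simp: t_def)
  have e: "e powr (2 - N) = e powr - N * e\<^sup>2" using assms by (simp add: powr_diff powr_minus divide_inverse)
  have p1: "t powr (- N / 2) = t powr (- N / 2 - 1) * t" using t by (simp add: powr_diff)
  have p2: "t powr (1 - N / 2) = t powr (- N / 2 - 1) * t * t"
  proof -
    have "t * t = t powr 2" using t by (simp add: powr_numeral power2_eq_square)
    then have "t powr (- N / 2 - 1) * t * t = t powr (- N / 2 - 1) * t powr 2" by (simp add: mult.assoc)
    then show ?thesis by (simp add: powr_add[symmetric])
  qed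
  have "4 * s * green'' e s + 2 * N * green' e s = e powr - N *
     (4 * t * - (bump t * t powr (- N / 2) + - N / 2 * step t * t powr (- N / 2 - 1)) + 2 * N * - (step t * t powr (- N / 2)))"
    using assms unfolding green''_def green'_def t_def[symmetric] e t(2) by (simp add: field_simps)
  also have "\<dots> = - mollifier e s"
    unfolding mollifier_def t_def[symmetric] p1 p2 by (simp add: algebra_simps)
  finally show ?thesis .
qed

end

section \<open>Means of a weak solution\<close>

lemma nn_integral_ball_norm_powr_finite:
  fixes b r :: real
  assumes "b > - real DIM('a)" "r > 0"
  shows "(\<integral>\<^sup>+(z::'a::euclidean_space). ennreal (norm z powr b) * indicator {z. norm z < r} z \<partial>lborel) < \<infinity>"
  unfolding nn_integral_ball_norm_powr_scale[OF assms(2)]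
  using nn_integral_unit_ball_norm_powr_finite[OF assms(1)] by (simp add: ennreal_mult_less_top)

text \<open>
  The equation tested with functions that are radial around some point only, with both derivatives moved to the test function.
  Boundedness is essential boundedness, as weak solutions provide it; everywhere defined values are recovered
  later from the potential.
\<close>
locale henon_distributional =
  fixes \<alpha> p :: real and u :: "real ^ 'n \<Rightarrow> real"
  assumes dim: "CARD('n) \<ge> 3" and \<alpha>: "\<alpha> > -2" and p: "p > 1"
    and u_measurable [measurable]: "u \<in> borel_measurable borel"
    and u_pos: "\<And>x. u x > 0"
    and u_locally_bounded: "\<And>r. \<exists>M. AE x in lborel. norm x \<le> r \<longrightarrow> u x \<le> M"
    and weak_eq: "\<And>G G' G'' a R. smooth G \<Longrightarrow> (\<And>s. (G has_real_derivative G' s) (at s)) \<Longrightarrow>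
      (\<And>s. (G' has_real_derivative G'' s) (at s)) \<Longrightarrow> R > 0 \<Longrightarrow> (\<And>s. s \<ge> R\<^sup>2 \<Longrightarrow> G s = 0) \<Longrightarrow>
      (\<integral>x. norm x powr \<alpha> * u x powr p * G ((x - a) \<bullet> (x - a)) \<partial>lborel) =
      - (\<integral>x. u x * (4 * ((x - a) \<bullet> (x - a)) * G'' ((x - a) \<bullet> (x - a))
          + 2 * real CARD('n) * G' ((x - a) \<bullet> (x - a))) \<partial>lborel)"

sublocale henon_distributional \<subseteq> newtonian_profile "real CARD('n)"
  by unfold_locales (use dim in simp)

context henon_distributional
begin

definition f :: "real ^ 'n \<Rightarrow> real" where "f y = norm y powr \<alpha> * u y powr p"

lemma f_measurable [measurable]: "f \<in> borel_measurable borel" unfolding f_def[abs_def] by measurable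

lemma f_nonneg: "f y \<ge> 0" by (simp add: f_def)

lemma u_bound: "\<exists>M>0. AE x in lborel. norm x \<le> r \<longrightarrow> u x \<le> M"
proof -
  obtain M where "AE x in lborel. norm x \<le> r \<longrightarrow> u x \<le> M" using u_locally_bounded by blast
  then have "AE x in lborel. norm x \<le> r \<longrightarrow> u x \<le> max M 1" by eventually_elim auto
  then show ?thesis by (intro exI[of _ "max M 1"]) auto
qed

definition sqdist :: "real ^ 'n \<Rightarrow> real ^ 'n \<Rightarrow> real" where
  "sqdist x y = (y - x) \<bullet> (y - x)"

lemma sqdist_nonneg: "sqdist x y \<ge> 0" by (simp add: sqdist_def)

lemma sqdist_norm: "sqdist x y = (norm (y - x))\<^sup>2" by (simp add: sqdist_def power2_norm_eq_inner)

lemma sqdist_measurable [measurable]: "(\<lambda>(x, y). sqdist x y) \<in> borel_measurable (borel \<Otimes>\<^sub>M borel)"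
  unfolding sqdist_def by measurable

lemma sqdist_measurable' [measurable]: "sqdist x \<in> borel_measurable borel"
  unfolding sqdist_def by measurable

lemma green_measurable [measurable]: "green e \<in> borel_measurable borel"
  by (rule borel_measurable_continuous_onI[OF smooth_continuous[OF smooth_green]])

lemma mollifier_measurable [measurable]: "mollifier e \<in> borel_measurable borel"
proof -
  have [measurable]: "bump \<in> borel_measurable borel"
    by (rule borel_measurable_continuous_onI[OF smooth_continuous[OF smooth_bump]])
  show ?thesis unfolding mollifier_def[abs_def] by measurable
qed

text \<open>
  A weighted mean of \<open>u\<close> over the shell between \<open>e / 2\<close> and \<open>e\<close> around \<open>x\<close>, with weights that
  add up to \<open>total\<close>.
\<close>
definition average :: "real \<Rightarrow> real ^ 'n \<Rightarrow> ennreal" where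
  "average e x = (\<integral>\<^sup>+y. ennreal (u y * mollifier e (sqdist x y)) \<partial>lborel)"

definition total :: ennreal where
  "total = (\<integral>\<^sup>+(z :: real ^ 'n). ennreal (mollifier 1 (z \<bullet> z)) \<partial>lborel)"

lemma mollifier_far: "e > 0 \<Longrightarrow> mollifier e (sqdist x y) \<noteq> 0 \<Longrightarrow> e / 2 < norm (y - x) \<and> norm (y - x) < e"
proof -
  assume e: "e > 0" "mollifier e (sqdist x y) \<noteq> 0"
  from mollifier_support[OF this] have *: "(e / 2)\<^sup>2 < (norm (y - x))\<^sup>2" "(norm (y - x))\<^sup>2 < e\<^sup>2"
    by (auto simp: sqdist_norm power_divide)
  show ?thesis
    using power2_less_imp_less[OF *(1)] power2_less_imp_less[OF *(2)] e by simp
qed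

lemma total_finite: "total < \<infinity>"
proof -
  define B where "B = 4 * 4 powr (real CARD('n) / 2 - 1) * 1 powr - real CARD('n)"
  have "total \<le> (\<integral>\<^sup>+z. ennreal B * indicator (ball (0 :: real ^ 'n) 1) z \<partial>lborel)"
    unfolding total_def
  proof (intro nn_integral_mono)
    fix z :: "real ^ 'n"
    show "ennreal (mollifier 1 (z \<bullet> z)) \<le> ennreal B * indicator (ball 0 1) z"
      using mollifier_le[of 1 "z \<bullet> z"] mollifier_far[of 1 0 z]
      by (cases "mollifier 1 (z \<bullet> z) = 0") (auto simp: B_def sqdist_def intro!: ennreal_leI)
  qed
  also have "\<dots> = ennreal B * emeasure lborel (ball (0 :: real ^ 'n) 1)" by (rule nn_integral_cmult_indicator) auto
  also have "\<dots> < \<infinity>" using emeasure_lborel_ball_finite[of "0 :: real ^ 'n" 1] by (simp add: ennreal_mult_less_top)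
  finally show ?thesis .
qed

lemma nn_integral_mollifier:
  assumes "e > 0"
  shows "(\<integral>\<^sup>+y. ennreal (mollifier e (sqdist x y)) \<partial>lborel) = total"
proof -
  have "(\<integral>\<^sup>+y. ennreal (mollifier e (sqdist x y)) \<partial>lborel) =
    ennreal (e ^ CARD('n)) * (\<integral>\<^sup>+z. ennreal (mollifier e (sqdist x (x + e *\<^sub>R z))) \<partial>lborel)"
    using assms by (subst nn_integral_lborel_affine[where c = e and t = x]) auto
  also have "\<dots> = (\<integral>\<^sup>+z. ennreal (e ^ CARD('n)) * ennreal (mollifier e (sqdist x (x + e *\<^sub>R z))) \<partial>lborel)"
    by (rule nn_integral_cmult[symmetric]) measurable
  also have "\<dots> = total"
    unfolding total_def
  proof (intro nn_integral_cong)
    fix z :: "real ^ 'n"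
    have "sqdist x (x + e *\<^sub>R z) / e\<^sup>2 = z \<bullet> z" using assms by (simp add: sqdist_def power2_eq_square)
    then have "e ^ CARD('n) * mollifier e (sqdist x (x + e *\<^sub>R z)) = (e ^ CARD('n) * e powr - real CARD('n)) * mollifier 1 (z \<bullet> z)"
      by (simp add: mollifier_def)
    also have "e ^ CARD('n) * e powr - real CARD('n) = 1"
      using assms by (simp add: powr_minus powr_realpow)
    finally show "ennreal (e ^ CARD('n)) * ennreal (mollifier e (sqdist x (x + e *\<^sub>R z))) = ennreal (mollifier 1 (z \<bullet> z))"
      using assms by (simp add: ennreal_mult[symmetric] mollifier_nonneg)
  qed
  finally show ?thesis .
qed

lemma total_pos: "total > 0"
proof -
  obtain v :: "real ^ 'n" where v: "norm v = 3 / 4" using vector_choose_size[of "3 / 4"] by auto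
  let ?A = "{z :: real ^ 'n. 1 / 2 < norm z \<and> norm z < 1}"
  have "total \<noteq> 0"
  proof
    assume "total = 0"
    then have ae: "AE z in lborel. ennreal (mollifier 1 ((z :: real ^ 'n) \<bullet> z)) = 0"
      unfolding total_def by (subst (asm) nn_integral_0_iff_AE) auto
    have pos: "mollifier 1 (z \<bullet> z) > 0" if "z \<in> ?A" for z :: "real ^ 'n"
    proof -
      have "(1 / 2)\<^sup>2 < (norm z)\<^sup>2" "(norm z)\<^sup>2 < 1\<^sup>2" using that by (intro power_strict_mono; simp)+
      then have "1 / 4 < z \<bullet> z" "z \<bullet> z < 1" by (auto simp: power2_norm_eq_inner power_divide)
      then show ?thesis using bump_pos[of "z \<bullet> z"] by (auto simp: mollifier_def intro!: mult_pos_pos)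
    qed
    from ae have "AE z in lborel. z \<notin> ?A"
    proof eventually_elim
      case (elim z)
      show ?case
      proof
        assume "z \<in> ?A"
        from pos[OF this] elim show False by (simp add: ennreal_eq_0_iff)
      qed
    qed
    moreover have "open ?A" by (intro open_Collect_conj open_Collect_less continuous_intros)
    ultimately have "?A = {}" by (rule AE_avoids_open_imp_empty)
    moreover have "v \<in> ?A" using v by simp
    ultimately show False by blast
  qed
  then show ?thesis by (simp add: zero_less_iff_neq_zero)
qed

lemma average_le:
  assumes e: "0 < e" and M: "AE y in lborel. norm (y - x) \<le> e \<longrightarrow> u y \<le> M"
  shows "average e x \<le> ennreal M * total"
proof -
  have "average e x \<le> (\<integral>\<^sup>+y. ennreal M * ennreal (mollifier e (sqdist x y)) \<partial>lborel)"
    unfolding average_def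
  proof (rule nn_integral_mono_AE)
    show "AE y in lborel. ennreal (u y * mollifier e (sqdist x y)) \<le> ennreal M * ennreal (mollifier e (sqdist x y))"
      using M
    proof eventually_elim
      case (elim y)
      show ?case
      proof (cases "mollifier e (sqdist x y) = 0")
        case False
        then have "u y \<le> M" using mollifier_far[OF e False] elim by simp
        then show ?thesis
          using u_pos[of y] mollifier_nonneg[of e] by (simp add: ennreal_mult[symmetric] ennreal_leI mult_right_mono)
      qed simp
    qed
  qed
  also have "\<dots> = ennreal M * total"
    by (subst nn_integral_cmult) (auto simp: nn_integral_mollifier[OF e])
  finally show ?thesis .
qed

lemma average_finite: "e > 0 \<Longrightarrow> average e x < \<infinity>"
proof -
  assume e: "e > 0"
  obtain M where M: "M > 0" "AE y in lborel. norm y \<le> norm x + e \<longrightarrow> u y \<le> M" using u_bound by blast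
  from M(2) have "AE y in lborel. norm (y - x) \<le> e \<longrightarrow> u y \<le> M"
  proof eventually_elim
    case (elim y)
    then show ?case using norm_triangle_sub[of y x] by auto
  qed
  from average_le[OF e this] show ?thesis
    using total_finite by (auto intro: order_le_less_trans simp: ennreal_mult_less_top)
qed

lemma f_locally_integrable:
  assumes "r > 0"
  shows "(\<integral>\<^sup>+y. ennreal (f y) * indicator {y. norm y < r} y \<partial>lborel) < \<infinity>"
proof -
  obtain M where M: "M > 0" "AE y in lborel. norm y \<le> r \<longrightarrow> u y \<le> M" using u_bound by blast
  have "(\<integral>\<^sup>+y. ennreal (f y) * indicator {y. norm y < r} y \<partial>lborel) \<le>
    (\<integral>\<^sup>+(y :: real ^ 'n). ennreal (M powr p) * (ennreal (norm y powr \<alpha>) * indicator {y. norm y < r} y) \<partial>lborel)"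
  proof (rule nn_integral_mono_AE)
    show "AE y in lborel. ennreal (f y) * indicator {y. norm y < r} y \<le>
      ennreal (M powr p) * (ennreal (norm y powr \<alpha>) * indicator {y. norm y < r} y)"
      using M(2)
    proof eventually_elim
      case (elim y)
      have "f y \<le> M powr p * norm y powr \<alpha>" if "norm y < r"
        unfolding f_def using elim that u_pos[of y] p by (subst mult.commute) (intro mult_right_mono powr_mono2, auto)
      then show ?case by (auto simp: indicator_def ennreal_mult[symmetric] intro!: ennreal_leI)
    qed
  qed
  also have "\<dots> = ennreal (M powr p) * (\<integral>\<^sup>+(y :: real ^ 'n). ennreal (norm y powr \<alpha>) * indicator {y. norm y < r} y \<partial>lborel)"
    by (rule nn_integral_cmult) measurable
  also have "\<dots> < \<infinity>"
    using nn_integral_ball_norm_powr_finite[of \<alpha> r, where 'a = "real ^ 'n"] assms \<alpha> dim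
    by (simp add: ennreal_mult_less_top)
  finally show ?thesis .
qed

abbreviation green_gap :: "real \<Rightarrow> real \<Rightarrow> real ^ 'n \<Rightarrow> ennreal" where
  "green_gap e R x \<equiv> (\<integral>\<^sup>+y. ennreal (f y * (green e (sqdist x y) - green R (sqdist x y))) \<partial>lborel)"

text \<open>
  The weak equation for the test function \<open>green e - green R\<close>. Its Laplacian is the difference of the two
  mollifiers, so this is the mean value formula between the scales \<open>e\<close> and \<open>R\<close>.
\<close>
lemma green_difference:
  assumes e: "0 < e" and R: "e < R"
  shows "average e x = average R x + green_gap e R x"
proof -
  let ?S = "sqdist x"
  define G where "G s = green e s - green R s" for s
  have R0: "R > 0" using e R by simp
  have G0: "G s = 0" if "s \<ge> R\<^sup>2" for s
  proof -
    have "e\<^sup>2 \<le> R\<^sup>2" using e R by (intro power_mono) auto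
    then show ?thesis unfolding G_def using green_outside[OF e, of s] green_outside[OF R0 that] that by simp
  qed
  have Gnonneg: "G s \<ge> 0" if "s \<ge> 0" for s
    using green_antimono[OF e less_imp_le[OF R], of s] green_antimono_0[OF e less_imp_le[OF R]] that
    by (cases "s = 0") (auto simp: G_def)
  have Gle: "G s \<le> e powr (2 - real CARD('n)) * profile 0" if "s \<ge> 0" for s
    using green_le[OF e that] green_nonneg[OF R0 that] by (simp add: G_def)
  have smoothG: "smooth G"
    unfolding G_def using smooth_add[OF smooth_green[of e] smooth_affine[OF smooth_green[of R], of 1 0 "-1"]] by simp
  have "(\<integral>y. norm y powr \<alpha> * u y powr p * G ((y - x) \<bullet> (y - x)) \<partial>lborel) =
      - (\<integral>y. u y * (4 * ((y - x) \<bullet> (y - x)) * (green'' e ((y - x) \<bullet> (y - x)) - green'' R ((y - x) \<bullet> (y - x)))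
          + 2 * real CARD('n) * (green' e ((y - x) \<bullet> (y - x)) - green' R ((y - x) \<bullet> (y - x)))) \<partial>lborel)"
    by (rule weak_eq[OF smoothG _ _ R0 G0])
       (unfold G_def, auto intro!: DERIV_diff green_has_derivative green'_has_derivative)
  also have "\<dots> = - (\<integral>y. u y * mollifier R (?S y) - u y * mollifier e (?S y) \<partial>lborel)"
  proof (intro arg_cong[where f = uminus] Bochner_Integration.integral_cong refl)
    fix y
    have "4 * ?S y * green'' e (?S y) + 2 * real CARD('n) * green' e (?S y) = - mollifier e (?S y)"
      "4 * ?S y * green'' R (?S y) + 2 * real CARD('n) * green' R (?S y) = - mollifier R (?S y)"
      using green_laplacian[OF e sqdist_nonneg] green_laplacian[OF R0 sqdist_nonneg] by blast+
    then have eq: "4 * ?S y * (green'' e (?S y) - green'' R (?S y)) + 2 * real CARD('n) * (green' e (?S y) - green' R (?S y))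
      = mollifier R (?S y) - mollifier e (?S y)" by (simp add: algebra_simps)
    show "u y * (4 * ((y - x) \<bullet> (y - x)) * (green'' e ((y - x) \<bullet> (y - x)) - green'' R ((y - x) \<bullet> (y - x)))
          + 2 * real CARD('n) * (green' e ((y - x) \<bullet> (y - x)) - green' R ((y - x) \<bullet> (y - x))))
      = u y * mollifier R (?S y) - u y * mollifier e (?S y)"
      unfolding sqdist_def[symmetric] eq by (rule right_diff_distrib)
  qed
  finally have main: "(\<integral>y. f y * G (?S y) \<partial>lborel) = - (\<integral>y. u y * mollifier R (?S y) - u y * mollifier e (?S y) \<partial>lborel)"
    by (simp add: f_def sqdist_def)
  have hb: "has_bochner_integral lborel (\<lambda>y. u y * mollifier r (?S y)) (enn2real (average r x))" if "r > 0" for r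
    unfolding average_def
    using average_finite[OF that, of x] u_pos mollifier_nonneg
    by (intro has_bochner_integral_nn_integral) (auto simp: average_def less_imp_le intro!: mult_nonneg_nonneg)
  have nnfin: "(\<integral>\<^sup>+y. ennreal (f y * G (?S y)) \<partial>lborel) < \<infinity>"
  proof -
    define K where "K = e powr (2 - real CARD('n)) * profile 0"
    have K: "K \<ge> 0" using Gnonneg[of 0] Gle[of 0] by (simp add: K_def)
    have "(\<integral>\<^sup>+y. ennreal (f y * G (?S y)) \<partial>lborel) \<le>
      (\<integral>\<^sup>+y. ennreal K * (ennreal (f y) * indicator {y. norm y < norm x + R} y) \<partial>lborel)"
    proof (intro nn_integral_mono)
      fix y
      show "ennreal (f y * G (?S y)) \<le> ennreal K * (ennreal (f y) * indicator {y. norm y < norm x + R} y)"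
      proof (cases "norm y < norm x + R")
        case True
        have "f y * G (?S y) \<le> f y * K"
          using mult_left_mono[OF Gle[OF sqdist_nonneg[of x y]] f_nonneg[of y]] unfolding K_def .
        then show ?thesis
          using K True by (simp add: ennreal_mult[symmetric] f_nonneg ennreal_leI mult.commute[of K])
      next
        case False
        then have "R \<le> norm (y - x)" using norm_triangle_sub[of y x] by simp
        then have "R\<^sup>2 \<le> ?S y" using R0 by (auto simp: sqdist_norm intro: power_mono)
        then show ?thesis by (simp add: G0)
      qed
    qed
    also have "\<dots> = ennreal K * (\<integral>\<^sup>+y. ennreal (f y) * indicator {y. norm y < norm x + R} y \<partial>lborel)"
      by (rule nn_integral_cmult) measurable
    also have "\<dots> < \<infinity>"
      using f_locally_integrable[of "norm x + R"] R0 by (simp add: ennreal_mult_less_top add_nonneg_pos)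
    finally show ?thesis .
  qed
  have [measurable]: "G \<in> borel_measurable borel"
    by (rule borel_measurable_continuous_onI[OF smooth_continuous[OF smoothG]])
  have "(\<integral>\<^sup>+y. ennreal (f y * G (?S y)) \<partial>lborel) = ennreal (\<integral>y. f y * G (?S y) \<partial>lborel)"
    using nnfin by (intro nn_integral_eq_integral integrableI_nonneg)
      (auto intro!: mult_nonneg_nonneg f_nonneg Gnonneg sqdist_nonneg)
  also have "(\<integral>y. f y * G (?S y) \<partial>lborel) = enn2real (average e x) - enn2real (average R x)"
    unfolding main using has_bochner_integral_diff[OF hb[OF R0] hb[OF e]] by (simp add: has_bochner_integral_iff)
  finally have nn: "(\<integral>\<^sup>+y. ennreal (f y * G (?S y)) \<partial>lborel) = ennreal (enn2real (average e x) - enn2real (average R x))" .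
  have "0 \<le> (\<integral>y. f y * G (?S y) \<partial>lborel)"
    by (intro integral_nonneg_AE AE_I2 mult_nonneg_nonneg f_nonneg Gnonneg sqdist_nonneg)
  then have le: "0 \<le> enn2real (average e x) - enn2real (average R x)"
    unfolding main using has_bochner_integral_diff[OF hb[OF R0] hb[OF e]] by (simp add: has_bochner_integral_iff)
  have fin: "ennreal (enn2real (average r x)) = average r x" if "r > 0" for r
    using average_finite[OF that, of x] by (simp add: ennreal_enn2real)
  have "average R x + (\<integral>\<^sup>+y. ennreal (f y * G (?S y)) \<partial>lborel)
    = ennreal (enn2real (average R x)) + ennreal (enn2real (average e x) - enn2real (average R x))"
    unfolding nn fin[OF R0] ..
  also have "\<dots> = ennreal (enn2real (average e x))"
    using le by (subst ennreal_plus[symmetric]) auto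
  finally show ?thesis unfolding fin[OF e] by (simp add: G_def)
qed

end

section \<open>The Newtonian potential as the limit of the means\<close>

context henon_distributional
begin

definition potential :: "real \<Rightarrow> real ^ 'n \<Rightarrow> ennreal" where
  "potential e x = (\<integral>\<^sup>+y. ennreal (f y * green e (sqdist x y)) \<partial>lborel)"

lemma green_difference_tendsto:
  assumes "e > 0"
  shows "(\<lambda>k. \<integral>\<^sup>+y. ennreal (f y * (green e (sqdist x y) - green (e + real (Suc k)) (sqdist x y))) \<partial>lborel)
    \<longlonglongrightarrow> potential e x"
  unfolding potential_def
proof (rule nn_integral_LIMSEQ)
  have mono: "green (e + real (Suc k')) s \<le> green (e + real (Suc k)) s" if "k \<le> k'" "s \<ge> 0" for k k' s
    using that assms green_antimono[of "e + real (Suc k)" "e + real (Suc k')" s] green_antimono_0[of "e + real (Suc k)" "e + real (Suc k')"]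
    by (cases "s = 0") auto
  show "incseq (\<lambda>k y. ennreal (f y * (green e (sqdist x y) - green (e + real (Suc k)) (sqdist x y))))"
    using mono sqdist_nonneg f_nonneg
    by (auto simp: incseq_def le_fun_def simp del: of_nat_Suc intro!: ennreal_leI mult_left_mono)
  fix y
  have lim: "(\<lambda>k. (e + real (Suc k)) powr (2 - real CARD('n)) * profile 0) \<longlonglongrightarrow> 0"
    using dim by (intro tendsto_mult_left_zero tendsto_neg_powr filterlim_tendsto_add_at_top[OF tendsto_const]
        filterlim_compose[OF filterlim_real_sequentially filterlim_Suc]) auto
  have "(\<lambda>k. green (e + real (Suc k)) (sqdist x y)) \<longlonglongrightarrow> 0"
    by (rule real_tendsto_sandwich[OF _ _ tendsto_const lim])
       (use assms sqdist_nonneg in \<open>auto intro!: always_eventually green_nonneg green_le simp del: of_nat_Suc\<close>)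
  then have "(\<lambda>k. f y * (green e (sqdist x y) - green (e + real (Suc k)) (sqdist x y))) \<longlonglongrightarrow> f y * (green e (sqdist x y) - 0)"
    by (intro tendsto_intros)
  then show "(\<lambda>k. ennreal (f y * (green e (sqdist x y) - green (e + real (Suc k)) (sqdist x y)))) \<longlonglongrightarrow> ennreal (f y * green e (sqdist x y))"
    by (intro tendsto_ennrealI) simp
qed measurable

lemma potential_le_average:
  assumes "e > 0"
  shows "potential e x \<le> average e x"
proof (rule LIMSEQ_le_const2[OF green_difference_tendsto[OF assms]])
  show "\<exists>N. \<forall>k\<ge>N. green_gap e (e + real (Suc k)) x \<le> average e x"
  proof (intro exI[of _ 0] allI impI)
    fix k
    have eq: "average e x = average (e + real (Suc k)) x +
      green_gap e (e + real (Suc k)) x"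
      by (rule green_difference[OF assms]) simp
    show "green_gap e (e + real (Suc k)) x \<le> average e x"
      unfolding eq by simp
  qed
qed

lemma powr_between:
  fixes a b c t :: real
  assumes "0 < a" "a \<le> t" "t \<le> b"
  shows "min (a powr c) (b powr c) \<le> t powr c"
proof (cases "c \<ge> 0")
  case True
  then have "a powr c \<le> t powr c" using assms by (intro powr_mono2) auto
  then show ?thesis by simp
next
  case False
  then have "b powr c \<le> t powr c" using assms by (intro powr_mono2') auto
  then show ?thesis by simp
qed

text \<open>
  Everywhere \<open>u \<le> \<eta> + \<eta> powr (1 - p) * u powr p\<close>, as the second summand exceeds \<open>u\<close> where \<open>u > \<eta>\<close>. On the support of the mollifier
  \<open>norm y\<close> and \<open>norm (y - x)\<close> are comparable with \<open>R\<close>, so \<open>u powr p\<close> can be replaced by \<open>f\<close> and the mollifier by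
  \<open>green 1\<close>, at the price of the power \<open>R powr (- 2 - \<alpha>)\<close>.
\<close>
lemma mollified_u_le:
  "\<exists>K\<ge>0. \<forall>x y R \<eta>. R \<ge> 2 \<longrightarrow> R \<ge> 4 * norm x \<longrightarrow> \<eta> > 0 \<longrightarrow>
    u y * mollifier R (sqdist x y) \<le> \<eta> * mollifier R (sqdist x y)
      + K * (\<eta> powr (1 - p) * R powr (- 2 - \<alpha>)) * (f y * green 1 (sqdist x y))"
proof -
  define N where "N = real CARD('n)"
  define B where "B = 4 * 4 powr (N / 2 - 1)"
  define a where "a = min ((1 / 4) powr \<alpha>) ((5 / 4) powr \<alpha>)"
  have a: "a > 0" by (simp add: a_def)
  define K where "K = B / (mass * a)"
  show ?thesis
  proof (intro exI[of _ K] conjI allI impI)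
    show "0 \<le> K" using a mass_pos by (simp add: K_def B_def)
    fix x y :: "real ^ 'n" and R \<eta> :: real assume R: "R \<ge> 2" "R \<ge> 4 * norm x" and \<eta>: "\<eta> > 0"
    let ?s = "sqdist x y"
    have rhs: "0 \<le> K * (\<eta> powr (1 - p) * R powr (- 2 - \<alpha>)) * (f y * green 1 ?s)"
      using \<open>0 \<le> K\<close> f_nonneg green_nonneg[of 1 ?s] sqdist_nonneg by (auto intro!: mult_nonneg_nonneg)
    show "u y * mollifier R ?s \<le> \<eta> * mollifier R ?s + K * (\<eta> powr (1 - p) * R powr (- 2 - \<alpha>)) * (f y * green 1 ?s)"
    proof (cases "mollifier R ?s = 0 \<or> u y \<le> \<eta>")
      case True
      then have "u y * mollifier R ?s \<le> \<eta> * mollifier R ?s" using mollifier_nonneg[of R ?s] by (auto intro: mult_right_mono)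
      with rhs show ?thesis by simp
    next
      case False
      then have u\<eta>: "u y > \<eta>" and mo: "mollifier R ?s \<noteq> 0" by auto
      have dist: "R / 2 < norm (y - x)" "norm (y - x) < R" using mollifier_far[OF _ mo] R by auto
      have "norm y \<le> norm x + norm (y - x)" "norm (y - x) \<le> norm x + norm y"
        using norm_triangle_sub[of y x] norm_triangle_ineq4[of y x] by (auto simp: add.commute)
      then have y: "1 / 4 * R \<le> norm y" "norm y \<le> 5 / 4 * R" using dist R by auto
      have "a * R powr \<alpha> = min ((1 / 4 * R) powr \<alpha>) ((5 / 4 * R) powr \<alpha>)"
        unfolding powr_mult a_def by (simp add: min_mult_distrib_right)
      also have "\<dots> \<le> norm y powr \<alpha>" using y R by (intro powr_between) auto
      finally have ya: "a * R powr \<alpha> \<le> norm y powr \<alpha>" .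
      have "(1 :: real)\<^sup>2 \<le> (norm (y - x))\<^sup>2" using dist R by (intro power_mono) auto
      then have "green 1 ?s = mass * ?s powr (1 - N / 2)"
        unfolding N_def by (intro green_outside) (auto simp: sqdist_norm)
      moreover have "(R\<^sup>2) powr (1 - N / 2) \<le> ?s powr (1 - N / 2)"
        using dist R dim by (intro powr_mono2') (auto simp: sqdist_norm N_def intro: power_mono)
      moreover have "(R\<^sup>2) powr (1 - N / 2) = R powr (2 - N)"
        using R by (simp add: powr_powr powr_numeral[symmetric] del: powr_numeral)
      ultimately have gr: "mass * R powr (2 - N) \<le> green 1 ?s" using mass_pos by simp
      have "u y = u y powr (1 - p) * u y powr p"
        using u_pos[of y] by (simp add: powr_add[symmetric])
      also have "\<dots> \<le> \<eta> powr (1 - p) * u y powr p"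
        using u\<eta> \<eta> p by (intro mult_right_mono powr_mono2') auto
      finally have u1: "u y \<le> \<eta> powr (1 - p) * u y powr p" .
      have "u y * mollifier R ?s \<le> (\<eta> powr (1 - p) * u y powr p) * (B * R powr - N)"
        using u1 mollifier_le[of R ?s] mollifier_nonneg[of R ?s] R
        by (intro mult_mono) (auto simp: B_def N_def)
      also have "\<dots> = K * (\<eta> powr (1 - p) * R powr (- 2 - \<alpha>)) * ((a * R powr \<alpha> * u y powr p) * (mass * R powr (2 - N)))"
      proof -
        have e1: "R powr (- 2 - \<alpha>) * R powr \<alpha> * R powr (2 - N) = R powr - N"
          by (simp add: powr_add[symmetric])
        have e2: "K * a * mass = B" using a mass_pos by (simp add: K_def)
        have "K * (\<eta> powr (1 - p) * R powr (- 2 - \<alpha>)) * ((a * R powr \<alpha> * u y powr p) * (mass * R powr (2 - N)))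
          = (\<eta> powr (1 - p) * u y powr p) * ((K * a * mass) * (R powr (- 2 - \<alpha>) * R powr \<alpha> * R powr (2 - N)))"
          by (simp only: mult_ac)
        then show ?thesis unfolding e1 e2 by (rule sym)
      qed
      also have "\<dots> \<le> K * (\<eta> powr (1 - p) * R powr (- 2 - \<alpha>)) * (f y * green 1 ?s)"
        unfolding f_def using \<open>0 \<le> K\<close> ya gr mass_pos a
        by (intro mult_left_mono mult_mono mult_right_mono) auto
      finally show ?thesis using \<eta> mollifier_nonneg[of R ?s] by (simp add: add_increasing)
    qed
  qed
qed

text \<open>
  Integrate \<open>mollified_u_le\<close> with \<open>\<eta> = R powr - \<sigma>\<close>, where \<open>\<sigma>\<close> is so small that half of the decay
  \<open>R powr - (2 + \<alpha>)\<close> survives. The potential on the right-hand side is finite by \<open>potential_le_average\<close>.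
\<close>
lemma average_tendsto_0: "(\<lambda>k. average (e + real (Suc k)) x) \<longlonglongrightarrow> 0"
proof -
  obtain K where K: "K \<ge> 0" "\<And>x y R \<eta>. R \<ge> 2 \<Longrightarrow> R \<ge> 4 * norm x \<Longrightarrow> \<eta> > 0 \<Longrightarrow>
    u y * mollifier R (sqdist x y) \<le> \<eta> * mollifier R (sqdist x y)
      + K * (\<eta> powr (1 - p) * R powr (- 2 - \<alpha>)) * (f y * green 1 (sqdist x y))"
    using mollified_u_le by blast
  define c where "c = enn2real total"
  have c: "total = ennreal c" "c \<ge> 0" using total_finite by (auto simp: c_def ennreal_enn2real)
  have "potential 1 x < \<infinity>"
    using potential_le_average[of 1 x] average_finite[of 1 x] by (auto intro: order_le_less_trans)
  then obtain F where F: "potential 1 x = ennreal F" "F \<ge> 0" by (cases "potential 1 x") auto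
  \<comment> \<open>The solution of \<open>\<sigma> * (p - 1) = (2 + \<alpha>) / 2\<close>.\<close>
  define \<sigma> where "\<sigma> = (2 + \<alpha>) / (2 * (p - 1))"
  have \<sigma>: "\<sigma> > 0" using \<alpha> p by (simp add: \<sigma>_def)
  have bound: "average R x \<le> ennreal (R powr - \<sigma> * c + K * R powr (- (2 + \<alpha>) / 2) * F)"
    if R: "R \<ge> 2" "R \<ge> 4 * norm x" for R
  proof -
    define \<eta> where "\<eta> = R powr - \<sigma>"
    have \<eta>: "\<eta> > 0" using R by (simp add: \<eta>_def)
    define L where "L = K * (\<eta> powr (1 - p) * R powr (- 2 - \<alpha>))"
    have L: "L \<ge> 0" using K by (simp add: L_def)
    have "average R x \<le> (\<integral>\<^sup>+y. ennreal \<eta> * ennreal (mollifier R (sqdist x y)) + ennreal L * ennreal (f y * green 1 (sqdist x y)) \<partial>lborel)"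
      unfolding average_def
    proof (intro nn_integral_mono)
      fix y
      have g: "green 1 (sqdist x y) \<ge> 0" by (rule green_nonneg) (auto simp: sqdist_nonneg)
      have "ennreal (u y * mollifier R (sqdist x y)) \<le> ennreal (\<eta> * mollifier R (sqdist x y) + L * (f y * green 1 (sqdist x y)))"
        unfolding L_def by (intro ennreal_leI K(2) R \<eta>)
      also have "\<dots> = ennreal \<eta> * ennreal (mollifier R (sqdist x y)) + ennreal L * ennreal (f y * green 1 (sqdist x y))"
        using \<eta> L g f_nonneg[of y] mollifier_nonneg[of R] by (simp add: ennreal_plus ennreal_mult[symmetric])
      finally show "ennreal (u y * mollifier R (sqdist x y)) \<le> \<dots>" .
    qed
    also have "\<dots> = (\<integral>\<^sup>+y. ennreal \<eta> * ennreal (mollifier R (sqdist x y)) \<partial>lborel) + (\<integral>\<^sup>+y. ennreal L * ennreal (f y * green 1 (sqdist x y)) \<partial>lborel)"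
      by (rule nn_integral_add) measurable
    also have "(\<integral>\<^sup>+y. ennreal \<eta> * ennreal (mollifier R (sqdist x y)) \<partial>lborel) = ennreal \<eta> * total"
      using R by (subst nn_integral_cmult) (auto simp: nn_integral_mollifier)
    also have "(\<integral>\<^sup>+y. ennreal L * ennreal (f y * green 1 (sqdist x y)) \<partial>lborel) = ennreal L * potential 1 x"
      unfolding potential_def by (rule nn_integral_cmult) measurable
    also have "ennreal \<eta> * total + ennreal L * potential 1 x = ennreal (\<eta> * c + L * F)"
      using \<eta> L c F by (simp add: ennreal_plus ennreal_mult)
    also have "L = K * R powr (- (2 + \<alpha>) / 2)"
    proof -
      have "- \<sigma> * (1 - p) + (- 2 - \<alpha>) = - (2 + \<alpha>) / 2" using p by (simp add: \<sigma>_def field_simps)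
      then show ?thesis unfolding L_def \<eta>_def powr_powr by (simp only: powr_add[symmetric])
    qed
    finally show ?thesis by (simp add: \<eta>_def)
  qed
  have top: "filterlim (\<lambda>k. e + real (Suc k)) at_top sequentially"
    by (intro filterlim_tendsto_add_at_top[OF tendsto_const]
        filterlim_compose[OF filterlim_real_sequentially filterlim_Suc])
  have "(\<lambda>k. (e + real (Suc k)) powr - \<sigma> * c + K * (e + real (Suc k)) powr (- (2 + \<alpha>) / 2) * F) \<longlonglongrightarrow> 0 * c + K * 0 * F"
    using \<sigma> \<alpha> by (intro tendsto_intros tendsto_neg_powr top) auto
  then have lim: "(\<lambda>k. ennreal ((e + real (Suc k)) powr - \<sigma> * c + K * (e + real (Suc k)) powr (- (2 + \<alpha>) / 2) * F)) \<longlonglongrightarrow> ennreal 0"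
    by (intro tendsto_ennrealI) simp
  have ev: "\<forall>\<^sub>F k in sequentially. average (e + real (Suc k)) x \<le>
      ennreal ((e + real (Suc k)) powr - \<sigma> * c + K * (e + real (Suc k)) powr (- (2 + \<alpha>) / 2) * F)"
    using filterlim_at_top[THEN iffD1, OF top, rule_format, of "max 2 (4 * norm x)"]
    by (rule eventually_mono) (rule bound, auto)
  show ?thesis
    by (rule tendsto_sandwich[OF _ ev tendsto_const]) (use lim in auto)
qed

text \<open>
  Let \<open>R\<close> tend to infinity in \<open>green_difference\<close>. No harmonic remainder is left since the means tend to \<open>0\<close>.
\<close>
lemma average_eq_potential:
  assumes "e > 0"
  shows "average e x = potential e x"
proof -
  have "(\<lambda>k. average (e + real (Suc k)) x +
      green_gap e (e + real (Suc k)) x) \<longlonglongrightarrow> 0 + potential e x"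
    by (intro tendsto_add average_tendsto_0 green_difference_tendsto assms)
  moreover have "average e x = average (e + real (Suc k)) x +
      green_gap e (e + real (Suc k)) x" for k
    by (rule green_difference[OF assms]) simp
  ultimately have "(\<lambda>k. average e x) \<longlonglongrightarrow> potential e x" by simp
  then show ?thesis by (rule LIMSEQ_unique[OF tendsto_const])
qed

definition newton :: "real ^ 'n \<Rightarrow> ennreal" where
  "newton x = (\<integral>\<^sup>+y. ennreal (f y * (mass * norm (x - y) powr - (real CARD('n) - 2))) \<partial>lborel)"

definition radius :: "nat \<Rightarrow> real" where "radius k = inverse (real (Suc k))"

lemma radius: "radius k > 0" "radius k \<le> 1" "radius \<longlonglongrightarrow> 0" "i \<le> k \<Longrightarrow> radius k \<le> radius i"
  using LIMSEQ_inverse_real_of_nat by (auto simp: radius_def[abs_def] inverse_le_1_iff intro: le_imp_inverse_le)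

lemma average_incseq: "incseq (\<lambda>k. average (radius k) x)"
  unfolding incseq_def
proof (intro allI impI)
  fix i k :: nat assume "i \<le> k"
  show "average (radius i) x \<le> average (radius k) x"
  proof (cases "radius k = radius i")
    case False
    then have "radius k < radius i" using radius(4)[OF \<open>i \<le> k\<close>] by simp
    from green_difference[OF radius(1) this, of x] show ?thesis by simp
  qed simp
qed

lemma average_tendsto_newton: "(\<lambda>k. average (radius k) x) \<longlonglongrightarrow> newton x"
proof -
  let ?g = "\<lambda>k y. ennreal (f y * green (radius k) (sqdist x y)) * indicator (- {x}) y"
  \<comment> \<open>The point \<open>x\<close> is removed because there the power with base \<open>0\<close> is \<open>0\<close> and not infinite.\<close>
  let ?w = "\<lambda>y. ennreal (f y * (mass * norm (x - y) powr - (real CARD('n) - 2))) * indicator (- {x}) y"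
  have AE_x: "AE y in lborel. y \<noteq> x" by (rule AE_lborel_singleton)
  have "(\<lambda>k. \<integral>\<^sup>+y. ?g k y \<partial>lborel) \<longlonglongrightarrow> (\<integral>\<^sup>+y. ?w y \<partial>lborel)"
  proof (rule nn_integral_LIMSEQ)
    show "incseq ?g"
    proof (intro incseq_SucI le_funI)
      fix k y
      show "?g k y \<le> ?g (Suc k) y"
      proof (cases "y = x")
        case False
        then have "sqdist x y > 0" by (simp add: sqdist_def)
        then have "green (radius k) (sqdist x y) \<le> green (radius (Suc k)) (sqdist x y)"
          by (intro green_antimono radius) simp
        then show ?thesis using False f_nonneg by (auto intro!: ennreal_leI mult_left_mono)
      qed simp
    qed
    fix y
    show "(\<lambda>k. ?g k y) \<longlonglongrightarrow> ?w y"
    proof (cases "y = x")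
      case False
      then have n: "norm (y - x) > 0" by simp
      have "\<forall>\<^sub>F k in sequentially. radius k < norm (y - x)" using order_tendstoD(2)[OF radius(3) n] .
      then have "\<forall>\<^sub>F k in sequentially. ?g k y = ?w y"
      proof eventually_elim
        case (elim k)
        have "(radius k)\<^sup>2 \<le> sqdist x y"
          unfolding sqdist_norm using elim radius(1)[of k] by (intro power_mono) auto
        then have "green (radius k) (sqdist x y) = mass * sqdist x y powr (1 - real CARD('n) / 2)"
          by (intro green_outside radius)
        also have "sqdist x y powr (1 - real CARD('n) / 2) = norm (x - y) powr - (real CARD('n) - 2)"
          using n by (simp add: sqdist_norm powr_powr powr_numeral[symmetric] norm_minus_commute del: powr_numeral)
        finally show ?case by simp
      qed
      then show ?thesis by (rule tendsto_eventually)
    qed simp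
  qed measurable
  moreover have "(\<integral>\<^sup>+y. ?g k y \<partial>lborel) = average (radius k) x" for k
    unfolding average_eq_potential[OF radius(1)] potential_def
    using AE_x by (intro nn_integral_cong_AE) (auto elim!: eventually_mono)
  moreover have "(\<integral>\<^sup>+y. ?w y \<partial>lborel) = newton x"
    unfolding newton_def using AE_x by (intro nn_integral_cong_AE) (auto elim!: eventually_mono)
  ultimately show ?thesis by simp
qed

lemma newton_locally_bounded: "\<exists>M>0. \<forall>x. norm x \<le> r \<longrightarrow> newton x \<le> ennreal M * total"
proof -
  obtain M where M: "M > 0" "AE y in lborel. norm y \<le> r + 1 \<longrightarrow> u y \<le> M" using u_bound by blast
  have "newton x \<le> ennreal M * total" if "norm x \<le> r" for x
  proof (rule LIMSEQ_le_const2[OF average_tendsto_newton])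
    have "average (radius k) x \<le> ennreal M * total" for k
    proof (rule average_le[OF radius(1)])
      show "AE y in lborel. norm (y - x) \<le> radius k \<longrightarrow> u y \<le> M"
        using M(2)
      proof eventually_elim
        case (elim y)
        then show ?case using norm_triangle_sub[of y x] radius(2)[of k] that by auto
      qed
    qed
    then show "\<exists>N. \<forall>k\<ge>N. average (radius k) x \<le> ennreal M * total" by blast
  qed
  with M show ?thesis by blast
qed

lemma average_measurable [measurable]: "average e \<in> borel_measurable borel"
  unfolding average_def[abs_def] by measurable

lemma newton_measurable [measurable]: "newton \<in> borel_measurable borel"
  unfolding newton_def[abs_def] by measurable

end

section \<open>From weak solutions to the integral equation\<close>

context henon_distributional
begin

lemma sqdist_commute: "sqdist x y = sqdist y x"
  by (simp add: sqdist_norm norm_minus_commute)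

text \<open>
  Integrating a mean over a box moves the mollifier to the indicator of the box, and the mollified indicators
  converge off the boundary of the box, which is a null set.
\<close>
lemma newton_box:
  fixes a b :: "real ^ 'n"
  shows "(\<integral>\<^sup>+x. newton x * indicator (box a b) x \<partial>lborel) = (\<integral>\<^sup>+x. ennreal (u x) * total * indicator (box a b) x \<partial>lborel)"
proof -
  let ?D = "box a b"
  define J where "J k y = (\<integral>\<^sup>+x. ennreal (mollifier (radius k) (sqdist x y)) * indicator ?D x \<partial>lborel)" for k y
  have [measurable]: "J k \<in> borel_measurable borel" for k unfolding J_def by measurable
  obtain r where r: "\<And>x. x \<in> ?D \<Longrightarrow> norm x \<le> r" using bounded_box[of a b] unfolding bounded_iff by blast
  obtain M where M: "M > 0" "AE y in lborel. norm y \<le> r + 1 \<longrightarrow> u y \<le> M" using u_bound by blast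
  have [measurable]: "cball (0 :: real ^ 'n) (r + 1) \<in> sets borel" by simp
  have near: "norm (y - x) < radius k" if "mollifier (radius k) (sqdist x y) \<noteq> 0" for x y k
    using mollifier_far[OF radius(1) that] by simp
  have J_le: "J k y \<le> total" for k y
  proof -
    have "J k y \<le> (\<integral>\<^sup>+x. ennreal (mollifier (radius k) (sqdist y x)) \<partial>lborel)"
      unfolding J_def by (intro nn_integral_mono) (auto simp: indicator_def sqdist_commute)
    then show ?thesis using nn_integral_mollifier[OF radius(1)] by simp
  qed
  have J_0: "J k y = 0" if "\<And>x. x \<in> ?D \<Longrightarrow> radius k \<le> norm (y - x)" for k y
  proof -
    have "J k y = (\<integral>\<^sup>+(x :: real ^ 'n). 0 \<partial>lborel)"
      unfolding J_def
    proof (intro nn_integral_cong)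
      fix x :: "real ^ 'n"
      show "ennreal (mollifier (radius k) (sqdist x y)) * indicator ?D x = 0"
        using that[of x] near[of k x y] by (cases "mollifier (radius k) (sqdist x y) = 0"; cases "x \<in> ?D") auto
    qed
    then show ?thesis by simp
  qed
  have J_total: "J k y = total" if "\<And>x. norm (y - x) < radius k \<Longrightarrow> x \<in> ?D" for k y
  proof -
    have "J k y = (\<integral>\<^sup>+x. ennreal (mollifier (radius k) (sqdist y x)) \<partial>lborel)"
      unfolding J_def
    proof (intro nn_integral_cong)
      fix x :: "real ^ 'n"
      show "ennreal (mollifier (radius k) (sqdist x y)) * indicator ?D x = ennreal (mollifier (radius k) (sqdist y x))"
        using that[of x] near[of k x y] unfolding sqdist_commute[of y x]
        by (cases "mollifier (radius k) (sqdist x y) = 0"; cases "x \<in> ?D") auto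
    qed
    then show ?thesis using nn_integral_mollifier[OF radius(1)] by simp
  qed
  have "(\<lambda>k. \<integral>\<^sup>+y. ennreal (u y) * J k y \<partial>lborel) \<longlonglongrightarrow> (\<integral>\<^sup>+y. ennreal (u y) * total * indicator ?D y \<partial>lborel)"
  proof (rule nn_integral_dominated_convergence[where w = "\<lambda>y. ennreal (u y) * total * indicator (cball 0 (r + 1)) y"])
    show "AE y in lborel. ennreal (u y) * J k y \<le> ennreal (u y) * total * indicator (cball 0 (r + 1)) y" for k
    proof (intro AE_I2)
      fix y :: "real ^ 'n"
      show "ennreal (u y) * J k y \<le> ennreal (u y) * total * indicator (cball 0 (r + 1)) y"
      proof (cases "norm y \<le> r + 1")
        case True
        then show ?thesis using J_le by (simp add: mult_left_mono)
      next
        case False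
        have "J k y = 0"
        proof (rule J_0)
          fix x assume "x \<in> ?D"
          then show "radius k \<le> norm (y - x)"
            using r[of x] radius(2)[of k] False norm_triangle_sub[of y x] by simp
        qed
        then show ?thesis by simp
      qed
    qed
    have "(\<integral>\<^sup>+y. ennreal (u y) * total * indicator (cball 0 (r + 1)) y \<partial>lborel) \<le>
      (\<integral>\<^sup>+y. ennreal M * total * indicator (cball (0 :: real ^ 'n) (r + 1)) y \<partial>lborel)"
      using M(2) by (intro nn_integral_mono_AE) (auto simp: indicator_def ennreal_leI mult_right_mono elim!: eventually_mono)
    also have "\<dots> = ennreal M * total * emeasure lborel (cball (0 :: real ^ 'n) (r + 1))"
      by (rule nn_integral_cmult_indicator) simp
    also have "\<dots> < \<infinity>"
      using total_finite emeasure_lborel_cball_finite[of "0 :: real ^ 'n" "r + 1"] by (simp add: ennreal_mult_less_top)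
    finally show "(\<integral>\<^sup>+y. ennreal (u y) * total * indicator (cball 0 (r + 1)) y \<partial>lborel) < \<infinity>" .
    have "frontier ?D \<in> null_sets lborel"
      using negligible_convex_frontier[OF convex_box(2)] by (simp add: negligible_iff_null_sets null_sets_completion_iff)
    then have "AE y in lborel. y \<notin> frontier ?D" by (rule AE_not_in)
    then show "AE y in lborel. (\<lambda>k. ennreal (u y) * J k y) \<longlonglongrightarrow> ennreal (u y) * total * indicator ?D y"
    proof eventually_elim
      case (elim y)
      then consider "y \<in> ?D" | "y \<in> - closure ?D"
        unfolding frontier_def using open_box[of a b] by (auto simp: interior_open)
      then show ?case
      proof cases
        case 1
        then obtain d where d: "d > 0" "ball y d \<subseteq> ?D" using open_box open_contains_ball by blast
        have "\<forall>\<^sub>F k in sequentially. radius k < d" using order_tendstoD(2)[OF radius(3) d(1)] .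
        then have "\<forall>\<^sub>F k in sequentially. ennreal (u y) * J k y = ennreal (u y) * total * indicator ?D y"
        proof eventually_elim
          case (elim k)
          have "J k y = total" by (rule J_total) (use d(2) elim in \<open>auto simp: dist_norm subset_iff\<close>)
          then show ?case using 1 by simp
        qed
        then show ?thesis by (rule tendsto_eventually)
      next
        case 2
        then obtain d where d: "d > 0" "ball y d \<subseteq> - closure ?D" using open_contains_ball[of "- closure ?D"] by auto
        have "\<forall>\<^sub>F k in sequentially. radius k < d" using order_tendstoD(2)[OF radius(3) d(1)] .
        then have "\<forall>\<^sub>F k in sequentially. ennreal (u y) * J k y = ennreal (u y) * total * indicator ?D y"
        proof eventually_elim
          case (elim k)
          have "J k y = 0"
          proof (rule J_0)
            fix x assume "x \<in> ?D"
            then have "x \<in> closure ?D" using closure_subset by blast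
            then have "\<not> norm (y - x) < d" using d(2) by (auto simp: dist_norm subset_iff)
            then show "radius k \<le> norm (y - x)" using elim by simp
          qed
          moreover have "y \<notin> ?D" using 2 closure_subset by blast
          ultimately show ?case by simp
        qed
        then show ?thesis by (rule tendsto_eventually)
      qed
    qed
  qed measurable
  moreover have "(\<integral>\<^sup>+y. ennreal (u y) * J k y \<partial>lborel) = (\<integral>\<^sup>+x. average (radius k) x * indicator ?D x \<partial>lborel)" for k
  proof -
    have "(\<integral>\<^sup>+y. ennreal (u y) * J k y \<partial>lborel) =
      (\<integral>\<^sup>+y. (\<integral>\<^sup>+x. ennreal (u y * mollifier (radius k) (sqdist x y)) * indicator ?D x \<partial>lborel) \<partial>lborel)"
      unfolding J_def using u_pos mollifier_nonneg
      by (intro nn_integral_cong) (simp add: nn_integral_cmult[symmetric] ennreal_mult less_imp_le mult.assoc)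
    also have "\<dots> = (\<integral>\<^sup>+x. (\<integral>\<^sup>+y. ennreal (u y * mollifier (radius k) (sqdist x y)) * indicator ?D x \<partial>lborel) \<partial>lborel)"
      by (rule lborel_pair.Fubini') measurable
    also have "\<dots> = (\<integral>\<^sup>+x. average (radius k) x * indicator ?D x \<partial>lborel)"
      unfolding average_def by (intro nn_integral_cong nn_integral_multc) measurable
    finally show ?thesis .
  qed
  ultimately have lim1: "(\<lambda>k. \<integral>\<^sup>+x. average (radius k) x * indicator ?D x \<partial>lborel) \<longlonglongrightarrow> (\<integral>\<^sup>+y. ennreal (u y) * total * indicator ?D y \<partial>lborel)"
    by simp
  have "(\<lambda>k. \<integral>\<^sup>+x. average (radius k) x * indicator ?D x \<partial>lborel) \<longlonglongrightarrow> (\<integral>\<^sup>+x. newton x * indicator ?D x \<partial>lborel)"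
  proof (rule nn_integral_LIMSEQ)
    show "incseq (\<lambda>k x. average (radius k) x * indicator ?D x)"
      using average_incseq by (auto simp: incseq_def le_fun_def intro!: mult_right_mono)
    show "(\<lambda>k. average (radius k) x * indicator ?D x) \<longlonglongrightarrow> newton x * indicator ?D x" for x
      using average_tendsto_newton[of x] by (cases "x \<in> ?D") auto
  qed measurable
  from LIMSEQ_unique[OF this lim1] show ?thesis .
qed

text \<open>
  The two densities define measures that agree on boxes.
\<close>
lemma newton_AE_eq: "AE x in lborel. newton x = ennreal (u x) * total"
proof (rule sigma_finite_measure.density_unique[OF lborel.sigma_finite_measure_axioms])
  show "density lborel newton = density lborel (\<lambda>x. ennreal (u x) * total)"
  proof (rule measure_eqI_generator_eq)
    let ?E = "range (\<lambda>(a, b). box a b :: (real ^ 'n) set)"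
    let ?A = "\<lambda>n::nat. box (- (real n *\<^sub>R One)) (real n *\<^sub>R One) :: (real ^ 'n) set"
    show "Int_stable ?E" by (auto simp: Int_stable_def box_Int_box)
    show "?E \<subseteq> Pow UNIV" by simp
    show "sets (density lborel newton) = sigma_sets UNIV ?E"
      "sets (density lborel (\<lambda>x. ennreal (u x) * total)) = sigma_sets UNIV ?E"
      by (simp_all add: borel_eq_box)
    show "range ?A \<subseteq> ?E" by auto
    show "(\<Union>i. ?A i) = UNIV" unfolding UN_box_eq_UNIV by auto
    show "emeasure (density lborel newton) X = emeasure (density lborel (\<lambda>x. ennreal (u x) * total)) X" if "X \<in> ?E" for X
      using that newton_box by (auto simp: emeasure_density)
    fix i
    obtain r where r: "\<And>x. x \<in> ?A i \<Longrightarrow> norm x \<le> r"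
      using bounded_box[of "- (real i *\<^sub>R One) :: real ^ 'n" "real i *\<^sub>R One"] unfolding bounded_iff by blast
    obtain M where M: "\<And>x. norm x \<le> r \<Longrightarrow> newton x \<le> ennreal M * total" using newton_locally_bounded by blast
    have "emeasure (density lborel newton) (?A i) = (\<integral>\<^sup>+x. newton x * indicator (?A i) x \<partial>lborel)"
      by (simp add: emeasure_density)
    also have "\<dots> \<le> (\<integral>\<^sup>+x. ennreal M * total * indicator (?A i) x \<partial>lborel)"
      using M r by (intro nn_integral_mono) (auto simp: indicator_def)
    also have "\<dots> = ennreal M * total * emeasure lborel (?A i)" by (rule nn_integral_cmult_indicator) simp
    also have "\<dots> < \<infinity>" using total_finite by (simp add: ennreal_mult_less_top emeasure_lborel_box_finite)
    finally show "emeasure (density lborel newton) (?A i) \<noteq> \<infinity>" by simp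
  qed
qed measurable

text \<open>
  The potential, divided by the total mass of the mollifier, is a representative of \<open>u\<close> for which the integral
  equation holds at every point.
\<close>
lemma riesz_representation: "\<exists>\<kappa> U. riesz_solution \<alpha> p \<kappa> (U :: real ^ 'n \<Rightarrow> real)"
proof -
  define c where "c = enn2real total"
  have c: "total = ennreal c" "c > 0"
    using total_finite total_pos by (auto simp: c_def ennreal_enn2real enn2real_positive_iff)
  define U where "U x = enn2real (newton x) / c" for x
  have fin: "newton x < \<infinity>" for x
  proof -
    obtain M where "newton x \<le> ennreal M * total" using newton_locally_bounded[of "norm x"] by blast
    also have "\<dots> < \<infinity>" using total_finite by (simp add: ennreal_mult_less_top)
    finally show ?thesis .
  qed
  have newtonU: "newton x = ennreal (U x * c)" for x
    using fin[of x] c by (simp add: U_def ennreal_enn2real)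
  have [measurable]: "U \<in> borel_measurable borel" unfolding U_def[abs_def] by measurable
  have U_nonneg: "U x \<ge> 0" for x using c by (simp add: U_def)
  have Uu: "AE x in lborel. U x = u x"
    using newton_AE_eq
  proof eventually_elim
    case (elim x)
    then have "ennreal (U x * c) = ennreal (u x * c)"
      using c u_pos[of x] by (simp add: newtonU ennreal_mult less_imp_le)
    then show ?case using c U_nonneg[of x] u_pos[of x] by (simp add: ennreal_inj less_imp_le)
  qed
  have "riesz_solution \<alpha> p (mass / c) U"
  proof
    show "mass / c > 0" using mass_pos c by simp
    show "U x > 0" for x
    proof (rule ccontr)
      assume "\<not> U x > 0"
      then have "newton x = 0" using U_nonneg[of x] by (simp add: newtonU)
      then have "AE y in lborel. ennreal (f y * (mass * norm (x - y) powr - (real CARD('n) - 2))) = 0"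
        unfolding newton_def by (subst (asm) nn_integral_0_iff_AE) auto
      moreover have "AE y in lborel. y \<noteq> x" "AE y in lborel. y \<noteq> (0 :: real ^ 'n)" by (rule AE_lborel_singleton)+
      ultimately have "AE y in (lborel :: (real ^ 'n) measure). False"
      proof eventually_elim
        case (elim y)
        have "f y > 0" using elim(3) u_pos[of y] by (simp add: f_def)
        then have "f y * (mass * norm (x - y) powr - (real CARD('n) - 2)) > 0" using mass_pos elim(2) by simp
        with elim(1) show ?case by (simp add: ennreal_eq_0_iff)
      qed
      then have "(UNIV :: (real ^ 'n) set) \<in> null_sets lborel" by (subst (asm) AE_iff_null) auto
      then show False by (simp add: null_sets_def)
    qed
    show "\<exists>M. \<forall>x. norm x \<le> r \<longrightarrow> U x \<le> M" for r
    proof -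
      obtain M where M: "M > 0" "\<And>x. norm x \<le> r \<Longrightarrow> newton x \<le> ennreal M * total"
        using newton_locally_bounded by blast
      have "U x \<le> M" if "norm x \<le> r" for x
      proof -
        have "ennreal (U x * c) \<le> ennreal (M * c)" using M(2)[OF that] c M(1) by (simp add: newtonU ennreal_mult)
        then show ?thesis using c M(1) by (subst (asm) ennreal_le_iff) auto
      qed
      then show ?thesis by blast
    qed
    fix x
    have "ennreal (U x) = ennreal (1 / c) * newton x"
      using c U_nonneg[of x] by (simp add: newtonU ennreal_mult[symmetric])
    also have "\<dots> = (\<integral>\<^sup>+y. ennreal (1 / c) * ennreal (f y * (mass * norm (x - y) powr - (real CARD('n) - 2))) \<partial>lborel)"
      unfolding newton_def by (rule nn_integral_cmult[symmetric]) measurable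
    also have "\<dots> = (\<integral>\<^sup>+y. ennreal (mass / c * norm y powr \<alpha> * U y powr p * norm (x - y) powr - (real CARD('n) - 2)) \<partial>lborel)"
    proof (rule nn_integral_cong_AE)
      show "AE y in lborel. ennreal (1 / c) * ennreal (f y * (mass * norm (x - y) powr - (real CARD('n) - 2)))
        = ennreal (mass / c * norm y powr \<alpha> * U y powr p * norm (x - y) powr - (real CARD('n) - 2))"
        using Uu
      proof eventually_elim
        case (elim y)
        have "ennreal (1 / c) * ennreal (f y * (mass * norm (x - y) powr - (real CARD('n) - 2)))
          = ennreal (1 / c * (f y * (mass * norm (x - y) powr - (real CARD('n) - 2))))"
          using c f_nonneg[of y] mass_pos by (intro ennreal_mult[symmetric]) auto
        then show ?case unfolding elim f_def by (simp add: mult_ac)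
      qed
    qed
    finally show "ennreal (U x) = (\<integral>\<^sup>+y. ennreal (mass / c * norm y powr \<alpha> * U y powr p * norm (x - y) powr - (real CARD('n) - 2)) \<partial>lborel)" .
  qed (use dim \<alpha> p in auto)
  then show ?thesis by blast
qed

end

text \<open>
  The representative \<open>v\<close> is Borel measurable and positive everywhere; the value \<open>1\<close> is used on a null set.
\<close>
lemma weak_solution_imp_henon_distributional:
  fixes u :: "real ^ 'n \<Rightarrow> real"
  assumes dim: "CARD('n) \<ge> 3" and \<alpha>: "\<alpha> > -2" and p: "p > 1"
    and sol: "weak_solution \<alpha> p u" and pos: "AE x in lebesgue. u x > 0"
  shows "\<exists>v :: real ^ 'n \<Rightarrow> real. henon_distributional \<alpha> p v"
proof -
  have um: "u \<in> borel_measurable lebesgue" using sol by (auto simp: weak_solution_def Linf_loc_def)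
  obtain Gr where Gr: "has_weak_gradient u Gr"
    "\<And>\<phi>. test_function \<phi> \<Longrightarrow> (\<integral>x. Gr x \<bullet> grad \<phi> x \<partial>lebesgue) = (\<integral>x. norm x powr \<alpha> * u x powr p * \<phi> x \<partial>lebesgue)"
    using sol by (auto simp: weak_solution_def)
  obtain u0 where u0: "u0 \<in> borel_measurable lborel" "AE x in lborel. u x = u0 x"
    using completion_ex_borel_measurable_real[OF um] by blast
  define v where "v x = (if u0 x > 0 then u0 x else 1)" for x
  have [measurable]: "v \<in> borel_measurable borel" using u0(1) unfolding v_def[abs_def] by simp
  have "AE x in lborel. u x > 0" using pos by (simp add: AE_completion_iff)
  with u0(2) have uv: "AE x in lborel. u x = v x" by eventually_elim (simp add: v_def)
  then have uv': "AE x in lebesgue. u x = v x" by (rule AE_completion)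
  have "henon_distributional \<alpha> p v"
  proof
    show "v x > 0" for x by (simp add: v_def)
    show "\<exists>M. AE x in lborel. norm x \<le> r \<longrightarrow> v x \<le> M" for r
    proof -
      have "u \<in> Linf_loc" using sol by (simp add: weak_solution_def)
      then obtain M where "AE x in lebesgue. x \<in> cball 0 r \<longrightarrow> \<bar>u x\<bar> \<le> M"
        unfolding Linf_loc_def using compact_cball by blast
      then have "AE x in lborel. x \<in> cball 0 r \<longrightarrow> \<bar>u x\<bar> \<le> M" by (simp add: AE_completion_iff)
      with uv have "AE x in lborel. norm x \<le> r \<longrightarrow> v x \<le> M" by eventually_elim auto
      then show ?thesis by blast
    qed
    fix G G' G'' :: "real \<Rightarrow> real" and a :: "real ^ 'n" and R :: real
    assume G: "smooth G" "\<And>s. (G has_real_derivative G' s) (at s)" "\<And>s. (G' has_real_derivative G'' s) (at s)"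
      and R: "R > 0" "\<And>s. s \<ge> R\<^sup>2 \<Longrightarrow> G s = 0"
    have smooth': "smooth G'" using smooth_derivative[OF G(1,2)] .
    have smooth'': "smooth G''" using smooth_derivative[OF smooth' G(3)] .
    have [measurable]: "G \<in> borel_measurable borel" "G' \<in> borel_measurable borel" "G'' \<in> borel_measurable borel"
      using G(1) smooth' smooth'' by (auto intro!: borel_measurable_continuous_onI smooth_continuous)
    let ?l = "\<lambda>w x. norm x powr \<alpha> * w x powr p * G ((x - a) \<bullet> (x - a))"
    let ?h = "\<lambda>x. 4 * ((x - a) \<bullet> (x - a)) * G'' ((x - a) \<bullet> (x - a)) + 2 * real CARD('n) * G' ((x - a) \<bullet> (x - a))"
    have vm: "v \<in> borel_measurable lebesgue" by (rule measurable_completion) simp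
    have m1: "(\<lambda>x. norm x powr \<alpha>) \<in> borel_measurable lebesgue"
      "(\<lambda>x. G ((x - a) \<bullet> (x - a))) \<in> borel_measurable lebesgue" "?h \<in> borel_measurable lebesgue"
      by (rule measurable_completion, measurable)+
    have l: "(\<integral>x. ?l u x \<partial>lebesgue) = (\<integral>x. ?l v x \<partial>lebesgue)"
    proof (rule integral_cong_AE)
      show "?l u \<in> borel_measurable lebesgue" "?l v \<in> borel_measurable lebesgue"
        using um vm m1 by measurable
      show "AE x in lebesgue. ?l u x = ?l v x" using uv' by eventually_elim simp
    qed
    have r: "(\<integral>x. u x * ?h x \<partial>lebesgue) = (\<integral>x. v x * ?h x \<partial>lebesgue)"
    proof (rule integral_cong_AE)
      show "(\<lambda>x. u x * ?h x) \<in> borel_measurable lebesgue" "(\<lambda>x. v x * ?h x) \<in> borel_measurable lebesgue"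
        by (rule borel_measurable_times[OF um m1(3)], rule borel_measurable_times[OF vm m1(3)])
      show "AE x in lebesgue. u x * ?h x = v x * ?h x" using uv' by eventually_elim simp
    qed
    have "(\<integral>x. ?l v x \<partial>lborel) = (\<integral>x. ?l v x \<partial>lebesgue)" by (rule integral_completion[symmetric]) measurable
    also have "\<dots> = (\<integral>x. Gr x \<bullet> grad (\<lambda>x. G ((x - a) \<bullet> (x - a))) x \<partial>lebesgue)"
      unfolding l[symmetric] using Gr(2)[OF weak_laplacian_radial(1)[OF G R Gr(1)]] by (rule sym)
    also have "\<dots> = - (\<integral>x. v x * ?h x \<partial>lebesgue)"
      by (simp only: weak_laplacian_radial(2)[OF G R Gr(1), of a] r)
    also have "(\<integral>x. v x * ?h x \<partial>lebesgue) = (\<integral>x. v x * ?h x \<partial>lborel)" by (rule integral_completion) measurable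
    finally show "(\<integral>x. ?l v x \<partial>lborel) = - (\<integral>x. v x * ?h x \<partial>lborel)" .
  qed (use dim \<alpha> p in auto)
  then show ?thesis by blast
qed

theorem theorem1:
  fixes \<alpha> p :: real
  assumes "CARD('n::finite) \<ge> 3"
    and "\<alpha> > -2"
    and "1 < p"
    and "p < (real CARD('n) + 2 * \<alpha> + 2) / (real CARD('n) - 2)"
  shows "\<not> (\<exists>u :: real ^ 'n \<Rightarrow> real. weak_solution \<alpha> p u \<and> (AE x in lebesgue. u x > 0))"
proof
  assume "\<exists>u :: real ^ 'n \<Rightarrow> real. weak_solution \<alpha> p u \<and> (AE x in lebesgue. u x > 0)"
  then obtain v :: "real ^ 'n \<Rightarrow> real" where "henon_distributional \<alpha> p v"
    using weak_solution_imp_henon_distributional[OF assms(1-3)] by blast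
  then interpret henon_distributional \<alpha> p v .
  obtain \<kappa> U where "riesz_solution \<alpha> p \<kappa> (U :: real ^ 'n \<Rightarrow> real)" using riesz_representation by blast
  then interpret riesz: riesz_solution \<alpha> p \<kappa> U .
  have "subcritical_riesz_solution \<alpha> p \<kappa> U"
  proof
    show "(real CARD('n) - 2) * p < real CARD('n) + 2 + 2 * \<alpha>"
      using assms(1,4) by (simp add: field_simps)
  qed
  then show False by (rule subcritical_riesz_solution.no_subcritical_riesz_solution)
qed

end
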